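(* Let $K$ be a local field of positive characteristic, and let $\Psi=\{\psi^1,\dots,\psi^L\}$ and $\Phi=\{\varphi^1,\dots,\varphi^L\}$ be finite families in $L^2(K)$ such that $X(\Psi)$ and $X(\Phi)$ are affine Bessel families. Then $K_{\Psi,\Phi}$ is translation invariant (i.e. $K_{\Psi,\Phi}(\tau_yf,\tau_yg)=K_{\Psi,\Phi}(f,g)$ for all $y\in K$ and all $f,g\in L^2(K)$) if and only if $K_{\Psi,\Phi}=\tilde K_{\Psi,\Phi}$.
   Context: Local field: a field $K$ with a topology that is locally compact, nondiscrete and totally disconnected; here $K$ has characteristic $p>0$. $dx$ is Haar measure on the additive group $K^+$, and the absolute value is defined by $d(\alpha x)=|\alpha|\,dx$, $|0|=0$; it is ultrametric. $\mathfrak{D}=\{x\in K:|x|\le 1\}$ is the ring of integers, $\mathfrak{P}=\{x\in K:|x|<1\}$ the prime ideal, $\mathfrak{D}^*=\mathfrak{D}\setminus\mathfrak{P}$. $\mathfrak{p}$ is a fixed element of maximal absolute value in $\mathfrak{P}$ (prime element). $\mathfrak{D}/\mathfrak{P}\cong GF(q)$ with $q=p^c$, $c\in\mathbb{N}$; Haar measure is normalized so that $\mathfrak{D}$ has measure $1$; then $|\mathfrak{p}|=q^{-1}$. $\mathbb{N}_0=\mathbb{N}\cup\{0\}$. Translation set: fix $1=\epsilon_0,\epsilon_1,\dots,\epsilon_{c-1}\in\mathfrak{D}^*$ whose $GF(p)$-span is isomorphic to $GF(q)\cong\mathfrak{D}/\mathfrak{P}$ (their classes form a basis of $\mathfrak{D}/\mathfrak{P}$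 over $GF(p)$). For $0\le n<q$, write $n=a_0+a_1p+\cdots+a_{c-1}p^{c-1}$ with $0\le a_k<p$, and set $u(n)=(a_0+a_1\epsilon_1+\cdots+a_{c-1}\epsilon_{c-1})\mathfrak{p}^{-1}$. For general $n\ge 0$, write $n=b_0+b_1q+\cdots+b_sq^s$ with $0\le b_k<q$, and set $u(n)=u(b_0)+u(b_1)\mathfrak{p}^{-1}+\cdots+u(b_s)\mathfrak{p}^{-s}$. ($\{u(n):n\in\mathbb{N}_0\}$ is a complete list of distinct coset representatives of $\mathfrak{D}$ in $K^+$.) Operators on $L^2(K)$: for $j\in\mathbb{Z}$, $y\in K$, $\delta_jf(x)=q^{j/2}f(\mathfrak{p}^{-j}x)$ and $\tau_yf(x)=f(x-y)$. For $f\in L^2(K)$, $j\in\mathbb{Z}$, $k\in\mathbb{N}_0$, let $f_{j,k}=\delta_j\tau_{u(k)}f$; let $\tilde f_{j,k}=\delta_j\tau_{u(k)}f$ if $j\ge0$, and $\tilde f_{j,k}=q^{j/2}\tau_{u(k)}\delta_jf$ if $j<0$. The affine system generated by $\Psi$ is the indexed family $X(\Psi)=\{\psi^l_{j,k}:1\le l\le L,\,j\in\mathbb{Z},\,k\in\mathbb{N}_0\}$. It is an affine Bessel family if there is $B>0$ with $\sum_{l=1}^L\sum_{j\in\mathbb{Z}}\sum_{k\in\mathbb{N}_0}|\langle f,\psi^l_{j,k}\rangle|^2\le B\|f\|_2^2$ for all $f\in L^2(K)$. The sesquilinear operators $K_{\Psi,\Phi},\tilde K_{\Psi,\Phi}:L^2(K)\times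 L^2(K)\to\mathbb{C}$ are $$K_{\Psi,\Phi}(f,g)=\sum_{l=1}^L\sum_{j\in\mathbb{Z}}\sum_{k\in\mathbb{N}_0}\langle f,\psi^l_{j,k}\rangle\langle\varphi^l_{j,k},g\rangle,\qquad \tilde K_{\Psi,\Phi}(f,g)=\sum_{l=1}^L\sum_{j\in\mathbb{Z}}\sum_{k\in\mathbb{N}_0}\langle f,\tilde\psi^l_{j,k}\rangle\langle\tilde\varphi^l_{j,k},g\rangle.$$ *)

theory Defs
  imports "HOL-Analysis.Analysis"
begin

class local_field = field + t2_space + topological_ab_group_add + topological_semigroup_mult +
  assumes tendsto_inverse_nhds: "a \<noteq> 0 \<Longrightarrow> (inverse \<longlongrightarrow> inverse a) (nhds a)"
    and locally_compact: "\<exists>U C. open U \<and> compact C \<and> a \<in> U \<and> U \<subseteq> C"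
    and nondiscrete: "\<not> discrete (UNIV :: 'a set)"
    and totally_disconnected: "connected S \<Longrightarrow> a \<in> S \<Longrightarrow> b \<in> S \<Longrightarrow> a = b"

text \<open>Regularity is not listed in the next definition: it is automatic on a local field, whose
  topology is second countable.\<close>

definition additive_haar_measure :: "'a::local_field measure \<Rightarrow> bool" where
  "additive_haar_measure m \<longleftrightarrow>
     sets m = sets borel \<and>
     (\<forall>y. \<forall>E\<in>sets m. emeasure m ((+) y ` E) = emeasure m E) \<and>
     (\<forall>C. compact C \<longrightarrow> emeasure m C < \<infinity>) \<and>
     (\<exists>E\<in>sets m. emeasure m E \<noteq> 0)"

text \<open>\<open>v\<close> is the module of \<open>K\<close>, i.e. \<open>d(\<alpha>x) = v \<alpha> dx\<close>.\<close>

definition haar_absolute_value :: "'a::local_field measure \<Rightarrow> ('a \<Rightarrow> real) \<Rightarrow> bool" where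
  "haar_absolute_value m v \<longleftrightarrow>
     v 0 = 0 \<and>
     (\<forall>\<alpha>. \<alpha> \<noteq> 0 \<longrightarrow> (\<forall>E\<in>sets m. emeasure m ((*) \<alpha> ` E) = ennreal (v \<alpha>) * emeasure m E))"

definition ring_of_integers :: "('a \<Rightarrow> real) \<Rightarrow> 'a set" where
  "ring_of_integers v = {x. v x \<le> 1}"

definition prime_ideal :: "('a \<Rightarrow> real) \<Rightarrow> 'a set" where
  "prime_ideal v = {x. v x < 1}"

definition residue_field :: "('a::ab_group_add \<Rightarrow> real) \<Rightarrow> 'a set set" where
  "residue_field v =
     ring_of_integers v // {(x, y) \<in> ring_of_integers v \<times> ring_of_integers v. x - y \<in> prime_ideal v}"

text \<open>The data fixed throughout: normalised Haar measure \<open>m\<close>, absolute value \<open>v\<close>, prime element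
  \<open>\<pi>\<close>, and \<open>\<epsilon> 0 = 1, \<dots>, \<epsilon> (c - 1)\<close> whose classes form a \<open>GF(p)\<close>-basis of the residue field
  \<open>GF(p ^ c)\<close>. Scalars of \<open>GF(p)\<close> are represented by integers, so that vanishing of a scalar is
  divisibility by \<open>p\<close>.\<close>

locale local_field_data =
  fixes m :: "'a::local_field measure"
    and v :: "'a \<Rightarrow> real"
    and \<pi> :: 'a
    and c :: nat
    and \<epsilon> :: "nat \<Rightarrow> 'a"
  assumes haar: "additive_haar_measure m"
    and abs_value: "haar_absolute_value m v"
    and normalised: "emeasure m (ring_of_integers v) = 1"
    and prime_elt: "\<pi> \<in> prime_ideal v"
    and prime_elt_maximal: "x \<in> prime_ideal v \<Longrightarrow> v x \<le> v \<pi>"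
    and c_pos: "c > 0"
    and card_residue_field: "card (residue_field v) = CHAR('a) ^ c"
    and eps_0: "\<epsilon> 0 = 1"
    and eps_unit: "i < c \<Longrightarrow> \<epsilon> i \<in> ring_of_integers v - prime_ideal v"
    and eps_independent:
      "(\<Sum>i<c. of_int (a i) * \<epsilon> i) \<in> prime_ideal v \<Longrightarrow> i < c \<Longrightarrow> int CHAR('a) dvd a i"
    and eps_spanning:
      "x \<in> ring_of_integers v \<Longrightarrow>
         \<exists>a :: nat \<Rightarrow> int. x - (\<Sum>i<c. of_int (a i) * \<epsilon> i) \<in> prime_ideal v"

definition u_digit :: "'a::field \<Rightarrow> nat \<Rightarrow> (nat \<Rightarrow> 'a) \<Rightarrow> nat \<Rightarrow> 'a" where
  "u_digit \<pi> c \<epsilon> n = (\<Sum>i<c. of_nat (n div CHAR('a) ^ i mod CHAR('a)) * \<epsilon> i) * inverse \<pi>"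

text \<open>All base \<open>q\<close> digits of \<open>n\<close> at positions above \<open>n\<close> vanish (and \<open>u_digit \<pi> c \<epsilon> 0 = 0\<close>), so the
  sum over \<open>k \<le> n\<close> covers the whole expansion.\<close>

definition u :: "'a::field \<Rightarrow> nat \<Rightarrow> (nat \<Rightarrow> 'a) \<Rightarrow> nat \<Rightarrow> 'a" where
  "u \<pi> c \<epsilon> n =
     (let q = CHAR('a) ^ c in \<Sum>k\<le>n. u_digit \<pi> c \<epsilon> (n div q ^ k mod q) * inverse \<pi> ^ k)"

definition translate :: "'a::ab_group_add \<Rightarrow> ('a \<Rightarrow> complex) \<Rightarrow> 'a \<Rightarrow> complex" where
  "translate y f = (\<lambda>x. f (x - y))"

definition q_half_power :: "'a::field itself \<Rightarrow> nat \<Rightarrow> int \<Rightarrow> complex" where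
  "q_half_power _ c j = of_real (real (CHAR('a) ^ c) powr (real_of_int j / 2))"

definition dilate :: "'a::field \<Rightarrow> nat \<Rightarrow> int \<Rightarrow> ('a \<Rightarrow> complex) \<Rightarrow> 'a \<Rightarrow> complex" where
  "dilate \<pi> c j f = (\<lambda>x. q_half_power TYPE('a) c j * f (\<pi> powi (- j) * x))"

definition affine_elt ::
  "'a::field \<Rightarrow> nat \<Rightarrow> (nat \<Rightarrow> 'a) \<Rightarrow> ('a \<Rightarrow> complex) \<Rightarrow> int \<Rightarrow> nat \<Rightarrow> 'a \<Rightarrow> complex" where
  "affine_elt \<pi> c \<epsilon> f j k = dilate \<pi> c j (translate (u \<pi> c \<epsilon> k) f)"

definition quasi_affine_elt ::
  "'a::field \<Rightarrow> nat \<Rightarrow> (nat \<Rightarrow> 'a) \<Rightarrow> ('a \<Rightarrow> complex) \<Rightarrow> int \<Rightarrow> nat \<Rightarrow> 'a \<Rightarrow> complex" where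
  "quasi_affine_elt \<pi> c \<epsilon> f j k =
     (if j \<ge> 0 then dilate \<pi> c j (translate (u \<pi> c \<epsilon> k) f)
      else (\<lambda>x. q_half_power TYPE('a) c j * translate (u \<pi> c \<epsilon> k) (dilate \<pi> c j f) x))"

text \<open>Elements of \<open>L\<^sup>2(K)\<close> are handled through representing functions; everything below depends
  only on almost-everywhere classes.\<close>

definition L2 :: "'a measure \<Rightarrow> ('a \<Rightarrow> complex) set" where
  "L2 m = {f \<in> borel_measurable m. integrable m (\<lambda>x. (cmod (f x))\<^sup>2)}"

definition L2_inner :: "'a measure \<Rightarrow> ('a \<Rightarrow> complex) \<Rightarrow> ('a \<Rightarrow> complex) \<Rightarrow> complex" where
  "L2_inner m f g = (\<integral>x. f x * cnj (g x) \<partial>m)"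

definition L2_norm :: "'a measure \<Rightarrow> ('a \<Rightarrow> complex) \<Rightarrow> real" where
  "L2_norm m f = sqrt (\<integral>x. (cmod (f x))\<^sup>2 \<partial>m)"

text \<open>The sums are taken in \<open>ennreal\<close>, so that divergence gives \<open>\<infinity>\<close> and not \<open>0\<close>.\<close>

definition affine_Bessel_family ::
  "'a::field measure \<Rightarrow> 'a \<Rightarrow> nat \<Rightarrow> (nat \<Rightarrow> 'a) \<Rightarrow> nat \<Rightarrow> (nat \<Rightarrow> 'a \<Rightarrow> complex) \<Rightarrow> bool" where
  "affine_Bessel_family m \<pi> c \<epsilon> L \<Psi> \<longleftrightarrow>
     (\<exists>B>0. \<forall>f\<in>L2 m.
        (\<Sum>l=1..L. \<Sum>\<^sub>\<infinity>j. \<Sum>\<^sub>\<infinity>k.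
           ennreal ((cmod (L2_inner m f (affine_elt \<pi> c \<epsilon> (\<Psi> l) j k)))\<^sup>2))
        \<le> ennreal (B * (L2_norm m f)\<^sup>2))"

definition affine_op ::
  "'a::field measure \<Rightarrow> 'a \<Rightarrow> nat \<Rightarrow> (nat \<Rightarrow> 'a) \<Rightarrow> nat \<Rightarrow> (nat \<Rightarrow> 'a \<Rightarrow> complex) \<Rightarrow>
     (nat \<Rightarrow> 'a \<Rightarrow> complex) \<Rightarrow> ('a \<Rightarrow> complex) \<Rightarrow> ('a \<Rightarrow> complex) \<Rightarrow> complex" where
  "affine_op m \<pi> c \<epsilon> L \<Psi> \<Phi> f g =
     (\<Sum>l=1..L. \<Sum>\<^sub>\<infinity>j. \<Sum>\<^sub>\<infinity>k.
        L2_inner m f (affine_elt \<pi> c \<epsilon> (\<Psi> l) j k) * L2_inner m (affine_elt \<pi> c \<epsilon> (\<Phi> l) j k) g)"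

definition quasi_affine_op ::
  "'a::field measure \<Rightarrow> 'a \<Rightarrow> nat \<Rightarrow> (nat \<Rightarrow> 'a) \<Rightarrow> nat \<Rightarrow> (nat \<Rightarrow> 'a \<Rightarrow> complex) \<Rightarrow>
     (nat \<Rightarrow> 'a \<Rightarrow> complex) \<Rightarrow> ('a \<Rightarrow> complex) \<Rightarrow> ('a \<Rightarrow> complex) \<Rightarrow> complex" where
  "quasi_affine_op m \<pi> c \<epsilon> L \<Psi> \<Phi> f g =
     (\<Sum>l=1..L. \<Sum>\<^sub>\<infinity>j. \<Sum>\<^sub>\<infinity>k.
        L2_inner m f (quasi_affine_elt \<pi> c \<epsilon> (\<Psi> l) j k) *
        L2_inner m (quasi_affine_elt \<pi> c \<epsilon> (\<Phi> l) j k) g)"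

definition translation_invariant ::
  "'a::ab_group_add measure \<Rightarrow> (('a \<Rightarrow> complex) \<Rightarrow> ('a \<Rightarrow> complex) \<Rightarrow> complex) \<Rightarrow> bool" where
  "translation_invariant m T \<longleftrightarrow>
     (\<forall>y. \<forall>f\<in>L2 m. \<forall>g\<in>L2 m. T (translate y f) (translate y g) = T f g)"

end

theory Submission
  imports Defs "HOL-Computational_Algebra.Primes" "HOL-Computational_Algebra.Euclidean_Algorithm"
begin

text \<open>Let \<open>T\<close> be the affine operator. The translation set \<open>\<Lambda> = {u n}\<close> is a subgroup of \<open>K\<close> (this uses
  the characteristic) with \<open>K = \<Lambda> \<oplus> \<DD>\<close> and \<open>\<pi>\<^sup>-\<^sup>1\<Lambda> \<subseteq> \<Lambda>\<close>. At scale \<open>j = -n < 0\<close> the affine system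
  translates by \<open>\<pi>\<^sup>-\<^sup>n\<Lambda>\<close>, the quasi-affine one by \<open>\<Lambda>\<close> with weight \<open>q\<^sup>-\<^sup>n\<close>. Hence averaging
  \<open>T(\<tau>\<^sub>y f, \<tau>\<^sub>y g)\<close> over the \<open>q\<^sup>N\<close> elements \<open>y = u r\<close>, \<open>r < q\<^sup>N\<close>, turns every scale \<open>j \<ge> -N\<close> into its
  quasi-affine counterpart, and the scales \<open>j < -N\<close> contribute an error that tends to \<open>0\<close>: for \<open>f\<close>
  supported in \<open>\<pi>\<^sup>-\<^sup>M\<DD>\<close> the translates with \<open>r < q\<^sup>M\<close> are controlled by the Bessel bound, the other ones
  by Cauchy--Schwarz, since the balls on which \<open>\<psi>\<close> is integrated cover each point at most \<open>N q\<^sup>M\<close>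
  times. If \<open>T\<close> is translation invariant, the averages are constant, so the two operators agree.

  Conversely the quasi-affine operator is invariant under \<open>\<Lambda>\<close>, and \<open>T\<close> under dilations. If they agree,
  then \<open>T\<close> is invariant under all \<open>\<pi>\<^sup>j\<Lambda>\<close>, whose union is dense, and translations are continuous
  in \<open>L\<^sup>2\<close>.\<close>

section \<open>Topology of local fields\<close>

text \<open>The hypotheses supply a topological field and a Haar module \<open>v\<close>: that
  \<open>v\<close> is ultrametric, that its unit ball is open, and that the multiples of this ball
  by powers of \<pi> shrink to \<open>0\<close> must be derived. Positive characteristic enters
  through Frobenius, in the ultrametric inequality, and through digit arithmetic without carries. In
  the coordinates \<open>(j, z)\<close> of the atoms, translating both functions by \<open>y\<close>
  moves \<open>z\<close> by \<open>\<pi> powi (- j) * y\<close>. Each operator becomes a (weighted)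
  sum of one function of \<open>(j, z)\<close>, over different index sets, so averaging turns into
  bookkeeping with cosets. The obstacle is the limit of the averages. For one translate, the scales
  below \<open>- N\<close> have a sum tending to \<open>0\<close>, but the number of translates
  grows like \<open>q ^ N\<close>, and the Bessel bound alone only keeps the average bounded. The
  overlap count gives an error of order \<open>N * q ^ M / q ^ N\<close>: \<open>N\<close> bounds
  the number of scales at which a given point is hit, \<open>q ^ M\<close> counts the unit balls in
  the support of the truncated function. The truncation \<open>M\<close> is fixed before
  \<open>N\<close> grows.\<close>

text \<open>An instance of the tube lemma. It makes stabilizers of compact open sets open, which
  yields the subgroup, the subring and the small multipliers below.\<close>

lemma open_Collect_Ball_compact:
  fixes g :: "'a::topological_space \<times> 'b::topological_space \<Rightarrow> 'c::topological_space"
  assumes "compact C" "open W" "continuous_on UNIV g"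
  shows "open {a. \<forall>h\<in>C. g (a, h) \<in> W}"
proof (subst open_subopen, intro ballI)
  fix a assume a: "a \<in> {a. \<forall>h\<in>C. g (a, h) \<in> W}"
  have "open (g -` W)"
    using assms(2,3) by (simp add: continuous_on_open_vimage)
  moreover have "{a} \<times> C \<subseteq> g -` W"
    using a by auto
  ultimately obtain X where "a \<in> X" "open X" "X \<times> C \<subseteq> g -` W"
    using Elementary_Topology.tube_lemma[OF assms(1)] by metis
  then show "\<exists>T. open T \<and> a \<in> T \<and> T \<subseteq> {a. \<forall>h\<in>C. g (a, h) \<in> W}"
    by (intro exI[of _ X]) auto
qed

lemma continuous_on_mult_local_field: "continuous_on UNIV (\<lambda>p::'a::local_field \<times> 'a. fst p * snd p)"
  by (auto simp: continuous_on_def intro!: tendsto_eq_intros)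

lemma continuous_on_scale: "continuous_on A (\<lambda>x::'a::local_field. a * x)"
  by (auto simp: continuous_on_def intro!: tendsto_eq_intros)

lemma continuous_on_translation: "continuous_on A (\<lambda>x::'a::local_field. a + x)"
  by (auto simp: continuous_on_def intro!: tendsto_eq_intros)

lemma scale_image_eq_vimage: "(a::'a::local_field) \<noteq> 0 \<Longrightarrow> (*) a ` S = (*) (inverse a) -` S"
  by (auto simp: image_iff field_simps intro!: bexI[of _ "inverse a * x" for x])

lemma translation_image_eq_vimage: "(+) (a::'a::local_field) ` S = (+) (- a) -` S"
  by (auto simp: image_iff algebra_simps intro!: bexI[of _ "- a + x" for x])

lemma open_scale: "(a::'a::local_field) \<noteq> 0 \<Longrightarrow> open S \<Longrightarrow> open ((*) a ` S)"
  using continuous_on_scale[of UNIV "inverse a"]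
  by (simp add: scale_image_eq_vimage continuous_on_open_vimage)

lemma open_translate: "open S \<Longrightarrow> open ((+) (a::'a::local_field) ` S)"
  unfolding translation_image_eq_vimage
  by (intro open_vimage continuous_on_translation)

lemma compact_scale: "compact S \<Longrightarrow> compact ((*) (a::'a::local_field) ` S)"
  by (rule compact_continuous_image[OF continuous_on_scale])

lemma not_open_singleton_0: "\<not> open {0::'a::local_field}"
proof
  assume "open {0::'a}"
  then have "open {x}" for x :: 'a
    using open_translate[of "{0}" x] by simp
  then have "discrete (UNIV :: 'a set)"
    by (intro discreteI) (auto simp: isolated_in_def)
  then show False
    using nondiscrete by blast
qed

lemma open_nonzero_element:
  assumes "open U" "(0::'a::local_field) \<in> U"
  obtains x where "x \<in> U" "x \<noteq> 0"
  using assms not_open_singleton_0 by (metis insert_absorb insert_iff subsetI subset_singletonD empty_iff)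

text \<open>Connected sets have at most one point, so the component of \<open>0\<close> is
  \<open>{0}\<close>. In a locally compact Hausdorff space a compact component has arbitrarily small
  clopen neighbourhoods, and one inside the compact \<open>C\<close> is compact.\<close>

lemma compact_open_neighbourhood_0:
  obtains V where "compact V" "open V" "(0::'a::local_field) \<in> V"
proof -
  obtain U C where U: "open U" "compact C" "(0::'a) \<in> U" "U \<subseteq> C"
    using locally_compact by metis
  have 1: "locally_compact_space (euclidean :: 'a topology)"
    unfolding locally_compact_space_def using locally_compact[where ?'a = 'a]
    by simp
  have 2: "{0::'a} \<in> connected_components_of euclidean"
  proof -
    have "y = 0" if y: "connected_component_of euclidean (0::'a) y" for y
    proof -
      obtain T where "connectedin euclidean T" "0 \<in> T" "y \<in> T"
        using y unfolding connected_component_of_def by blast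
      then show ?thesis
        using totally_disconnected[of T y 0] by (simp only: connectedin_iff_connected)
    qed
    moreover have "connected_component_of euclidean (0::'a) 0"
      by (simp only: connected_component_of_refl topspace_euclidean UNIV_I)
    ultimately have "connected_component_of_set euclidean (0::'a) = {0}"
      by blast
    then show ?thesis
      unfolding connected_components_of_def by (metis UNIV_I image_eqI topspace_euclidean)
  qed
  have 3: "Hausdorff_space (euclidean :: 'a topology)"
    unfolding Hausdorff_space_def using hausdorff[where ?'a = 'a] by (auto simp: disjnt_def)
  obtain V W where "openin euclidean V" "openin euclidean W" "disjnt V W" "V \<union> W = topspace euclidean"
    "{0} \<subseteq> V" "V \<subseteq> U"
    using wilder_locally_compact_component_thm[OF 1 3 2, of U] U by auto
  then have "V = - W" "open V" "open W"
    by (auto simp: disjnt_def)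
  then have "compact (C \<inter> V)" 
    using U by (intro compact_Int_closed) (auto simp: closed_def)
  moreover have "C \<inter> V = V"
    using \<open>V \<subseteq> U\<close> U by auto
  ultimately show thesis
    using that[of V] \<open>open V\<close> \<open>{0} \<subseteq> V\<close> by auto
qed

text \<open>The elements that move the compact open set \<open>V\<close> into itself form a clopen
  monoid \<open>S\<close>. Its invertible part is a group, and evaluation at
  \<open>0 \<in> V\<close> puts it inside \<open>V\<close>.\<close>

lemma compact_open_subgroup:
  obtains H where "compact H" "open H" "(0::'a::local_field) \<in> H" "\<And>x y. x \<in> H \<Longrightarrow> y \<in> H \<Longrightarrow> x - y \<in> H"
proof -
  obtain V where V: "compact V" "open V" "(0::'a) \<in> V"
    by (rule compact_open_neighbourhood_0)
  define S where "S = {x. \<forall>h\<in>V. x + h \<in> V}"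
  define H where "H = S \<inter> uminus -` S"
  have "continuous_on UNIV (\<lambda>p::'a \<times> 'a. fst p + snd p)"
    by (auto simp: continuous_on_def intro!: tendsto_eq_intros)
  from open_Collect_Ball_compact[OF V(1,2) this] have "open S"
    by (simp add: S_def)
  moreover have cont: "continuous_on UNIV (uminus :: 'a \<Rightarrow> 'a)"
    by (auto simp: continuous_on_def intro!: tendsto_eq_intros)
  ultimately have "open H"
    unfolding H_def by (auto simp: continuous_on_open_vimage intro!: open_Int)
  have "S = (\<Inter>h\<in>V. (+) h -` V)"
    by (auto simp: S_def add.commute)
  moreover have "closed ((+) h -` V)" for h
    using continuous_on_translation[of UNIV h] V
    by (auto simp: continuous_on_closed_vimage intro: compact_imp_closed)
  ultimately have "closed S"
    by auto
  then have "closed H"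
    unfolding H_def using cont by (auto simp: continuous_on_closed_vimage intro!: closed_Int)
  have "H \<subseteq> V"
    using V(3) by (force simp: H_def S_def)
  then have "compact H"
    using \<open>closed H\<close> V(1) by (metis compact_Int_closed inf.absorb2)
  have S_add: "x + y \<in> S" if "x \<in> S" "y \<in> S" for x y
    using that by (auto simp: S_def add.assoc)
  show thesis
  proof (rule that[OF \<open>compact H\<close> \<open>open H\<close>])
    show "0 \<in> H"
      by (auto simp: H_def S_def)
    show "x - y \<in> H" if "x \<in> H" "y \<in> H" for x y
      using that S_add[of x "- y"] S_add[of "- x" y] by (auto simp: H_def)
  qed
qed

text \<open>\<open>R\<close> is the multiplier ring of the compact open subgroup \<open>H\<close>. A
  nonzero \<open>h \<in> H\<close>, available because the field is not discrete, traps
  \<open>R\<close> inside the compact set \<open>inverse h * H\<close>.\<close>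

lemma compact_open_subring:
  obtains R where "compact R" "open R" "(1::'a::local_field) \<in> R"
    "\<And>x y. x \<in> R \<Longrightarrow> y \<in> R \<Longrightarrow> x - y \<in> R" "\<And>x y. x \<in> R \<Longrightarrow> y \<in> R \<Longrightarrow> x * y \<in> R"
proof -
  obtain H where H: "compact H" "open H" "(0::'a) \<in> H" "\<And>x y. x \<in> H \<Longrightarrow> y \<in> H \<Longrightarrow> x - y \<in> H"
    by (rule compact_open_subgroup) blast
  define R where "R = {a. \<forall>h\<in>H. a * h \<in> H}"
  have "open R"
    using open_Collect_Ball_compact[OF H(1,2) continuous_on_mult_local_field] by (simp add: R_def)
  have "R = (\<Inter>h\<in>H. (*) h -` H)"
    by (auto simp: R_def mult.commute)
  moreover have "closed ((*) h -` H)" for h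
    using continuous_on_scale[of UNIV h] H
    by (auto simp: continuous_on_closed_vimage intro: compact_imp_closed)
  ultimately have "closed R"
    by auto
  obtain h where h: "h \<in> H" "h \<noteq> 0"
    using open_nonzero_element H by metis
  have "R \<subseteq> (*) (inverse h) ` H"
    using h by (subst scale_image_eq_vimage) (auto simp: R_def mult.commute)
  then have "compact R"
    using \<open>closed R\<close> compact_scale[OF H(1)] by (metis compact_Int_closed inf.absorb2)
  moreover have "1 \<in> R" "\<And>x y. x \<in> R \<Longrightarrow> y \<in> R \<Longrightarrow> x - y \<in> R" "\<And>x y. x \<in> R \<Longrightarrow> y \<in> R \<Longrightarrow> x * y \<in> R"
    using H(4) by (auto simp: R_def left_diff_distrib mult.assoc)
  ultimately show thesis
    using that \<open>open R\<close> by blast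
qed

text \<open>If \<open>1 + aR\<close> consists of units, then \<open>a\<close> is nilpotent modulo every open ideal \<open>zR\<close>: as \<open>R / zR\<close> is
  finite, \<open>a\<^sup>i (1 - a\<^sup>k) \<in> zR\<close> for some \<open>i\<close> and \<open>k > 0\<close>.\<close>

lemma topologically_nilpotent_element:
  obtains R a where "compact R" "open R" "(1::'a::local_field) \<in> R"
    "\<And>x y. x \<in> R \<Longrightarrow> y \<in> R \<Longrightarrow> x - y \<in> R" "\<And>x y. x \<in> R \<Longrightarrow> y \<in> R \<Longrightarrow> x * y \<in> R"
    "a \<in> R" "a \<noteq> 0" "\<And>U. open U \<Longrightarrow> 0 \<in> U \<Longrightarrow> \<exists>n. \<forall>x\<in>R. a ^ n * x \<in> U"
proof -
  obtain R where R: "compact R" "open R" "(1::'a) \<in> R"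
    and R_diff: "\<And>x y. x \<in> R \<Longrightarrow> y \<in> R \<Longrightarrow> x - y \<in> R"
    and R_mult: "\<And>x y. x \<in> R \<Longrightarrow> y \<in> R \<Longrightarrow> x * y \<in> R"
    by (rule compact_open_subring) blast
  have R0: "0 \<in> R"
    using R_diff[OF R(3) R(3)] by simp
  have R_uminus: "- x \<in> R" if "x \<in> R" for x
    using R_diff[OF R0 that] by simp
  \<comment> \<open>The multipliers of the compact \<open>R\<close> into \<open>U\<close> form an
    open set containing \<open>0\<close>, and \<open>0\<close> is not isolated.\<close>
  have ideal: "\<exists>w. w \<noteq> 0 \<and> (\<forall>x\<in>R. w * x \<in> U)" if U: "open U" "0 \<in> U" for U
  proof -
    have "open {w. \<forall>x\<in>R. w * x \<in> U}"
      using open_Collect_Ball_compact[OF R(1) U(1) continuous_on_mult_local_field] by simp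
    then show ?thesis
      using U(2) by (elim open_nonzero_element) auto
  qed
  have "eventually (\<lambda>x. inverse x \<in> R) (nhds (1::'a))"
    using tendsto_inverse_nhds[of "1::'a"] R(2,3) by (auto simp: tendsto_def)
  then obtain T where T: "open T" "1 \<in> T" "\<And>x. x \<in> T \<Longrightarrow> inverse x \<in> R"
    unfolding eventually_nhds by auto
  \<comment> \<open>For \<open>x \<in> T'\<close> the element \<open>1 + x\<close> is nonzero with
    inverse in \<open>R\<close>; choosing \<open>a\<close> with \<open>a * R\<close> inside
    \<open>T'\<close> gives the units.\<close>
  define T' where "T' = R \<inter> (+) 1 -` (T - {0})"
  have "open T'"
    unfolding T'_def using continuous_on_translation[of UNIV 1] T R
    by (auto simp: continuous_on_open_vimage intro!: open_Int open_Diff)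
  moreover have "0 \<in> T'"
    using T R0 by (auto simp: T'_def)
  ultimately obtain a where a: "a \<noteq> 0" "\<And>x. x \<in> R \<Longrightarrow> a * x \<in> T'"
    using ideal by metis
  have aR: "a \<in> R"
    using a(2)[OF R(3)] by (simp add: T'_def)
  have pow_R: "a ^ n \<in> R" for n
    by (induction n) (auto intro: R R_mult aR)
  have unit: "1 - a ^ k \<noteq> 0 \<and> inverse (1 - a ^ k) \<in> R" if "k > 0" for k
  proof -
    have "a * - (a ^ (k - 1)) \<in> T'"
      by (rule a(2)[OF R_uminus[OF pow_R]])
    moreover have "a * - (a ^ (k - 1)) = - (a ^ k)"
      using that by (cases k) auto
    ultimately show ?thesis
      using T(3) by (auto simp: T'_def)
  qed
  have "\<exists>n. \<forall>x\<in>R. a ^ n * x \<in> U" if U: "open U" "0 \<in> U" for U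
  proof -
    obtain z where z: "z \<noteq> 0" "\<And>x. x \<in> R \<Longrightarrow> z * x \<in> U"
      using ideal[OF U] by metis
    have "R \<subseteq> (\<Union>x\<in>R. (+) x ` (*) z ` R)"
      using R0 by force
    moreover have "open ((+) x ` (*) z ` R)" for x
      by (intro open_translate open_scale z R)
    ultimately obtain F where F: "F \<subseteq> R" "finite F" "R \<subseteq> (\<Union>x\<in>F. (+) x ` (*) z ` R)"
      using compactE_image[OF R(1), of R "\<lambda>x. (+) x ` (*) z ` R"] by metis
    then have "\<forall>i. \<exists>x\<in>F. \<exists>r\<in>R. a ^ i = x + z * r"
      using pow_R by blast
    then obtain x r where x: "\<And>i::nat. x i \<in> F" "\<And>i. r i \<in> R" "\<And>i. a ^ i = x i + z * r i"
      by metis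
    have "\<not> inj x"
      using F(2) x(1) by (metis finite_subset image_subsetI infinite_UNIV_nat finite_imageD)
    then obtain i j where ij: "i < j" "x i = x j"
      by (metis injI linorder_neqE_nat)
    have "a ^ i - a ^ j = z * (r i - r j)"
      using x(3)[of i] x(3)[of j] ij(2) by (simp add: algebra_simps)
    moreover have "a ^ i - a ^ j = a ^ i * (1 - a ^ (j - i))"
      using ij(1) by (simp add: algebra_simps flip: power_add)
    ultimately have "a ^ i = z * ((r i - r j) * inverse (1 - a ^ (j - i)))"
      using unit[of "j - i"] ij(1) by (simp add: field_simps)
    moreover have "(r i - r j) * inverse (1 - a ^ (j - i)) \<in> R"
      using unit[of "j - i"] ij(1) x(2) by (intro R_mult R_diff) auto
    ultimately have "\<forall>y\<in>R. a ^ i * y \<in> U"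
      using z(2) R_mult by (metis mult.assoc)
    then show ?thesis ..
  qed
  then show thesis
    using that R R_diff R_mult aR a(1) by metis
qed

section \<open>The absolute value\<close>

locale positive_char_local_field = local_field_data m v \<pi> c \<epsilon>
  for m :: "'a::local_field measure" and v :: "'a \<Rightarrow> real" and \<pi> :: 'a and c :: nat and \<epsilon> :: "nat \<Rightarrow> 'a" +
  assumes CHAR_positive: "CHAR('a) > 0"
begin

abbreviation RI :: "'a set" where "RI \<equiv> ring_of_integers v"

lemma mem_RI: "x \<in> RI \<longleftrightarrow> v x \<le> 1"
  by (simp add: ring_of_integers_def)

lemma mem_prime_ideal: "x \<in> prime_ideal v \<longleftrightarrow> v x < 1"
  by (simp add: prime_ideal_def)

section \<open>Multiplicativity of the module of Haar measure\<close>

lemma sets_m: "sets m = sets borel"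
  using haar by (simp add: additive_haar_measure_def)

lemma space_m: "space m = UNIV"
  using sets_eq_imp_space_eq[OF sets_m] by simp

lemma emeasure_translate: "E \<in> sets m \<Longrightarrow> emeasure m ((+) y ` E) = emeasure m E"
  using haar by (auto simp: additive_haar_measure_def)

lemma emeasure_scale: "a \<noteq> 0 \<Longrightarrow> E \<in> sets m \<Longrightarrow> emeasure m ((*) a ` E) = ennreal (v a) * emeasure m E"
  using abs_value by (auto simp: haar_absolute_value_def)

lemma open_sets_m: "open S \<Longrightarrow> S \<in> sets m"
  by (simp add: sets_m)

lemma translation_measurable: "(+) y \<in> measurable m m"
proof -
  have "(+) y \<in> measurable borel borel"
    by (intro borel_measurable_continuous_onI continuous_on_translation)
  then show ?thesis
    by (simp add: measurable_cong_sets[OF sets_m sets_m])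
qed

lemma scale_measurable: "(*) y \<in> measurable m m"
proof -
  have "(*) y \<in> measurable borel borel"
    by (intro borel_measurable_continuous_onI continuous_on_scale)
  then show ?thesis
    by (simp add: measurable_cong_sets[OF sets_m sets_m])
qed

lemma scale_sets: "a \<noteq> 0 \<Longrightarrow> E \<in> sets m \<Longrightarrow> (*) a ` E \<in> sets m"
  using measurable_sets[OF scale_measurable[of "inverse a"], of E]
  by (simp add: scale_image_eq_vimage space_m)

lemma translate_sets: "E \<in> sets m \<Longrightarrow> (+) a ` E \<in> sets m"
  using measurable_sets[OF translation_measurable[of "- a"], of E]
  unfolding translation_image_eq_vimage by (simp add: space_m)

lemma RI_sets: "RI \<in> sets m"
  using normalised emeasure_notin_sets by force

lemma v_0 [simp]: "v 0 = 0"
  using abs_value by (simp add: haar_absolute_value_def)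

lemma emeasure_scale_RI: "a \<noteq> 0 \<Longrightarrow> emeasure m ((*) a ` RI) = ennreal (v a)"
  using emeasure_scale[OF _ RI_sets] normalised by simp

lemma v_pos: "a \<noteq> 0 \<Longrightarrow> v a > 0"
proof -
  assume a: "a \<noteq> 0"
  have "emeasure m ((*) (inverse a) ` (*) a ` RI) = ennreal (v (inverse a)) * ennreal (v a)"
    using a by (simp add: emeasure_scale scale_sets RI_sets normalised)
  also have "(*) (inverse a) ` (*) a ` RI = RI"
    using a by (simp add: image_image mult.assoc[symmetric])
  finally have "ennreal (v a) \<noteq> 0"
    using normalised by auto
  \<comment> \<open>\<open>ennreal\<close> sends every nonpositive real to \<open>0\<close>, so
    nonvanishing already gives the sign.\<close>
  then show "v a > 0"
    by (meson ennreal_neg linorder_not_le nless_le)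
qed

lemma v_nonneg [simp]: "v a \<ge> 0"
  using v_pos[of a] by (cases "a = 0") auto

lemma v_mult: "v (a * b) = v a * v b"
proof (cases "a = 0 \<or> b = 0")
  case False
  have "emeasure m ((*) a ` (*) b ` RI) = ennreal (v a) * ennreal (v b)"
    using False by (simp add: emeasure_scale scale_sets RI_sets normalised)
  moreover have "(*) a ` (*) b ` RI = (*) (a * b) ` RI"
    by (simp add: image_image mult.assoc)
  ultimately have "ennreal (v (a * b)) = ennreal (v a * v b)"
    using emeasure_scale_RI[of "a * b"] False by (simp add: ennreal_mult)
  then show ?thesis
    by (subst (asm) ennreal_inj) auto
qed auto

lemma v_1 [simp]: "v 1 = 1"
  using v_mult[of 1 1] v_pos[of 1] by simp

lemma v_eq_0_iff [simp]: "v a = 0 \<longleftrightarrow> a = 0"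
  by (metis less_irrefl v_0 v_pos)

lemma v_inverse: "v (inverse a) = inverse (v a)"
  using v_mult[of a "inverse a"] by (cases "a = 0") (auto simp: field_simps)

lemma v_divide: "v (a / b) = v a / v b"
  by (simp add: divide_inverse v_mult v_inverse)

lemma v_power: "v (a ^ n) = v a ^ n"
  by (induction n) (auto simp: v_mult)

lemma v_powi: "v (a powi n) = v a powi n"
  by (cases "n \<ge> 0") (auto simp: power_int_def v_power v_inverse)

lemma v_minus_1: "v (- 1) = 1"
proof -
  have "v (- 1) ^ 2 = 1"
    using v_power[of "- 1" 2] by simp
  then show ?thesis
    using v_nonneg[of "- 1"] by (simp add: power2_eq_1_iff)
qed

lemma v_uminus [simp]: "v (- a) = v a"
  using v_mult[of "- 1" a] v_minus_1 by simp

text \<open>\<open>v\<close> comes from measure alone; this ties it to the topology by trapping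
  \<open>RI\<close> between \<open>R\<close> and a multiple of \<open>R\<close>. Comparing the
  measures of \<open>x * R\<close> and \<open>R\<close> gives one inclusion; the other comes from
  compactness of the shell \<open>R - a * R\<close>.\<close>

lemma compact_open_subring_bounds_RI:
  obtains R a N where "compact R" "open R" "(1::'a) \<in> R"
    "\<And>x y. x \<in> R \<Longrightarrow> y \<in> R \<Longrightarrow> x - y \<in> R" "\<And>x y. x \<in> R \<Longrightarrow> y \<in> R \<Longrightarrow> x * y \<in> R"
    "a \<in> R" "a \<noteq> 0" "\<And>U. open U \<Longrightarrow> 0 \<in> U \<Longrightarrow> \<exists>n. \<forall>x\<in>R. a ^ n * x \<in> U"
    "R \<subseteq> RI" "v a < 1" "\<And>x. x \<in> RI \<Longrightarrow> a ^ N * x \<in> R"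
proof -
  obtain R a where R: "compact R" "open R" "(1::'a) \<in> R"
    and R_diff: "\<And>x y. x \<in> R \<Longrightarrow> y \<in> R \<Longrightarrow> x - y \<in> R"
    and R_mult: "\<And>x y. x \<in> R \<Longrightarrow> y \<in> R \<Longrightarrow> x * y \<in> R"
    and a: "a \<in> R" "a \<noteq> 0" 
    and nil: "\<And>U. open U \<Longrightarrow> 0 \<in> U \<Longrightarrow> \<exists>n. \<forall>x\<in>R. a ^ n * x \<in> U"
    by (rule topologically_nilpotent_element) blast
  have R0: "0 \<in> R"
    using R_diff[OF R(3) R(3)] by simp
  have pow_R: "a ^ n \<in> R" for n
    by (induction n) (auto intro: R R_mult a)
  have R_sets: "R \<in> sets m"
    by (intro open_sets_m R)
  have absorb: "\<exists>n. a ^ n * x \<in> R" for x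
  proof -
    have "open ((*) x -` R)"
      by (intro open_vimage continuous_on_scale R)
    then obtain n where "\<forall>y\<in>R. a ^ n * y \<in> (*) x -` R"
      using nil[of "(*) x -` R"] R0 by auto
    then have "x * a ^ n \<in> R"
      using R(3) by force
    then show ?thesis
      by (auto simp: mult.commute)
  qed
  \<comment> \<open>The dilates of \<open>R\<close> by powers of \<open>inverse a\<close> cover the
    field, so a null set \<open>R\<close> would make \<open>RI\<close> null.\<close>
  have R_pos: "emeasure m R > 0"
  proof (rule ccontr)
    assume "\<not> emeasure m R > 0"
    then have "emeasure m R = 0"
      by (simp add: not_gr_zero)
    then have "emeasure m ((*) (inverse (a ^ n)) ` R) = 0" for n
      using a by (simp add: emeasure_scale R_sets)
    then have "emeasure m (\<Union>n. (*) (inverse (a ^ n)) ` R) = 0"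
      using a R_sets by (intro emeasure_UN_eq_0) (auto intro!: scale_sets)
    moreover have "(\<Union>n. (*) (inverse (a ^ n)) ` R) = UNIV"
      using a absorb by (subst scale_image_eq_vimage) auto
    ultimately have "emeasure m RI \<le> 0"
      using emeasure_mono[of RI UNIV m] sets.top[of m] by (simp add: space_m)
    then show False
      using normalised by simp
  qed
  have R_fin: "emeasure m R < \<infinity>"
    using haar R(1) by (simp add: additive_haar_measure_def)
  have cancel: "t \<le> 1" if "ennreal t * emeasure m R \<le> 1 * emeasure m R" for t
  proof -
    obtain s where s: "emeasure m R = ennreal s" "s > 0"
      using R_pos R_fin by (cases "emeasure m R") auto
    show ?thesis
    proof (rule ccontr)
      assume "\<not> t \<le> 1"
      then have "1 * s < t * s"
        using s(2) by (intro mult_strict_right_mono) auto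
      moreover have "ennreal (t * s) \<le> ennreal s"
        using that s \<open>\<not> t \<le> 1\<close> by (simp add: ennreal_mult)
      ultimately show False
        using s(2) by simp
    qed
  qed
  have R_le: "v x \<le> 1" if "x \<in> R" for x
  proof (cases "x = 0")
    case False
    have "ennreal (v x) * emeasure m R = emeasure m ((*) x ` R)"
      using False by (simp add: emeasure_scale R_sets)
    also have "\<dots> \<le> 1 * emeasure m R"
      using that R_mult R_sets by (auto intro!: emeasure_mono)
    finally show ?thesis
      using cancel by simp
  qed simp
  have va: "v a < 1"
  proof -
    \<comment> \<open>Once \<open>1\<close> is outside \<open>a ^ n * R\<close>, this set and its
      translate by \<open>1\<close> are disjoint subsets of \<open>R\<close> of equal measure, so
      \<open>2 * v a ^ n \<le> 1\<close>.\<close>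
    have "open (R - {1})"
      using R by auto
    then obtain n where n: "\<forall>x\<in>R. a ^ n * x \<in> R - {1}"
      using nil[of "R - {1}"] R0 by auto
    define S where "S = (*) (a ^ n) ` R"
    have S_sets: "S \<in> sets m"
      using a by (simp add: S_def scale_sets R_sets)
    have "(+) 1 ` S \<inter> S = {}"
    proof (safe, goal_cases)
      case (1 x y)
      then obtain r r' where r: "r \<in> R" "r' \<in> R" "1 + a ^ n * r = a ^ n * r'"
        by (auto simp: S_def)
      then have "a ^ n * (r' - r) = 1"
        by (simp add: algebra_simps)
      then show ?case
        using n R_diff[OF r(2,1)] by auto
    qed
    then have "emeasure m ((+) 1 ` S \<union> S) = emeasure m S + emeasure m S"
      by (subst plus_emeasure[symmetric]) (auto simp: emeasure_translate S_sets translate_sets)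
    moreover have "(+) 1 ` S \<union> S \<subseteq> R"
      using n R_diff[OF R(3) R_diff[OF R0]] by (auto simp: S_def)
    ultimately have "emeasure m S + emeasure m S \<le> 1 * emeasure m R"
      using emeasure_mono[of "(+) 1 ` S \<union> S" R m] R_sets by simp
    moreover have "emeasure m S = ennreal (v a ^ n) * emeasure m R"
      using a by (simp add: S_def emeasure_scale R_sets v_power)
    ultimately have "ennreal (v a ^ n + v a ^ n) * emeasure m R \<le> 1 * emeasure m R"
      by (subst ennreal_plus) (simp_all add: distrib_right)
    then have "v a ^ n + v a ^ n \<le> 1"
      by (rule cancel)
    then have "v a ^ n < 1"
      using v_nonneg[of a] by linarith
    then show ?thesis
      by (meson linorder_not_le one_le_power)
  qed
  \<comment> \<open>The first power of \<open>a\<close> that brings an element from outside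
    \<open>R\<close> into \<open>R\<close> brings it into this shell.\<close>
  define C where "C = R - (*) a ` R"
  have "compact C"
    unfolding C_def using R a by (intro compact_diff open_scale)
  define W where "W n = - {0} \<inter> inverse -` ((*) (a ^ n) -` R)" for n
  have "open (W n)" for n
  proof -
    have "open ((*) (a ^ n) -` R)"
      by (intro open_vimage continuous_on_scale R)
    moreover have "continuous_on (- {0}) (inverse :: 'a \<Rightarrow> 'a)"
      unfolding continuous_on_def at_within_def
      using filterlim_mono[OF tendsto_inverse_nhds order_refl inf.cobounded1] by blast
    ultimately show ?thesis
      unfolding W_def by (intro continuous_open_preimage) auto
  qed
  moreover have "C \<subseteq> (\<Union>n. W n)"
    using absorb R0 by (auto simp: C_def W_def image_iff)
  ultimately obtain F where F: "finite F" "C \<subseteq> (\<Union>n\<in>F. W n)"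
    using compactE_image[OF \<open>compact C\<close>, of UNIV W] by metis
  define N where "N = Max (insert 0 F)"
  \<comment> \<open>By compactness finitely many exponents \<open>n\<close> suffice to bring
    \<open>a ^ n * inverse x\<close> into \<open>R\<close>, so \<open>v\<close> has one positive
    lower bound on the shell.\<close>
  have v_C: "v a ^ N \<le> v x" if "x \<in> C" for x
  proof -
    obtain n where n: "n \<in> F" "x \<noteq> 0" "a ^ n * inverse x \<in> R"
    proof -
      have "x \<in> (\<Union>n\<in>F. W n)"
        using F(2) \<open>x \<in> C\<close> by (rule subsetD)
      then obtain n where "n \<in> F" "x \<in> W n"
        by blast
      then show thesis
        by (intro that[of n]) (auto simp: W_def)
    qed
    have "v (a ^ n * inverse x) \<le> 1"
      by (rule R_le[OF n(3)])
    then have "v a ^ n * inverse (v x) \<le> 1"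
      by (simp only: v_mult v_power v_inverse)
    then have "v a ^ n \<le> v x"
      using n(2) v_pos[of x] by (simp add: field_simps)
    moreover have "n \<le> N"
      using n F by (auto simp: N_def)
    then have "v a ^ N \<le> v a ^ n"
      using va by (intro power_decreasing) auto
    ultimately show ?thesis
      by simp
  qed
  \<comment> \<open>For the least \<open>n\<close>, either \<open>n = 0\<close> or
    \<open>a ^ n * x\<close> lies in the shell; in the latter case
    \<open>v a ^ N \<le> v a ^ n * v x \<le> v a ^ n\<close>, which forces
    \<open>n \<le> N\<close>.\<close>
  have "a ^ N * x \<in> R" if x: "x \<in> RI" for x
  proof -
    define n where "n = (LEAST n. a ^ n * x \<in> R)"
    have n: "a ^ n * x \<in> R"
      unfolding n_def using absorb by (rule LeastI_ex)
    have "n \<le> N"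
    proof (cases n)
      case (Suc k)
      have "a ^ k * x \<notin> R"
        using Suc not_less_Least[of k "\<lambda>n. a ^ n * x \<in> R"] by (auto simp: n_def)
      then have "a ^ n * x \<in> C"
        using a n Suc by (auto simp: C_def)
      then have "v a ^ N \<le> v a ^ n * v x"
        using v_C by (fastforce simp: v_mult v_power)
      also have "\<dots> \<le> v a ^ n"
        using x by (simp add: mem_RI mult_left_le)
      finally show ?thesis
        using va v_pos[OF a(2)] by (simp add: power_decreasing_iff)
    qed simp
    then have "a ^ N * x = a ^ (N - n) * (a ^ n * x)"
      by (simp flip: mult.assoc power_add)
    then show ?thesis
      using R_mult[OF pow_R n, of "N - n"] by (simp only:)
  qed
  moreover have "R \<subseteq> RI"
    using R_le by (auto simp: mem_RI)
  ultimately show thesis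
    using that[OF R R_diff R_mult a nil _ va] by blast
qed

section \<open>The ultrametric inequality and the unit ball\<close>

lemma prime_CHAR: "prime CHAR('a)"
  using prime_CHAR_semidom CHAR_positive by blast

text \<open>Sums of elements of \<open>\<DD>\<close> are bounded; by Frobenius, so are all \<open>p ^ k\<close>-th powers of such a sum.\<close>

lemma RI_add: assumes "x \<in> RI" "y \<in> RI" shows "x + y \<in> RI"
proof -
  obtain R a N where R: "(1::'a) \<in> R" "\<And>x y. x \<in> R \<Longrightarrow> y \<in> R \<Longrightarrow> x - y \<in> R"
    and a: "a \<noteq> 0" "R \<subseteq> RI" and N: "\<And>x. x \<in> RI \<Longrightarrow> a ^ N * x \<in> R"
    by (rule compact_open_subring_bounds_RI) blast
  have bound: "v (z + w) \<le> inverse (v a ^ N)" if "z \<in> RI" "w \<in> RI" for z w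
  proof -
    have "a ^ N * z - a ^ N * (- w) \<in> R"
      using that by (intro R N) (auto simp: mem_RI)
    then have "a ^ N * (z + w) \<in> RI"
      using a(2) by (auto simp: algebra_simps)
    then have "v a ^ N * v (z + w) \<le> 1"
      by (simp only: mem_RI v_mult v_power)
    then show ?thesis
      using v_pos[OF a(1)] by (simp add: field_simps)
  qed
  have "v (x + y) \<le> 1"
  proof (rule ccontr)
    assume "\<not> v (x + y) \<le> 1"
    then obtain k :: nat where k: "inverse (v a ^ N) < v (x + y) ^ k" and gt: "v (x + y) > 1"
      using real_arch_pow[of "v (x + y)" "inverse (v a ^ N)"] by auto
    have "CHAR('a) > 1"
      using prime_CHAR prime_gt_1_nat by blast
    then have "k \<le> CHAR('a) ^ k"
      using power_gt_expt[of "CHAR('a)" k] by simp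
    then have "v (x + y) ^ k \<le> v (x + y) ^ (CHAR('a) ^ k)"
      using gt by (intro power_increasing) auto
    also have "\<dots> = v (x ^ (CHAR('a) ^ k) + y ^ (CHAR('a) ^ k))"
      by (simp add: freshmans_dream'[OF prime_CHAR] flip: v_power)
    also have "\<dots> \<le> inverse (v a ^ N)"
      using assms by (intro bound) (auto simp: mem_RI v_power power_le_one)
    finally show False
      using k by simp
  qed
  then show ?thesis
    by (simp add: mem_RI)
qed

text \<open>By homogeneity: division by the larger of the two reduces it to
  \<open>RI_add\<close>.\<close>

lemma v_add: "v (x + y) \<le> max (v x) (v y)"
proof -
  have le: "v (x + y) \<le> v y" if "v x \<le> v y" for x y
  proof (cases "y = 0")
    case False
    have "x / y + 1 \<in> RI"
      using that v_pos[OF False] by (intro RI_add) (auto simp: mem_RI v_divide)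
    moreover have "x + y = y * (x / y + 1)"
      using False by (simp add: field_simps)
    ultimately show ?thesis
      by (metis mem_RI mult_left_le v_mult v_nonneg)
  qed (use that in auto)
  show ?thesis
    using le[of x y] le[of y x] by (cases "v x \<le> v y") (auto simp: add.commute)
qed

lemma v_diff: "v (x - y) \<le> max (v x) (v y)"
  using v_add[of x "- y"] by simp

lemma RI_diff: "x \<in> RI \<Longrightarrow> y \<in> RI \<Longrightarrow> x - y \<in> RI"
  using v_diff[of x y] by (auto simp: mem_RI)

lemma RI_uminus: "x \<in> RI \<Longrightarrow> - x \<in> RI"
  by (simp add: mem_RI)

lemma RI_mult: "x \<in> RI \<Longrightarrow> y \<in> RI \<Longrightarrow> x * y \<in> RI"
  by (auto simp: mem_RI v_mult intro: mult_le_one)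

lemma RI_0 [simp]: "0 \<in> RI" and RI_1 [simp]: "1 \<in> RI"
  by (auto simp: mem_RI)

lemma v_less_1_\<pi>: "v \<pi> < 1"
  using prime_elt by (simp add: mem_prime_ideal)

lemma \<pi>_nonzero [simp]: "\<pi> \<noteq> 0"
proof -
  obtain a :: 'a where "a \<noteq> 0" "v a < 1"
    by (rule compact_open_subring_bounds_RI) blast
  then have "0 < v \<pi>"
    using prime_elt_maximal[of a] v_pos[of a] by (simp add: mem_prime_ideal)
  then show ?thesis
    by auto
qed

lemma v_\<pi>_pos: "v \<pi> > 0"
  by (simp add: v_pos)

lemma open_RI: "open RI"
proof -
  obtain R where R: "open R" "R \<subseteq> RI" "(1::'a) \<in> R" "\<And>x y. x \<in> R \<Longrightarrow> y \<in> R \<Longrightarrow> x - y \<in> R"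
    by (rule compact_open_subring_bounds_RI) blast
  have "RI = (\<Union>x\<in>RI. (+) x ` R)"
    using R RI_add R(4)[OF R(3) R(3)] by force
  moreover have "open (\<Union>x\<in>RI. (+) x ` R)"
    by (intro open_UN ballI open_translate R)
  ultimately show ?thesis
    by simp
qed

text \<open>Together with \<open>open_RI\<close> this makes the balls \<open>\<pi> ^ n * RI\<close>
  a neighbourhood base of \<open>0\<close>. It is transported from \<open>a ^ k * R\<close>: if
  \<open>v \<pi> ^ n < v a ^ (k + N)\<close>, the ball lies in
  \<open>a ^ k * (a ^ N * RI)\<close>.\<close>

lemma \<pi>_power_RI_small:
  assumes "open U" "0 \<in> U"
  shows "\<exists>n. \<forall>x\<in>RI. \<pi> ^ n * x \<in> U"
proof -
  obtain R a N where a: "a \<noteq> 0" "\<And>U. open U \<Longrightarrow> 0 \<in> U \<Longrightarrow> \<exists>n. \<forall>x\<in>R. a ^ n * x \<in> U"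
    and N: "\<And>x. x \<in> RI \<Longrightarrow> a ^ N * x \<in> R"
    by (rule compact_open_subring_bounds_RI) blast
  obtain k where k: "\<And>x. x \<in> R \<Longrightarrow> a ^ k * x \<in> U"
    using a(2)[OF assms] by blast
  obtain n where n: "v \<pi> ^ n < v a ^ (k + N)"
    using real_arch_pow_inv[of "v a ^ (k + N)" "v \<pi>"] v_less_1_\<pi> v_pos[OF a(1)] by auto
  have "\<pi> ^ n * x \<in> U" if "x \<in> RI" for x
  proof -
    define y where "y = inverse (a ^ (k + N)) * \<pi> ^ n"
    have "y \<in> RI"
      using n v_pos[OF a(1)] unfolding y_def mem_RI v_mult v_power v_inverse
      by (simp add: field_simps)
    then have "a ^ k * (a ^ N * (y * x)) \<in> U"
      using that by (intro k N RI_mult)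
    moreover have "a ^ k * (a ^ N * (y * x)) = \<pi> ^ n * x"
      using a(1) by (simp add: y_def field_simps power_add)
    ultimately show ?thesis
      by simp
  qed
  then show ?thesis
    by blast
qed

end

section \<open>The translation set\<close>

lemma digits_inj:
  fixes p :: nat
  assumes "n < p ^ k" "n' < p ^ k" "\<And>i. i < k \<Longrightarrow> n div p ^ i mod p = n' div p ^ i mod p"
  shows "n = n'"
  using assms
proof (induction k arbitrary: n n')
  case (Suc k)
  have "n div p = n' div p"
  proof (rule Suc.IH)
    show "n div p < p ^ k" "n' div p < p ^ k"
      using Suc.prems(1,2) by (auto simp: less_mult_imp_div_less mult.commute)
    show "n div p div p ^ i mod p = n' div p div p ^ i mod p" if "i < k" for i
      using Suc.prems(3)[of "Suc i"] that by (simp add: div_mult2_eq)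
  qed
  moreover have "n mod p = n' mod p"
    using Suc.prems(3)[of 0] by simp
  ultimately show ?case
    by (metis div_mult_mod_eq)
qed auto

lemma digits_exist:
  fixes p :: nat
  assumes "\<And>i. i < k \<Longrightarrow> b i < p"
  shows "\<exists>n<p ^ k. \<forall>i<k. n div p ^ i mod p = b i"
  using assms
proof (induction k arbitrary: b)
  case (Suc k)
  then obtain n where n: "n < p ^ k" "\<And>i. i < k \<Longrightarrow> n div p ^ i mod p = b (Suc i)"
    using Suc.IH[of "\<lambda>i. b (Suc i)"] by (meson Suc_less_eq)
  have b0: "b 0 < p"
    using Suc.prems by simp
  have "b 0 + p * n < p ^ Suc k"
  proof -
    have "p * (n + 1) \<le> p * p ^ k"
      using n(1) by (intro mult_left_mono) auto
    then show ?thesis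
      using b0 by simp
  qed
  moreover have "(b 0 + p * n) div p ^ i mod p = b i" if "i < Suc k" for i
    using that b0 n(2) by (cases i) (auto simp: div_mult2_eq)
  ultimately show ?case
    by blast
qed simp

context positive_char_local_field
begin

section \<open>Representatives of the residue field and the value of \<open>v \<pi>\<close>\<close>

definition q :: nat where "q = CHAR('a) ^ c"

lemma q_gt_1: "q > 1"
  unfolding q_def using prime_gt_1_nat[OF prime_CHAR] c_pos by (rule one_less_power)

lemma q_pos [simp]: "q > 0"
  using q_gt_1 by simp

definition residue_rep :: "nat \<Rightarrow> 'a" where
  "residue_rep n = (\<Sum>i<c. of_nat (n div CHAR('a) ^ i mod CHAR('a)) * \<epsilon> i)"

lemma u_digit_eq: "u_digit \<pi> c \<epsilon> n = residue_rep n * inverse \<pi>"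
  by (simp add: u_digit_def residue_rep_def)

lemma residue_rep_RI: "residue_rep n \<in> RI"
proof -
  have of_nat_RI: "of_nat k \<in> RI" for k
    by (induction k) (auto intro: RI_add)
  have sum_RI: "(\<Sum>i\<in>A. f i) \<in> RI" if "finite A" "\<And>i. i \<in> A \<Longrightarrow> f i \<in> RI" for A and f :: "nat \<Rightarrow> 'a"
    using that by (induction A rule: finite_induct) (auto intro: RI_add)
  show ?thesis
    unfolding residue_rep_def using eps_unit by (intro sum_RI RI_mult of_nat_RI) auto
qed

lemma residue_rep_inj:
  assumes "n < q" "n' < q" "residue_rep n - residue_rep n' \<in> prime_ideal v"
  shows "n = n'"
proof (rule digits_inj)
  define a where "a i = int (n div CHAR('a) ^ i mod CHAR('a)) - int (n' div CHAR('a) ^ i mod CHAR('a))" for i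
  have "residue_rep n - residue_rep n' = (\<Sum>i<c. of_int (a i) * \<epsilon> i)"
    by (simp add: residue_rep_def a_def sum_subtractf left_diff_distrib)
  then have dvd: "int CHAR('a) dvd a i" if "i < c" for i
    using eps_independent[OF _ that] assms(3) by simp
  show "n div CHAR('a) ^ i mod CHAR('a) = n' div CHAR('a) ^ i mod CHAR('a)" if "i < c" for i
  proof -
    have "int (n div CHAR('a) ^ i mod CHAR('a)) mod int CHAR('a) = int (n' div CHAR('a) ^ i mod CHAR('a)) mod int CHAR('a)"
      using dvd[OF that] by (simp add: a_def mod_eq_dvd_iff)
    then show ?thesis
      by (metis mod_mod_trivial of_nat_eq_iff of_nat_mod)
  qed
qed (use assms in \<open>auto simp: q_def\<close>)

text \<open>The equality holds in the field itself, not merely modulo the prime ideal: reducing the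
  integer coefficients mod \<open>CHAR('a)\<close> does not change their images.\<close>

lemma residue_rep_exists: "\<exists>n<q. (\<Sum>i<c. of_int (a i) * \<epsilon> i) = residue_rep n"
proof -
  define b where "b i = nat (a i mod int CHAR('a))" for i
  obtain n where n: "n < q" "\<forall>i<c. n div CHAR('a) ^ i mod CHAR('a) = b i"
    using digits_exist[of c b "CHAR('a)"] CHAR_positive by (auto simp: b_def q_def nat_less_iff)
  have "of_nat (b i) = (of_int (a i) :: 'a)" for i
  proof -
    have "of_nat (b i) = (of_int (a i mod int CHAR('a)) :: 'a)"
      using CHAR_positive by (simp add: b_def)
    also have "\<dots> = of_int (a i - int CHAR('a) * (a i div int CHAR('a)))"
      by (simp add: minus_mult_div_eq_mod)
    finally show ?thesis
      by simp
  qed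
  then have "(\<Sum>i<c. of_int (a i) * \<epsilon> i) = residue_rep n"
    unfolding residue_rep_def using n by (intro sum.cong) auto
  then show ?thesis
    using n by blast
qed

lemma residue_rep_approx: "x \<in> RI \<Longrightarrow> \<exists>n<q. x - residue_rep n \<in> prime_ideal v"
  using eps_spanning residue_rep_exists by metis

text \<open>Digit arithmetic therefore never carries; the group property of \<Lambda> depends on
  it.\<close>

lemma residue_rep_diff: "\<exists>k<q. residue_rep n - residue_rep n' = residue_rep k"
  using residue_rep_exists[of "\<lambda>i. int (n div CHAR('a) ^ i mod CHAR('a)) - int (n' div CHAR('a) ^ i mod CHAR('a))"]
  by (simp add: residue_rep_def sum_subtractf left_diff_distrib)

lemma residue_rep_0 [simp]: "residue_rep 0 = 0"
  by (simp add: residue_rep_def)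

lemma prime_ideal_eq: "prime_ideal v = (*) \<pi> ` RI"
proof -
  have "inverse \<pi> * x \<in> RI \<longleftrightarrow> v x < 1" for x
    using prime_elt_maximal[of x] v_less_1_\<pi> v_\<pi>_pos
    unfolding mem_RI mem_prime_ideal v_mult v_inverse by (fastforce simp: field_simps)
  then show ?thesis
    by (subst scale_image_eq_vimage) (auto simp: mem_prime_ideal)
qed

text \<open>\<open>RI\<close> splits into \<open>q\<close> cosets of \<open>\<pi> * RI\<close>, each
  of measure \<open>v \<pi>\<close>.\<close>

lemma v_\<pi>: "v \<pi> = 1 / q"
proof -
  have meas: "(+) (residue_rep n) ` prime_ideal v \<in> sets m" for n
    unfolding prime_ideal_eq by (intro translate_sets scale_sets RI_sets \<pi>_nonzero)
  have "RI = (\<Union>n<q. (+) (residue_rep n) ` prime_ideal v)"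
  proof (intro subset_antisym subsetI)
    fix x assume "x \<in> RI"
    then obtain n where "n < q" "x - residue_rep n \<in> prime_ideal v"
      using residue_rep_approx by blast
    then show "x \<in> (\<Union>n<q. (+) (residue_rep n) ` prime_ideal v)"
      by (intro UN_I[of n] image_eqI[of _ _ "x - residue_rep n"]) auto
  next
    fix x assume "x \<in> (\<Union>n<q. (+) (residue_rep n) ` prime_ideal v)"
    then show "x \<in> RI"
      using residue_rep_RI by (auto simp: mem_RI mem_prime_ideal intro!: RI_add[unfolded mem_RI])
  qed
  moreover have "disjoint_family_on (\<lambda>n. (+) (residue_rep n) ` prime_ideal v) {..<q}"
  proof (unfold disjoint_family_on_def, intro ballI impI)
    fix n n' assume n: "n \<in> {..<q}" "n' \<in> {..<q}" "n \<noteq> n'"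
    have False if "x \<in> prime_ideal v" "y \<in> prime_ideal v" "residue_rep n + x = residue_rep n' + y" for x y
    proof -
      have "residue_rep n - residue_rep n' = y - x"
        using that(3) by (simp add: algebra_simps)
      moreover have "y - x \<in> prime_ideal v"
        using that v_diff[of y x] by (auto simp: mem_prime_ideal)
      ultimately show False
        using residue_rep_inj n by auto
    qed
    then show "(+) (residue_rep n) ` prime_ideal v \<inter> (+) (residue_rep n') ` prime_ideal v = {}"
      by blast
  qed
  ultimately have "emeasure m RI = (\<Sum>n<q. emeasure m ((+) (residue_rep n) ` prime_ideal v))"
    using meas by (subst sum_emeasure) auto
  also have "\<dots> = (\<Sum>n<q. ennreal (v \<pi>))"
    unfolding prime_ideal_eq by (simp add: emeasure_translate scale_sets RI_sets emeasure_scale_RI)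
  also have "\<dots> = ennreal (real q * v \<pi>)"
    by (simp add: ennreal_mult ennreal_of_nat_eq_real_of_nat)
  finally have "real q * v \<pi> = 1"
    using normalised by (metis ennreal_eq_1)
  then show ?thesis
    using q_pos by (simp add: field_simps)
qed

section \<open>Digit expansions and the tiling by unit balls\<close>

abbreviation uu :: "nat \<Rightarrow> 'a" where "uu \<equiv> u \<pi> c \<epsilon>"

text \<open>Frees the expansion from the cut-off at \<open>n\<close> in the definition: the extra
  digits are \<open>0\<close>, so any sufficient number of digits may be chosen. The exponent
  \<open>Suc k\<close> absorbs the \<open>inverse \<pi>\<close> of \<open>u_digit\<close>.\<close>

lemma u_eq_sum:
  assumes "n < q ^ K"
  shows "uu n = (\<Sum>k<K. residue_rep (n div q ^ k mod q) * inverse \<pi> ^ Suc k)"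
proof -
  have zero: "n div q ^ k = 0" if "n < q ^ j" "j \<le> k" for k j
    using that power_increasing[OF that(2), of q] q_pos
    by (intro div_less) linarith
  have "n < q ^ Suc n"
    using power_gt_expt[of q n] power_increasing[of n "Suc n" q] q_gt_1 by linarith
  have eq: "(\<Sum>k<K. residue_rep (n div q ^ k mod q) * inverse \<pi> ^ Suc k) =
      (\<Sum>k<max K (Suc n). residue_rep (n div q ^ k mod q) * inverse \<pi> ^ Suc k)"
    if "n < q ^ K" for K
    using zero[OF that] by (intro sum.mono_neutral_left) auto
  have eq': "(\<Sum>k<Suc n. residue_rep (n div q ^ k mod q) * inverse \<pi> ^ Suc k) =
      (\<Sum>k<max K (Suc n). residue_rep (n div q ^ k mod q) * inverse \<pi> ^ Suc k)"
    using zero[OF \<open>n < q ^ Suc n\<close>] by (intro sum.mono_neutral_left) auto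
  show ?thesis
    unfolding eq[OF assms] eq'[symmetric]
    by (simp add: u_def Let_def u_digit_eq lessThan_Suc_atMost mult.assoc flip: q_def)
qed

lemma uu_0 [simp]: "uu 0 = 0"
  using u_eq_sum[of 0 0] by simp

text \<open>Horner form; with it, facts about digits become inductions that treat the lowest digit
  and pass to \<open>n div q\<close>.\<close>

lemma uu_rec: "uu n = residue_rep (n mod q) * inverse \<pi> + inverse \<pi> * uu (n div q)"
proof -
  have n: "n < q ^ Suc n"
    using power_gt_expt[of q n] power_increasing[of n "Suc n" q] q_gt_1 by linarith
  then have n': "n div q < q ^ n"
    by (simp add: less_mult_imp_div_less mult.commute)
  show ?thesis
    unfolding u_eq_sum[OF n] u_eq_sum[OF n']
    by (subst sum.lessThan_Suc_shift) (simp add: div_mult2_eq sum_distrib_left mult_ac)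
qed

text \<open>Multiplied by \<open>\<pi> ^ k\<close>, it says that \<open>\<pi> ^ k * uu n\<close>
  depends modulo \<Lambda> only on \<open>n mod q ^ k\<close>. This is the source of the periodicity
  used in averaging.\<close>

lemma uu_split: "uu n = uu (n mod q ^ k) + inverse \<pi> ^ k * uu (n div q ^ k)"
proof (induction k arbitrary: n)
  case (Suc k)
  have 1: "n mod q ^ Suc k mod q = n mod q"
    by (simp add: mod_mod_cancel)
  have 2: "n mod q ^ Suc k div q = n div q mod q ^ k"
    by (simp add: mod_mult2_eq)
  have 3: "n div q div q ^ k = n div q ^ Suc k"
    by (simp add: div_mult2_eq)
  show ?case
    using uu_rec[of n] uu_rec[of "n mod q ^ Suc k"] Suc.IH[of "n div q"] unfolding 1 2 3
    by (simp add: algebra_simps)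
qed simp

lemma uu_range_diff: "uu a - uu b \<in> uu ` {..<q ^ N}" if "a < q ^ N" "b < q ^ N"
  using that
proof (induction N arbitrary: a b)
  case (Suc N)
  have "a div q < q ^ N" "b div q < q ^ N"
    using Suc.prems by (auto simp: less_mult_imp_div_less mult.commute)
  then obtain n where n: "n < q ^ N" "uu (a div q) - uu (b div q) = uu n"
    using Suc.IH by blast
  obtain k where k: "k < q" "residue_rep (a mod q) - residue_rep (b mod q) = residue_rep k"
    using residue_rep_diff by blast
  have "k + q * n < q ^ Suc N"
  proof -
    have "q * (n + 1) \<le> q * q ^ N"
      using n(1) by (intro mult_left_mono) auto
    then show ?thesis
      using k by simp
  qed
  moreover have "uu a - uu b = uu (k + q * n)"
  proof -
    have "uu a - uu b = (residue_rep (a mod q) - residue_rep (b mod q)) * inverse \<pi> +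
        inverse \<pi> * (uu (a div q) - uu (b div q))"
      by (subst (1 2) uu_rec) (simp add: algebra_simps)
    then show ?thesis
      using k n by (subst uu_rec) simp
  qed
  ultimately show ?case
    by auto
qed simp

lemma uu_bound: "n < q ^ N \<Longrightarrow> \<pi> ^ N * uu n \<in> RI"
proof (induction N arbitrary: n)
  case (Suc N)
  have "n div q < q ^ N"
    using Suc.prems by (simp add: less_mult_imp_div_less mult.commute)
  then have "\<pi> ^ N * residue_rep (n mod q) + \<pi> ^ N * uu (n div q) \<in> RI"
    using v_less_1_\<pi>
    by (intro RI_add RI_mult residue_rep_RI Suc.IH) (auto simp: mem_RI v_power power_le_one)
  moreover have "\<pi> ^ Suc N * uu n = \<pi> ^ N * residue_rep (n mod q) + \<pi> ^ N * uu (n div q)"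
    by (subst uu_rec) (simp add: field_simps)
  ultimately show ?case
    by simp
qed simp

text \<open>After multiplication by \<pi> the lowest digits are integral, so removing them leaves
  the same situation for the quotients. Once these agree, the lowest digits are congruent modulo the
  prime ideal.\<close>

lemma uu_tile_unique: "uu a - uu b \<in> RI \<Longrightarrow> a = b"
proof (induction "a + b" arbitrary: a b rule: less_induct)
  case less
  show ?case
  proof (cases "a + b = 0")
    case False
    have "\<pi> * (uu a - uu b) = (residue_rep (a mod q) - residue_rep (b mod q)) + (uu (a div q) - uu (b div q))"
      by (subst (1 2) uu_rec) (simp add: field_simps)
    moreover have "\<pi> * (uu a - uu b) \<in> prime_ideal v"
      using less.prems by (simp add: prime_ideal_eq)
    ultimately have *: "(residue_rep (a mod q) - residue_rep (b mod q)) + (uu (a div q) - uu (b div q)) \<in> prime_ideal v"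
      by simp
    then have "((residue_rep (a mod q) - residue_rep (b mod q)) + (uu (a div q) - uu (b div q)))
        - (residue_rep (a mod q) - residue_rep (b mod q)) \<in> RI"
      by (intro RI_diff residue_rep_RI) (auto simp: mem_prime_ideal mem_RI)
    then have "uu (a div q) - uu (b div q) \<in> RI"
      by simp
    moreover have "a div q + b div q < a + b"
      using False q_gt_1 by (cases "a = 0"; cases "b = 0") (auto intro!: add_less_mono div_less_dividend add_less_le_mono)
    ultimately have div_eq: "a div q = b div q"
      using less.hyps by blast
    then have "a mod q = b mod q"
      using * by (intro residue_rep_inj) auto
    then show ?thesis
      using div_eq by (metis div_mult_mod_eq)
  qed auto
qed

text \<open>Multiplication by \<pi> lowers the radius by one power of \<open>q\<close>. The
  induction hypothesis approximates \<open>\<pi> * x\<close> up to \<open>RI\<close>, and a residue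
  representative improves this to the prime ideal, which is \<open>\<pi> * RI\<close>.\<close>

lemma uu_tile_exists: "\<pi> ^ N * x \<in> RI \<Longrightarrow> \<exists>n<q ^ N. x - uu n \<in> RI"
proof (induction N arbitrary: x)
  case (Suc N)
  then have "\<pi> ^ N * (\<pi> * x) \<in> RI"
    by (simp add: mult_ac)
  then obtain n where n: "n < q ^ N" "\<pi> * x - uu n \<in> RI"
    using Suc.IH by blast
  then obtain k where k: "k < q" "\<pi> * x - uu n - residue_rep k \<in> prime_ideal v"
    using residue_rep_approx by blast
  have "k + q * n < q ^ Suc N"
  proof -
    have "q * (n + 1) \<le> q * q ^ N"
      using n(1) by (intro mult_left_mono) auto
    then show ?thesis
      using k by simp
  qed
  moreover have "x - uu (k + q * n) \<in> RI"
  proof -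
    have "\<pi> * (x - uu (k + q * n)) = \<pi> * x - uu n - residue_rep k"
      using k by (subst uu_rec) (simp add: field_simps)
    then have "\<pi> * (x - uu (k + q * n)) \<in> (*) \<pi> ` RI"
      using k by (simp add: prime_ideal_eq)
    then show ?thesis
      by auto
  qed
  ultimately show ?case
    by blast
qed simp

section \<open>The translation group\<close>

definition Lam :: "'a set" where "Lam = range uu"

lemma inj_uu: "inj uu"
  using uu_tile_unique by (intro injI) auto

lemma Lam_diff: "x \<in> Lam \<Longrightarrow> y \<in> Lam \<Longrightarrow> x - y \<in> Lam"
proof -
  assume "x \<in> Lam" "y \<in> Lam"
  then obtain a b where ab: "x = uu a" "y = uu b"
    by (auto simp: Lam_def)
  have "a + b < q ^ (a + b)"
    using power_gt_expt[of q "a + b"] q_gt_1 by simp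
  then show "x - y \<in> Lam"
    using uu_range_diff[of a "a + b" b] ab by (auto simp: Lam_def)
qed

lemma Lam_0 [simp]: "0 \<in> Lam"
  unfolding Lam_def by (metis rangeI uu_0)

lemma Lam_uminus: "x \<in> Lam \<Longrightarrow> - x \<in> Lam"
  using Lam_diff[of 0 x] by simp

lemma Lam_add: "x \<in> Lam \<Longrightarrow> y \<in> Lam \<Longrightarrow> x + y \<in> Lam"
  using Lam_diff[of x "- y"] Lam_uminus by simp

lemma Lam_inverse_\<pi>: "x \<in> Lam \<Longrightarrow> inverse \<pi> ^ k * x \<in> Lam"
proof -
  assume "x \<in> Lam"
  then obtain n where "x = uu n"
    by (auto simp: Lam_def)
  then have "inverse \<pi> ^ k * x = uu (q ^ k * n)"
    using uu_split[of "q ^ k * n" k] by simp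
  then show ?thesis
    by (simp add: Lam_def)
qed

lemma Lam_tile_unique: "x \<in> Lam \<Longrightarrow> y \<in> Lam \<Longrightarrow> x - y \<in> RI \<Longrightarrow> x = y"
  using uu_tile_unique by (auto simp: Lam_def)

lemma exists_\<pi>_power_RI: "\<exists>N. \<pi> ^ N * x \<in> RI"
proof -
  have "open ((*) x -` RI)"
    by (intro open_vimage continuous_on_scale open_RI)
  then obtain n where "\<forall>y\<in>RI. \<pi> ^ n * y \<in> (*) x -` RI"
    using \<pi>_power_RI_small[of "(*) x -` RI"] by auto
  then have "\<pi> ^ n * 1 \<in> (*) x -` RI"
    using RI_1 by blast
  then show ?thesis
    by (auto simp: mult.commute)
qed

lemma \<pi>_power_RI_mono:
  assumes "\<pi> ^ N * x \<in> RI" "N \<le> M"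
  shows "\<pi> ^ M * x \<in> RI"
proof -
  have "\<pi> ^ (M - N) * (\<pi> ^ N * x) \<in> RI"
    by (rule RI_mult[OF _ assms(1)]) (use v_less_1_\<pi> in \<open>simp add: mem_RI v_power power_le_one\<close>)
  moreover have "\<pi> ^ (M - N) * (\<pi> ^ N * x) = \<pi> ^ M * x"
    using assms(2) by (simp flip: mult.assoc power_add)
  ultimately show ?thesis
    by simp
qed

lemma Lam_tile_exists: "\<exists>y\<in>Lam. x - y \<in> RI"
  using exists_\<pi>_power_RI[of x] uu_tile_exists by (auto simp: Lam_def)

text \<open>Some index below \<open>q ^ N\<close> has its point within \<open>RI\<close> of
  \<open>uu n\<close>, and uniqueness of the tile makes it \<open>n\<close>. The order of the
  indices thus measures size, which later places \<open>uu r\<close> with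
  \<open>r \<ge> q ^ M\<close> outside the ball of radius \<open>q ^ M\<close>.\<close>

lemma Lam_RI_bounded_iff: "\<pi> ^ N * uu n \<in> RI \<longleftrightarrow> n < q ^ N"
  using uu_bound uu_tile_exists uu_tile_unique[of n] by blast

end

section \<open>Averaging over translates\<close>

lemma sum_periodic:
  fixes G :: "nat \<Rightarrow> 'b::real_vector"
  assumes "\<And>r. G r = G (r mod k)"
  shows "(\<Sum>r<l * k. G r) = real l *\<^sub>R (\<Sum>r<k. G r)"
proof -
  have "(\<Sum>r = m * k..<m * k + k. G r) = (\<Sum>r<k. G r)" for m
  proof -
    have "(\<Sum>r = m * k..<m * k + k. G r) = (\<Sum>r = 0..<k. G (r + m * k))"
      using sum.shift_bounds_nat_ivl[of G 0 "m * k" k] by (simp add: add.commute)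
    also have "\<dots> = (\<Sum>r<k. G r)"
    proof (rule sum.cong)
      show "G (r + m * k) = G r" for r
        using assms[of "r + m * k"] assms[of r] by simp
    qed auto
    finally show ?thesis .
  qed
  then show ?thesis
    by (simp add: sum.nat_group[symmetric] sum_constant_scaleR)
qed

lemma has_sum_sum_finite:
  fixes f :: "'c \<Rightarrow> 'd \<Rightarrow> 'b::topological_comm_monoid_add"
  assumes "finite I" "\<And>i. i \<in> I \<Longrightarrow> (f i has_sum s i) A"
  shows "((\<lambda>x. \<Sum>i\<in>I. f i x) has_sum (\<Sum>i\<in>I. s i)) A"
  using assms by (induction I rule: finite_induct) (auto intro!: has_sum_add)

lemma infsum_sum_finite:
  fixes f :: "'c \<Rightarrow> 'd \<Rightarrow> 'b::{topological_comm_monoid_add, t2_space}"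
  assumes "finite I" "\<And>i. i \<in> I \<Longrightarrow> f i summable_on A"
  shows "(\<lambda>x. \<Sum>i\<in>I. f i x) summable_on A" and "infsum (\<lambda>x. \<Sum>i\<in>I. f i x) A = (\<Sum>i\<in>I. infsum (f i) A)"
  using has_sum_sum_finite[OF assms(1), where f = f and s = "\<lambda>i. infsum (f i) A" and A = A] assms(2) by (auto simp: has_sum_iff)

lemma infsum_tendsto_exhaustion:
  fixes f :: "'c \<Rightarrow> 'b::banach"
  assumes f: "(\<lambda>x. norm (f x)) summable_on A"
    and A: "\<And>F. finite F \<Longrightarrow> F \<subseteq> A \<Longrightarrow> \<forall>\<^sub>F N in sequentially. F \<subseteq> B N" and BA: "\<And>N::nat. B N \<subseteq> A"
  shows "(\<lambda>N. infsum f (B N)) \<longlonglongrightarrow> infsum f A"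
proof (rule tendstoI)
  fix e :: real assume "e > 0"
  then obtain F where F: "finite F" "F \<subseteq> A" "dist (\<Sum>x\<in>F. norm (f x)) (\<Sum>\<^sub>\<infinity>x\<in>A. norm (f x)) \<le> e / 2"
    using infsum_finite_approximation[OF f, of "e / 2"] by auto
  show "\<forall>\<^sub>F N in sequentially. dist (infsum f (B N)) (infsum f A) < e"
    using A[OF F(1,2)]
  proof eventually_elim
    case (elim N)
    have sum_sub: "(\<lambda>x. norm (f x)) summable_on S" if "S \<subseteq> A" for S
      using summable_on_subset_banach[OF f that] .
    have f': "f summable_on S" if "S \<subseteq> A" for S
      using abs_summable_summable[OF sum_sub[OF that]] .
    have "infsum f A = infsum f (B N) + infsum f (A - B N)"
      using BA[of N] f'[of "B N"] f'[of "A - B N"] infsum_Un_disjoint[of f "B N" "A - B N"]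
      by (simp add: Un_absorb1)
    then have "dist (infsum f (B N)) (infsum f A) = norm (infsum f (A - B N))"
      by (simp add: dist_norm)
    also have "\<dots> \<le> (\<Sum>\<^sub>\<infinity>x\<in>A - B N. norm (f x))"
      by (rule norm_infsum_bound) (rule sum_sub, auto)
    also have "\<dots> \<le> (\<Sum>\<^sub>\<infinity>x\<in>A - F. norm (f x))"
      using elim by (intro infsum_mono2 sum_sub) auto
    also have "\<dots> = (\<Sum>\<^sub>\<infinity>x\<in>A. norm (f x)) - (\<Sum>x\<in>F. norm (f x))"
      using F f by (subst infsum_Diff) auto
    also have "\<dots> \<le> e / 2"
      using F(3) unfolding dist_real_def by linarith
    finally show ?case
      using \<open>e > 0\<close> by simp
  qed
qed

context positive_char_local_field
begin

lemma q_nonzero [simp]: "q \<noteq> 0"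
  using q_pos by linarith

text \<open>The translates of the quasi-affine system in the coordinates \<open>\<pi> powi (- j) * x - z\<close> of the affine
  one, with the weight \<open>q ^ j\<close> of its coefficients for \<open>j < 0\<close>.\<close>

definition LamQ :: "int \<Rightarrow> 'a set" where
  "LamQ j = (if j \<ge> 0 then Lam else (*) (\<pi> powi (- j)) ` Lam)"

definition wt :: "int \<Rightarrow> real" where
  "wt j = (if j \<ge> 0 then 1 else real q powi j)"

lemma wt_nonneg [simp]: "wt j \<ge> 0"
  by (simp add: wt_def)

lemma \<pi>_powi_neg: "j \<ge> 0 \<Longrightarrow> \<pi> powi (- j) = inverse \<pi> ^ nat j"
  by (simp add: power_int_def)

text \<open>For \<open>j \<ge> 0\<close> the shift is by an element of \<Lambda>. For
  \<open>j < 0\<close> the element \<open>\<pi> powi (- j) * y\<close> need not lie in \<Lambda>,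
  but it lies in the enlarged set \<open>LamQ j\<close>; this is what makes the quasi-affine
  operator invariant under \<Lambda>.\<close>

lemma LamQ_shift: "y \<in> Lam \<Longrightarrow> z \<in> LamQ j \<Longrightarrow> z - \<pi> powi (- j) * y \<in> LamQ j"
  by (cases "j \<ge> 0")
     (auto simp: LamQ_def \<pi>_powi_neg Lam_inverse_\<pi> Lam_diff simp flip: right_diff_distrib)

text \<open>The points \<open>\<pi> ^ n * uu r\<close> with \<open>r < q ^ n\<close> represent the
  cosets of \<Lambda> in \<open>LamQ j\<close>. All of them lie in \<open>RI\<close>, so two that
  differ by an element of \<Lambda> coincide; \<open>uu_split\<close> decomposes a given
  point.\<close>

lemma LamQ_decomposition:
  assumes "j = - int n"
  shows "bij_betw (\<lambda>(r, z). z - \<pi> powi (- j) * uu r) ({..<q ^ n} \<times> Lam) (LamQ j)"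
proof -
  have p: "\<pi> powi (- j) = \<pi> ^ n"
    using assms by simp
  have Q: "LamQ j = (*) (\<pi> ^ n) ` Lam"
    using assms by (auto simp: LamQ_def)
  have Q_diff: "x - y \<in> LamQ j" if "x \<in> LamQ j" "y \<in> LamQ j" for x y
    using that Lam_diff by (auto simp: Q simp flip: right_diff_distrib)
  have Q_0: "0 \<in> LamQ j"
    unfolding Q by (rule image_eqI[of _ _ 0]) auto
  have sub: "Lam \<subseteq> LamQ j"
  proof
    fix x assume "x \<in> Lam"
    then show "x \<in> LamQ j"
      unfolding Q using Lam_inverse_\<pi>[of x n]
      by (intro image_eqI[of _ _ "inverse \<pi> ^ n * x"]) (auto simp: field_simps)
  qed
  have "inj_on (\<lambda>(r, z). z - \<pi> powi (- j) * uu r) ({..<q ^ n} \<times> Lam)"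
  proof (rule inj_onI, clarify)
    fix r z r' z' assume r: "r < q ^ n" "r' < q ^ n" and z: "z \<in> Lam" "z' \<in> Lam"
      and eq: "z - \<pi> powi (- j) * uu r = z' - \<pi> powi (- j) * uu r'"
    have eq': "z - z' = \<pi> ^ n * uu r - \<pi> ^ n * uu r'"
      using eq unfolding p by (simp add: algebra_simps)
    have "z = z'"
      using z by (rule Lam_tile_unique) (use eq' r in \<open>auto intro!: RI_diff uu_bound\<close>)
    then show "r = r' \<and> z = z'"
      using eq' inj_uu by (auto dest: injD)
  qed
  moreover have "(\<lambda>(r, z). z - \<pi> powi (- j) * uu r) ` ({..<q ^ n} \<times> Lam) = LamQ j"
  proof (intro subset_antisym subsetI)
    fix x assume "x \<in> (\<lambda>(r, z). z - \<pi> powi (- j) * uu r) ` ({..<q ^ n} \<times> Lam)"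
    then obtain r z where "z \<in> Lam" "x = z - \<pi> ^ n * uu r"
      unfolding p by auto
    moreover have "\<pi> ^ n * uu r \<in> LamQ j"
      unfolding Q Lam_def by blast
    ultimately show "x \<in> LamQ j"
      using sub Q_diff by blast
  next
    fix x assume "x \<in> LamQ j"
    \<comment> \<open>The bijection subtracts the representatives, so the digits to be split are
      those of \<open>- x\<close>.\<close>
    then have "- x \<in> LamQ j"
      using Q_diff[OF Q_0] by simp
    then obtain k where "- x = \<pi> ^ n * uu k"
      by (auto simp: Q Lam_def)
    also have "\<dots> = \<pi> ^ n * uu (k mod q ^ n) + uu (k div q ^ n)"
      by (subst uu_split[of k n]) (simp add: field_simps)
    finally have "- (- x) = - (\<pi> ^ n * uu (k mod q ^ n) + uu (k div q ^ n))"
      by (rule arg_cong)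
    then have "x = - uu (k div q ^ n) - \<pi> ^ n * uu (k mod q ^ n)"
      by simp
    moreover have "- uu (k div q ^ n) \<in> Lam"
      by (intro Lam_uminus) (auto simp: Lam_def)
    ultimately show "x \<in> (\<lambda>(r, z). z - \<pi> powi (- j) * uu r) ` ({..<q ^ n} \<times> Lam)"
      unfolding p by (intro image_eqI[of _ _ "(k mod q ^ n, - uu (k div q ^ n))"]) auto
  qed
  ultimately show ?thesis
    by (simp add: bij_betw_def)
qed

lemma infsum_Lam_shift:
  assumes "y \<in> Lam"
  shows "infsum (\<lambda>z. h (z - y)) Lam = infsum h Lam"
proof -
  have "bij_betw (\<lambda>z. z - y) Lam Lam"
    using Lam_diff assms Lam_add by (intro bij_betwI[where g = "\<lambda>z. z + y"]) auto
  then show ?thesis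
    by (rule infsum_reindex_bij_betw)
qed

text \<open>For \<open>j \<ge> 0\<close> all inner sums agree. For \<open>j = - n\<close> they
  depend only on \<open>r mod q ^ n\<close>, and one period sums \<open>h\<close> once over
  \<open>LamQ j\<close>. There are \<open>q ^ (N - n)\<close> periods, which is
  \<open>q ^ N * wt j\<close>; this needs \<open>n \<le> N\<close>.\<close>

lemma average_fixed_scale:
  fixes h :: "'a \<Rightarrow> 'b::banach"
  assumes summable: "\<And>r. (\<lambda>z. h (z - \<pi> powi (- j) * uu r)) summable_on Lam" and N: "- j \<le> int N"
  shows "h summable_on LamQ j"
    and "(\<Sum>r<q ^ N. \<Sum>\<^sub>\<infinity>z\<in>Lam. h (z - \<pi> powi (- j) * uu r)) = (real (q ^ N) * wt j) *\<^sub>R (\<Sum>\<^sub>\<infinity>z\<in>LamQ j. h z)"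
proof -
  define G where "G r = (\<Sum>\<^sub>\<infinity>z\<in>Lam. h (z - \<pi> powi (- j) * uu r))" for r
  have "h summable_on LamQ j \<and> (\<Sum>r<q ^ N. G r) = (real (q ^ N) * wt j) *\<^sub>R (\<Sum>\<^sub>\<infinity>z\<in>LamQ j. h z)"
  proof (cases "j \<ge> 0")
    case True
    have "G r = infsum h Lam" for r
      unfolding G_def using True by (intro infsum_Lam_shift) (auto simp: \<pi>_powi_neg Lam_def intro!: Lam_inverse_\<pi>[unfolded Lam_def])
    moreover have "h summable_on Lam"
      using summable[of 0] by simp
    ultimately show ?thesis
      using True by (simp add: LamQ_def wt_def sum_constant_scaleR)
  next
    case False
    define n where "n = nat (- j)"
    have j: "j = - int n" "n \<le> N"
      using False N by (auto simp: n_def)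
    have p: "\<pi> powi (- j) = \<pi> ^ n"
      using j by simp
    have G_per: "G r = G (r mod q ^ n)" for r
    proof -
      have "\<pi> ^ n * uu r = \<pi> ^ n * uu (r mod q ^ n) + uu (r div q ^ n)"
        by (subst uu_split[of r n]) (simp add: field_simps)
      then have "G r = (\<Sum>\<^sub>\<infinity>z\<in>Lam. (\<lambda>z. h (z - \<pi> ^ n * uu (r mod q ^ n))) (z - uu (r div q ^ n)))"
        unfolding G_def p by (intro infsum_cong) (simp add: algebra_simps)
      also have "\<dots> = G (r mod q ^ n)"
        unfolding G_def p by (rule infsum_Lam_shift) (auto simp: Lam_def)
      finally show ?thesis .
    qed
    have bij: "bij_betw (\<lambda>(r, z). z - \<pi> powi (- j) * uu r) ({..<q ^ n} \<times> Lam) (LamQ j)"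
      by (rule LamQ_decomposition[OF j(1)])
    have has_sum: "((\<lambda>(r, z). h (z - \<pi> powi (- j) * uu r)) has_sum (\<Sum>r<q ^ n. G r)) ({..<q ^ n} \<times> Lam)"
    proof -
      have "({..<q ^ n} \<times> Lam) = (\<Union>r<q ^ n. Pair r ` Lam)"
        by auto
      moreover have "((\<lambda>(r, z). h (z - \<pi> powi (- j) * uu r)) has_sum (\<Sum>r<q ^ n. G r)) (\<Union>r<q ^ n. Pair r ` Lam)"
      proof (rule sum_has_sum)
        show "((\<lambda>(r, z). h (z - \<pi> powi (- j) * uu r)) has_sum G r) (Pair r ` Lam)" for r
          unfolding G_def using has_sum_infsum[OF summable[of r]]
          by (subst has_sum_reindex) (auto simp: o_def inj_on_def)
      qed auto
      ultimately show ?thesis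
        by simp
    qed
    have "(h has_sum (\<Sum>r<q ^ n. G r)) (LamQ j)"
      using has_sum_reindex_bij_betw[OF bij, of h "\<Sum>r<q ^ n. G r"] has_sum by (simp add: case_prod_unfold)
    then have *: "h summable_on LamQ j" "infsum h (LamQ j) = (\<Sum>r<q ^ n. G r)"
      by (auto simp: has_sum_iff)
    have "real (q ^ N) * wt j = real (q ^ (N - n))"
    proof -
      have "q ^ N = q ^ (N - n) * q ^ n"
        using j(2) by (simp flip: power_add)
      then show ?thesis
        using False j(1) by (simp add: wt_def power_int_minus field_simps)
    qed
    moreover have "(\<Sum>r<q ^ N. G r) = real (q ^ (N - n)) *\<^sub>R (\<Sum>r<q ^ n. G r)"
      using sum_periodic[of G "q ^ n" "q ^ (N - n)", OF G_per] j(2) by (simp flip: power_add)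
    ultimately show ?thesis
      using * by simp
  qed
  then show "h summable_on LamQ j"
    and "(\<Sum>r<q ^ N. \<Sum>\<^sub>\<infinity>z\<in>Lam. h (z - \<pi> powi (- j) * uu r)) = (real (q ^ N) * wt j) *\<^sub>R (\<Sum>\<^sub>\<infinity>z\<in>LamQ j. h z)"
    by (auto simp: G_def)
qed

text \<open>The effect on coefficients of translating the function by \<open>y\<close>, see
  \<open>coef_translate\<close>.\<close>

definition shift :: "'a \<Rightarrow> (int \<Rightarrow> 'a \<Rightarrow> 'b) \<Rightarrow> int \<times> 'a \<Rightarrow> 'b" where
  "shift y P = (\<lambda>(j, z). P j (z - \<pi> powi (- j) * y))"

text \<open>Up to the weight, an inner sum over \<open>LamQ j\<close> is an average of inner sums
  over \<Lambda>, so its summability in \<open>j\<close> is inherited from the affine side. For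
  nonnegative terms this yields summability over pairs.\<close>

lemma average_nonneg:
  fixes P :: "int \<Rightarrow> 'a \<Rightarrow> real"
  assumes nonneg: "\<And>j z. P j z \<ge> 0"
    and summable: "\<And>r. shift (uu r) P summable_on UNIV \<times> Lam"
  shows "(\<lambda>(j, z). wt j * P j z) summable_on Sigma {- int N..} LamQ"
proof -
  have summable_N: "shift (uu r) P summable_on {- int N..} \<times> Lam" for r
    by (rule summable_on_subset_banach[OF summable]) auto
  have fixed: "(\<lambda>z. P j (z - \<pi> powi (- j) * uu r)) summable_on Lam" for j r
    using summable_on_SigmaD1[of "\<lambda>j z. P j (z - \<pi> powi (- j) * uu r)" UNIV "\<lambda>_. Lam" j] summable[of r]
    by (simp add: shift_def)
  show ?thesis
  proof (rule summable_on_SigmaI[where g = "\<lambda>j. wt j * (\<Sum>\<^sub>\<infinity>z\<in>LamQ j. P j z)"])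
    show "((\<lambda>z. case (j, z) of (j, z) \<Rightarrow> wt j * P j z) has_sum wt j * (\<Sum>\<^sub>\<infinity>z\<in>LamQ j. P j z)) (LamQ j)" if "j \<in> {- int N..}" for j
      unfolding prod.case using that by (intro has_sum_cmult_right has_sum_infsum average_fixed_scale(1)[where h = "P j" and N = N, OF fixed]) auto
    have "(\<lambda>j. \<Sum>\<^sub>\<infinity>z\<in>Lam. P j (z - \<pi> powi (- j) * uu r)) summable_on {- int N..}" for r
      by (rule summable_on_Sigma_banach) (use summable_N[of r] in \<open>simp add: shift_def\<close>)
    then have "(\<lambda>j. \<Sum>r<q ^ N. \<Sum>\<^sub>\<infinity>z\<in>Lam. P j (z - \<pi> powi (- j) * uu r)) summable_on {- int N..}"
      by (intro infsum_sum_finite(1)) auto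
    then have "(\<lambda>j. (1 / q ^ N) * (\<Sum>r<q ^ N. \<Sum>\<^sub>\<infinity>z\<in>Lam. P j (z - \<pi> powi (- j) * uu r))) summable_on {- int N..}"
      by (rule summable_on_cmult_right)
    also have "?this \<longleftrightarrow> (\<lambda>j. wt j * (\<Sum>\<^sub>\<infinity>z\<in>LamQ j. P j z)) summable_on {- int N..}"
    proof (rule summable_on_cong)
      show "(1 / q ^ N) * (\<Sum>r<q ^ N. \<Sum>\<^sub>\<infinity>z\<in>Lam. P j (z - \<pi> powi (- j) * uu r)) = wt j * (\<Sum>\<^sub>\<infinity>z\<in>LamQ j. P j z)"
        if "j \<in> {- int N..}" for j
        using average_fixed_scale(2)[where h = "P j" and N = N and j = j, OF fixed] that by simp
    qed
    finally show "(\<lambda>j. wt j * (\<Sum>\<^sub>\<infinity>z\<in>LamQ j. P j z)) summable_on {- int N..}" .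
  qed (use nonneg in auto)
qed

lemma average_sum:
  fixes P :: "int \<Rightarrow> 'a \<Rightarrow> 'b::banach"
  assumes summable: "\<And>r. (\<lambda>x. norm (shift (uu r) P x)) summable_on UNIV \<times> Lam"
  shows "(\<Sum>r<q ^ N. infsum (shift (uu r) P) ({- int N..} \<times> Lam)) =
      real (q ^ N) *\<^sub>R (\<Sum>\<^sub>\<infinity>(j, z)\<in>Sigma {- int N..} LamQ. wt j *\<^sub>R P j z)"
proof -
  have summable_N: "shift (uu r) P summable_on {- int N..} \<times> Lam" for r
    by (rule summable_on_subset_banach[OF abs_summable_summable[OF summable]]) auto
  have fixed: "(\<lambda>z. P j (z - \<pi> powi (- j) * uu r)) summable_on Lam" for j r
  proof (rule abs_summable_summable)
    show "(\<lambda>z. norm (P j (z - \<pi> powi (- j) * uu r))) summable_on Lam"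
      using summable_on_SigmaD1[of "\<lambda>j z. norm (P j (z - \<pi> powi (- j) * uu r))" UNIV "\<lambda>_. Lam" j]
        summable[of r] by (simp add: shift_def case_prod_unfold)
  qed
  have "shift y (\<lambda>j z. norm (P j z)) = (\<lambda>x. norm (shift y P x))" for y
    by (auto simp: shift_def)
  then have "(\<lambda>(j, z). wt j * norm (P j z)) summable_on Sigma {- int N..} LamQ"
    using summable by (intro average_nonneg) auto
  then have summable_Q: "(\<lambda>(j, z). wt j *\<^sub>R P j z) summable_on Sigma {- int N..} LamQ"
    by - (rule abs_summable_summable, simp add: case_prod_unfold)
  have summable_N': "(\<lambda>(j, z). P j (z - \<pi> powi (- j) * uu r)) summable_on {- int N..} \<times> Lam" for r
    using summable_N[of r] by (simp add: shift_def)
  have "(\<Sum>r<q ^ N. infsum (shift (uu r) P) ({- int N..} \<times> Lam)) =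
      (\<Sum>r<q ^ N. \<Sum>\<^sub>\<infinity>j\<in>{- int N..}. \<Sum>\<^sub>\<infinity>z\<in>Lam. P j (z - \<pi> powi (- j) * uu r))"
    by (simp only: infsum_Sigma'_banach[OF summable_N'] shift_def)
  also have "\<dots> = (\<Sum>\<^sub>\<infinity>j\<in>{- int N..}. \<Sum>r<q ^ N. \<Sum>\<^sub>\<infinity>z\<in>Lam. P j (z - \<pi> powi (- j) * uu r))"
    by (rule infsum_sum_finite(2)[symmetric]) (auto intro!: summable_on_Sigma_banach[OF summable_N'])
  also have "\<dots> = (\<Sum>\<^sub>\<infinity>j\<in>{- int N..}. real (q ^ N) *\<^sub>R (\<Sum>\<^sub>\<infinity>z\<in>LamQ j. wt j *\<^sub>R P j z))"
  proof (rule infsum_cong)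
    fix j assume "j \<in> {- int N..}"
    then show "(\<Sum>r<q ^ N. \<Sum>\<^sub>\<infinity>z\<in>Lam. P j (z - \<pi> powi (- j) * uu r)) = real (q ^ N) *\<^sub>R (\<Sum>\<^sub>\<infinity>z\<in>LamQ j. wt j *\<^sub>R P j z)"
      using average_fixed_scale(2)[where h = "P j" and N = N and j = j, OF fixed]
      by (simp add: infsum_scaleR_right)
  qed
  also have "\<dots> = real (q ^ N) *\<^sub>R (\<Sum>\<^sub>\<infinity>(j, z)\<in>Sigma {- int N..} LamQ. wt j *\<^sub>R P j z)"
    by (subst infsum_scaleR_right) (simp only: infsum_Sigma'_banach[OF summable_Q])
  finally show ?thesis .
qed

text \<open>A finite set of pairs involves only scales \<open>j \<ge> - N\<close> for some
  \<open>N\<close>. There the quasi-affine sum is an average of \<open>q ^ N\<close> affine sums,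
  each at most \<open>C\<close>, so the bound does not depend on \<open>N\<close>.\<close>

lemma quasi_summable:
  fixes P :: "int \<Rightarrow> 'a \<Rightarrow> 'b::banach"
  assumes summable: "\<And>r. (\<lambda>x. norm (shift (uu r) P x)) summable_on UNIV \<times> Lam"
    and bound: "\<And>r. (\<Sum>\<^sub>\<infinity>x\<in>UNIV \<times> Lam. norm (shift (uu r) P x)) \<le> C"
  shows "(\<lambda>(j, z). norm (wt j *\<^sub>R P j z)) summable_on Sigma UNIV LamQ"
proof (rule nonneg_bdd_above_summable_on)
  define P' where "P' = (\<lambda>j z. norm (P j z))"
  have shift_P': "shift y P' = (\<lambda>x. norm (shift y P x))" for y
    by (auto simp: shift_def P'_def)
  have "sum (\<lambda>(j, z). norm (wt j *\<^sub>R P j z)) F \<le> C" if F: "F \<subseteq> Sigma UNIV LamQ" "finite F" for F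
  proof -
    define N where "N = nat (Max (insert 0 ((\<lambda>(j, z). - j) ` F)))"
    have "- j \<le> int N" if "(j, z) \<in> F" for j z
    proof -
      have "- j \<le> Max (insert 0 ((\<lambda>(j, z). - j) ` F))"
        using F(2) that by (intro Max_ge) force+
      then show ?thesis
        by (simp add: N_def)
    qed
    then have F': "F \<subseteq> Sigma {- int N..} LamQ"
      using F(1) by (auto simp: subset_eq) (metis add.inverse_inverse neg_le_iff_le)
    have "sum (\<lambda>(j, z). norm (wt j *\<^sub>R P j z)) F = sum (\<lambda>(j, z). wt j * P' j z) F"
      by (simp add: P'_def case_prod_unfold)
    also have "\<dots> \<le> (\<Sum>\<^sub>\<infinity>(j, z)\<in>Sigma {- int N..} LamQ. wt j * P' j z)"
      using F F' summable
      by (intro finite_sum_le_infsum average_nonneg) (auto simp: P'_def shift_P'[unfolded P'_def])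
    also have "\<dots> = (1 / q ^ N) * (\<Sum>r<q ^ N. infsum (shift (uu r) P') ({- int N..} \<times> Lam))"
      using average_sum[of P' N] summable by (simp add: shift_P')
    also have "\<dots> \<le> (1 / q ^ N) * (\<Sum>r<q ^ N. C)"
    proof (intro mult_left_mono sum_mono)
      show "infsum (shift (uu r) P') ({- int N..} \<times> Lam) \<le> C" for r
        using summable[of r] unfolding shift_P'
        by (intro order_trans[OF infsum_mono2 bound[of r]] summable_on_subset_banach[OF summable[of r]]) auto
    qed auto
    also have "\<dots> = C"
      by simp
    finally show ?thesis .
  qed
  then show "bdd_above (sum (\<lambda>(j, z). norm (wt j *\<^sub>R P j z)) ` {F. F \<subseteq> Sigma UNIV LamQ \<and> finite F})"
    by (auto intro!: bdd_aboveI)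
qed auto

text \<open>The scales \<open>j \<ge> - N\<close> average exactly to a truncation of the limit
  series, and the truncations converge because any finite set of pairs has its scales bounded below.
  The remaining scales form \<open>low\<close>, which hypothesis \<open>tail\<close>
  controls.\<close>

lemma average_tendsto:
  fixes P :: "int \<Rightarrow> 'a \<Rightarrow> 'b::banach"
  assumes summable: "\<And>r. (\<lambda>x. norm (shift (uu r) P x)) summable_on UNIV \<times> Lam"
    and bound: "\<And>r. (\<Sum>\<^sub>\<infinity>x\<in>UNIV \<times> Lam. norm (shift (uu r) P x)) \<le> C"
    and tail: "(\<lambda>N. (1 / real (q ^ N)) * (\<Sum>r<q ^ N. \<Sum>\<^sub>\<infinity>x\<in>{..<- int N} \<times> Lam. norm (shift (uu r) P x))) \<longlonglongrightarrow> 0"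
  shows "(\<lambda>N. (1 / real (q ^ N)) *\<^sub>R (\<Sum>r<q ^ N. infsum (shift (uu r) P) (UNIV \<times> Lam)))
    \<longlonglongrightarrow> (\<Sum>\<^sub>\<infinity>(j, z)\<in>Sigma UNIV LamQ. wt j *\<^sub>R P j z)"
proof -
  have sub: "(\<lambda>x. norm (shift (uu r) P x)) summable_on S" if "S \<subseteq> UNIV \<times> Lam" for r S
    using summable_on_subset_banach[OF summable that] .
  have sub': "shift (uu r) P summable_on S" if "S \<subseteq> UNIV \<times> Lam" for r S
    using abs_summable_summable[OF sub[OF that]] .
  define low where "low N = (1 / real (q ^ N)) *\<^sub>R (\<Sum>r<q ^ N. infsum (shift (uu r) P) ({..<- int N} \<times> Lam))" for N
  have "norm (low N) \<le> (1 / real (q ^ N)) * (\<Sum>r<q ^ N. \<Sum>\<^sub>\<infinity>x\<in>{..<- int N} \<times> Lam. norm (shift (uu r) P x))" for N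
    unfolding low_def norm_scaleR
    by (intro mult_mono order_trans[OF norm_sum sum_mono] norm_infsum_bound sub) auto
  then have "low \<longlonglongrightarrow> 0"
    by (intro Lim_null_comparison[OF _ tail]) auto
  moreover have "(\<lambda>N. \<Sum>\<^sub>\<infinity>(j, z)\<in>Sigma {- int N..} LamQ. wt j *\<^sub>R P j z) \<longlonglongrightarrow> (\<Sum>\<^sub>\<infinity>(j, z)\<in>Sigma UNIV LamQ. wt j *\<^sub>R P j z)"
  proof (rule infsum_tendsto_exhaustion)
    show "(\<lambda>x. norm (case x of (j, z) \<Rightarrow> wt j *\<^sub>R P j z)) summable_on Sigma UNIV LamQ"
      using quasi_summable[OF summable bound] by (simp add: case_prod_unfold)
    fix F assume F: "finite F" "F \<subseteq> Sigma UNIV LamQ"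
    have "\<forall>\<^sub>F N in sequentially. - fst x \<le> int N" for x :: "int \<times> 'a"
      using eventually_ge_at_top[of "nat (- fst x)"] by eventually_elim auto
    then have "\<forall>\<^sub>F N in sequentially. \<forall>x\<in>F. - fst x \<le> int N"
      using F(1) by (simp add: eventually_ball_finite)
    then show "\<forall>\<^sub>F N in sequentially. F \<subseteq> Sigma {- int N..} LamQ"
      by eventually_elim (use F in force)
  qed auto
  ultimately have "(\<lambda>N. (\<Sum>\<^sub>\<infinity>(j, z)\<in>Sigma {- int N..} LamQ. wt j *\<^sub>R P j z) + low N) \<longlonglongrightarrow> (\<Sum>\<^sub>\<infinity>(j, z)\<in>Sigma UNIV LamQ. wt j *\<^sub>R P j z) + 0"
    by (intro tendsto_add)
  moreover have "(\<Sum>\<^sub>\<infinity>(j, z)\<in>Sigma {- int N..} LamQ. wt j *\<^sub>R P j z) + low N =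
      (1 / real (q ^ N)) *\<^sub>R (\<Sum>r<q ^ N. infsum (shift (uu r) P) (UNIV \<times> Lam))" for N
  proof -
    have "infsum (shift (uu r) P) (UNIV \<times> Lam) =
        infsum (shift (uu r) P) ({- int N..} \<times> Lam) + infsum (shift (uu r) P) ({..<- int N} \<times> Lam)" for r
    proof -
      have "(UNIV :: int set) \<times> Lam = {- int N..} \<times> Lam \<union> {..<- int N} \<times> Lam"
        by auto
      then show ?thesis
        by (simp only:) (intro infsum_Un_disjoint sub'; auto)
    qed
    then show ?thesis
      using average_sum[OF summable, of N] by (simp add: low_def sum.distrib scaleR_right_distrib)
  qed
  ultimately show ?thesis
    by simp
qed

lemma quasi_sum_shift:
  assumes "y \<in> Lam"
  shows "(\<Sum>\<^sub>\<infinity>(j, z)\<in>Sigma UNIV LamQ. wt j *\<^sub>R shift y P (j, z)) = (\<Sum>\<^sub>\<infinity>(j, z)\<in>Sigma UNIV LamQ. wt j *\<^sub>R P j z)"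
proof -
  have "bij_betw (\<lambda>(j, z). (j, z - \<pi> powi (- j) * y)) (Sigma UNIV LamQ) (Sigma UNIV LamQ)"
    using LamQ_shift[OF assms] LamQ_shift[OF Lam_uminus[OF assms]]
    by (intro bij_betwI[where g = "\<lambda>(j, z). (j, z + \<pi> powi (- j) * y)"]) auto
  from infsum_reindex_bij_betw[OF this, of "\<lambda>(j, z). wt j *\<^sub>R P j z"] show ?thesis
    by (simp add: shift_def case_prod_unfold)
qed

end

section \<open>Square-integrable functions and wavelet coefficients\<close>

text \<open>Optimising in \<open>t\<close> recovers a product bound from a sum bound. It serves both
  for the Cauchy-Schwarz inequality of integrals and for the bound on the affine form.\<close>

lemma square_le_if_all_scalings:
  fixes X a b :: real
  assumes "\<And>t. t > 0 \<Longrightarrow> 2 * X \<le> t * a + b / t" "X \<ge> 0" "a \<ge> 0" "b \<ge> 0"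
  shows "X\<^sup>2 \<le> a * b"
proof (cases "X = 0")
  case False
  then have X: "X > 0"
    using assms by simp
  show ?thesis
  proof (cases "a = 0")
    case True
    \<comment> \<open>With \<open>a = 0\<close> a large \<open>t\<close> contradicts
      \<open>X > 0\<close>; this one already gives \<open>b / t \<le> X\<close>.\<close>
    have "2 * X \<le> b / ((b + 1) / X)"
      using assms(1)[of "(b + 1) / X"] True X assms(4) by simp
    also have "\<dots> \<le> X"
      using X assms(4) by (simp add: field_simps)
    finally show ?thesis
      using X by simp
  next
    case False
    \<comment> \<open>The choice \<open>t = X / a\<close> turns the first term on the right into
      \<open>X\<close>.\<close>
    then have "2 * X \<le> X / a * a + b / (X / a)"
      using assms(1)[of "X / a"] X assms(3) by simp
    then have "X \<le> a * b / X"
      using False by (simp add: mult.commute)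
    then show ?thesis
      using X by (simp add: field_simps power2_eq_square)
  qed
qed (use assms in auto)

lemma two_mult_le_scaled_squares:
  fixes a b t :: real
  assumes "t > 0"
  shows "2 * (a * b) \<le> t * a\<^sup>2 + b\<^sup>2 / t"
proof -
  have "0 \<le> (t * a - b)\<^sup>2 / t"
    using assms by simp
  also have "\<dots> = t * a\<^sup>2 + b\<^sup>2 / t - 2 * (a * b)"
    using assms by (simp add: power2_eq_square field_simps)
  finally show ?thesis
    by simp
qed

section \<open>Square-integrable functions over a general measure\<close>

definition energy :: "'a measure \<Rightarrow> ('a \<Rightarrow> complex) \<Rightarrow> real" where
  "energy M f = (\<integral>x. (cmod (f x))\<^sup>2 \<partial>M)"

lemma energy_nonneg [simp]: "energy M f \<ge> 0"
  by (simp add: energy_def)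

lemma L2_norm_square: "(L2_norm M f)\<^sup>2 = energy M f"
  by (simp add: L2_norm_def energy_def)

lemma L2_measurable: "f \<in> L2 M \<Longrightarrow> f \<in> borel_measurable M"
  by (simp add: L2_def)

lemma L2_integrable_square: "f \<in> L2 M \<Longrightarrow> integrable M (\<lambda>x. (cmod (f x))\<^sup>2)"
  by (simp add: L2_def)

lemma borel_measurable_cnj:
  assumes "g \<in> borel_measurable M" shows "(\<lambda>x. cnj (g x)) \<in> borel_measurable M"
  by (rule measurable_compose[OF assms borel_measurable_continuous_onI]) (intro continuous_intros)

lemma L2_integrable_mult:
  assumes "f \<in> L2 M" "g \<in> L2 M"
  shows "integrable M (\<lambda>x. f x * cnj (g x))"
proof (rule Bochner_Integration.integrable_bound)
  show "integrable M (\<lambda>x. (cmod (f x))\<^sup>2 + (cmod (g x))\<^sup>2)"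
    using assms by (intro Bochner_Integration.integrable_add L2_integrable_square)
  have "norm (a * cnj b) \<le> norm ((cmod a)\<^sup>2 + (cmod b)\<^sup>2)" for a b
  proof -
    have "2 * (cmod a * cmod b) \<le> (cmod a)\<^sup>2 + (cmod b)\<^sup>2"
      using two_mult_le_scaled_squares[of 1 "cmod a" "cmod b"] by simp
    moreover have "0 \<le> cmod a * cmod b"
      by simp
    ultimately show ?thesis
      unfolding norm_mult complex_mod_cnj real_norm_def by linarith
  qed
  then show "AE x in M. norm (f x * cnj (g x)) \<le> norm ((cmod (f x))\<^sup>2 + (cmod (g x))\<^sup>2)"
    by simp
qed (use assms in \<open>auto intro!: borel_measurable_times borel_measurable_cnj simp: L2_def\<close>)

lemma cmod_add_square_le: "(cmod (a + b))\<^sup>2 \<le> 2 * (cmod a)\<^sup>2 + 2 * (cmod b)\<^sup>2"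
proof -
  have "(cmod (a + b))\<^sup>2 \<le> (cmod a + cmod b)\<^sup>2"
    by (intro power_mono norm_triangle_ineq) auto
  then show ?thesis
    using two_mult_le_scaled_squares[of 1 "cmod a" "cmod b"] by (simp add: power2_sum)
qed

lemma L2_add:
  assumes "f \<in> L2 M" "g \<in> L2 M"
  shows "(\<lambda>x. f x + g x) \<in> L2 M" and "energy M (\<lambda>x. f x + g x) \<le> 2 * energy M f + 2 * energy M g"
proof -
  note le = cmod_add_square_le
  have int: "integrable M (\<lambda>x. 2 * (cmod (f x))\<^sup>2 + 2 * (cmod (g x))\<^sup>2)"
    using assms by (auto intro!: L2_integrable_square)
  have meas: "(\<lambda>x. f x + g x) \<in> borel_measurable M"
    using assms by (intro borel_measurable_add L2_measurable)
  from int have int': "integrable M (\<lambda>x. (cmod (f x + g x))\<^sup>2)"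
    by (rule Bochner_Integration.integrable_bound) (use meas le in \<open>auto intro!: AE_I2\<close>)
  then show "(\<lambda>x. f x + g x) \<in> L2 M"
    using meas by (simp add: L2_def)
  have "energy M (\<lambda>x. f x + g x) \<le> (\<integral>x. 2 * (cmod (f x))\<^sup>2 + 2 * (cmod (g x))\<^sup>2 \<partial>M)"
    unfolding energy_def by (intro integral_mono int int' le)
  also have "\<dots> = 2 * energy M f + 2 * energy M g"
    using assms by (simp add: energy_def L2_integrable_square)
  finally show "energy M (\<lambda>x. f x + g x) \<le> 2 * energy M f + 2 * energy M g" .
qed

lemma L2_cmult: 
  assumes "f \<in> L2 M" shows "(\<lambda>x. a * f x) \<in> L2 M" 
  using assms by (auto simp: L2_def norm_mult power_mult_distrib)

lemma L2_diff:
  assumes "f \<in> L2 M" "g \<in> L2 M"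
  shows "(\<lambda>x. f x - g x) \<in> L2 M"
  using L2_add(1)[OF assms(1) L2_cmult[OF assms(2), of "- 1"]] by simp

lemma L2_indicator:
  assumes "f \<in> L2 M" "Y \<in> sets M"
  shows "(\<lambda>x. indicator Y x * f x) \<in> L2 M" 
proof -
  have "(cmod (indicator Y x * f x))\<^sup>2 = indicator Y x *\<^sub>R (cmod (f x))\<^sup>2" for x
    by (auto simp: indicator_def)
  then show ?thesis
    using assms integrable_mult_indicator[OF assms(2) L2_integrable_square[OF assms(1)]]
    by (auto simp: L2_def)
qed

lemma L2_inner_Cauchy_Schwarz:
  assumes "f \<in> L2 M" "g \<in> L2 M"
  shows "(cmod (L2_inner M f g))\<^sup>2 \<le> energy M f * energy M g"
proof (rule square_le_if_all_scalings)
  fix t :: real assume t: "t > 0"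
  have "cmod (L2_inner M f g) \<le> (\<integral>x. cmod (f x * cnj (g x)) \<partial>M)"
    unfolding L2_inner_def by (rule integral_norm_bound)
  also have "\<dots> \<le> (\<integral>x. (t * (cmod (f x))\<^sup>2 + (cmod (g x))\<^sup>2 / t) / 2 \<partial>M)"
  proof (rule integral_mono)
    show "cmod (f x * cnj (g x)) \<le> (t * (cmod (f x))\<^sup>2 + (cmod (g x))\<^sup>2 / t) / 2" for x
      using two_mult_le_scaled_squares[OF t, of "cmod (f x)" "cmod (g x)"] by (simp add: norm_mult)
  qed (use assms in \<open>auto intro!: L2_integrable_mult L2_integrable_square integrable_norm integrable_divide
      Bochner_Integration.integrable_add integrable_mult_right\<close>)
  also have "\<dots> = (t * energy M f + energy M g / t) / 2"
    using assms by (simp add: energy_def L2_integrable_square)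
  finally show "2 * cmod (L2_inner M f g) \<le> t * energy M f + energy M g / t"
    by simp
qed auto

lemma L2_inner_commute: "L2_inner M f g = cnj (L2_inner M g f)"
  unfolding L2_inner_def by (subst Bochner_Integration.integral_cnj[symmetric]) (simp add: mult.commute)

context positive_char_local_field
begin

section \<open>Change of variables for Haar measure\<close>

lemma distr_translation: "distr m m ((+) y) = m"
proof (rule measure_eqI)
  fix E assume "E \<in> sets (distr m m ((+) y))"
  then have E: "E \<in> sets m"
    by simp
  have "emeasure (distr m m ((+) y)) E = emeasure m ((+) y -` E)"
    using E by (simp add: emeasure_distr translation_measurable space_m)
  also have "(+) y -` E = (+) (- y) ` E"
    using translation_image_eq_vimage[of "- y" E] by simp
  finally show "emeasure (distr m m ((+) y)) E = emeasure m E"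
    by (simp only: emeasure_translate[OF E])
qed simp

lemma distr_scale:
  assumes "a \<noteq> 0"
  shows "distr m m ((*) a) = density m (\<lambda>_. ennreal (inverse (v a)))"
proof (rule measure_eqI)
  fix E assume "E \<in> sets (distr m m ((*) a))"
  then have E: "E \<in> sets m"
    by simp
  have "emeasure (distr m m ((*) a)) E = emeasure m ((*) a -` E)"
    using E by (simp add: emeasure_distr scale_measurable space_m)
  also have "(*) a -` E = (*) (inverse a) ` E"
    using scale_image_eq_vimage[of "inverse a" E] assms by simp
  finally show "emeasure (distr m m ((*) a)) E = emeasure (density m (\<lambda>_. ennreal (inverse (v a)))) E"
    using E assms by (simp add: emeasure_scale v_inverse emeasure_density nn_integral_cmult_indicator)
qed simp

lemma measurable_translate:
  "f \<in> measurable m N \<Longrightarrow> (\<lambda>x. f (y + x)) \<in> measurable m N"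
  by (rule measurable_compose[OF translation_measurable])

lemma measurable_scale:
  "f \<in> measurable m N \<Longrightarrow> (\<lambda>x. f (a * x)) \<in> measurable m N"
  by (rule measurable_compose[OF scale_measurable])

lemma
  fixes f :: "'a \<Rightarrow> 'b::{banach, second_countable_topology}"
  assumes "f \<in> borel_measurable m"
  shows integral_translate: "(\<integral>x. f (y + x) \<partial>m) = (\<integral>x. f x \<partial>m)"
    and integrable_translate_iff: "integrable m (\<lambda>x. f (y + x)) \<longleftrightarrow> integrable m f"
  using integral_distr[OF translation_measurable assms, of y]
    integrable_distr_eq[OF translation_measurable assms, of y] by (simp_all add: distr_translation)

lemma
  fixes f :: "'a \<Rightarrow> 'b::{banach, second_countable_topology}"
  assumes "f \<in> borel_measurable m" "a \<noteq> 0"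
  shows integral_scale: "(\<integral>x. f (a * x) \<partial>m) = inverse (v a) *\<^sub>R (\<integral>x. f x \<partial>m)"
    and integrable_scale_iff: "integrable m (\<lambda>x. f (a * x)) \<longleftrightarrow> integrable m f"
proof -
  have "(\<integral>x. f (a * x) \<partial>m) = integral\<^sup>L (distr m m ((*) a)) f"
    using integral_distr[OF scale_measurable assms(1), of a] by simp
  also have "\<dots> = (\<integral>x. inverse (v a) *\<^sub>R f x \<partial>m)"
    unfolding distr_scale[OF assms(2)] using assms(1) by (intro integral_density) auto
  finally show "(\<integral>x. f (a * x) \<partial>m) = inverse (v a) *\<^sub>R (\<integral>x. f x \<partial>m)"
    by simp
  have "integrable m (\<lambda>x. f (a * x)) \<longleftrightarrow> integrable (distr m m ((*) a)) f"
    using integrable_distr_eq[OF scale_measurable assms(1), of a] by simp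
  also have "\<dots> \<longleftrightarrow> integrable m (\<lambda>x. inverse (v a) *\<^sub>R f x)"
    unfolding distr_scale[OF assms(2)] using assms(1) by (intro integrable_density) auto
  also have "\<dots> \<longleftrightarrow> integrable m f"
  proof
    assume "integrable m (\<lambda>x. inverse (v a) *\<^sub>R f x)"
    then have "integrable m (\<lambda>x. v a *\<^sub>R inverse (v a) *\<^sub>R f x)"
      by (rule integrable_scaleR_right)
    then show "integrable m f"
      using assms(2) by simp
  qed (rule integrable_scaleR_right)
  finally show "integrable m (\<lambda>x. f (a * x)) \<longleftrightarrow> integrable m f" .
qed

lemma affine_measurable:
  "f \<in> measurable m N \<Longrightarrow> (\<lambda>x. f (a * x - z)) \<in> measurable m N"
  using measurable_scale[OF measurable_translate[of f N "- z"], of a] by simp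

lemma
  fixes f :: "'a \<Rightarrow> 'b::{banach, second_countable_topology}"
  assumes "f \<in> borel_measurable m" "a \<noteq> 0"
  shows integral_affine_map: "(\<integral>x. f (a * x - z) \<partial>m) = inverse (v a) *\<^sub>R (\<integral>x. f x \<partial>m)"
    and integrable_affine_map_iff: "integrable m (\<lambda>x. f (a * x - z)) \<longleftrightarrow> integrable m f"
  using integral_scale[OF measurable_translate[OF assms(1), of "- z"] assms(2)]
    integrable_scale_iff[OF measurable_translate[OF assms(1), of "- z"] assms(2)]
    integral_translate[OF assms(1), of "- z"] integrable_translate_iff[OF assms(1), of "- z"]
  by simp_all

lemma L2_affine_map:
  assumes "f \<in> L2 m" "a \<noteq> 0"
  shows "(\<lambda>x. f (a * x - z)) \<in> L2 m"
  using assms integrable_affine_map_iff[of "\<lambda>x. (cmod (f x))\<^sup>2" a z] affine_measurable[of f borel a z]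
  by (auto simp: L2_def)

lemma L2_translate: "f \<in> L2 m \<Longrightarrow> translate y f \<in> L2 m"
  using L2_affine_map[of f 1 y] by (simp add: translate_def)

lemma energy_translate: "f \<in> L2 m \<Longrightarrow> energy m (translate y f) = energy m f"
  using integral_affine_map[OF borel_measurable_integrable[OF L2_integrable_square], of f 1 y]
  by (simp add: translate_def energy_def)

lemma L2_dilate: "f \<in> L2 m \<Longrightarrow> dilate \<pi> c j f \<in> L2 m"
  unfolding dilate_def using L2_affine_map[of f "\<pi> powi (- j)" 0] by (intro L2_cmult) simp

text \<open>The translation parameter is a field element instead of an index, so that both systems,
  and their shifts by arbitrary \<open>y\<close>, are described by one coefficient function on
  different sets of \<open>z\<close>.\<close>

definition atom :: "int \<Rightarrow> 'a \<Rightarrow> ('a \<Rightarrow> complex) \<Rightarrow> 'a \<Rightarrow> complex" where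
  "atom j z \<psi> = (\<lambda>x. of_real (real q powr (j / 2)) * \<psi> (\<pi> powi (- j) * x - z))"

definition coef :: "('a \<Rightarrow> complex) \<Rightarrow> ('a \<Rightarrow> complex) \<Rightarrow> int \<Rightarrow> 'a \<Rightarrow> complex" where
  "coef \<psi> f j z = L2_inner m f (atom j z \<psi>)"

lemma L2_atom: "\<psi> \<in> L2 m \<Longrightarrow> atom j z \<psi> \<in> L2 m"
  unfolding atom_def by (intro L2_cmult L2_affine_map) auto

lemma affine_elt_eq_atom: "affine_elt \<pi> c \<epsilon> \<psi> j k = atom j (uu k) \<psi>"
  by (simp add: affine_elt_def dilate_def translate_def q_half_power_def atom_def q_def)

lemma quasi_affine_elt_eq_atom:
  "quasi_affine_elt \<pi> c \<epsilon> \<psi> j k =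
     (if j \<ge> 0 then atom j (uu k) \<psi>
      else (\<lambda>x. of_real (real q powr (j / 2)) * atom j (\<pi> powi (- j) * uu k) \<psi> x))"
  by (simp add: quasi_affine_elt_def dilate_def translate_def q_half_power_def atom_def q_def fun_eq_iff
      right_diff_distrib)

lemma v_\<pi>_powi: "v (\<pi> powi j) = real q powr (- j)"
  by (simp add: v_powi v_\<pi> powr_minus powr_real_of_int' power_int_divide_distrib inverse_eq_divide)

lemma coef_add: "f \<in> L2 m \<Longrightarrow> g \<in> L2 m \<Longrightarrow> \<psi> \<in> L2 m \<Longrightarrow>
    coef \<psi> (\<lambda>x. f x + g x) j z = coef \<psi> f j z + coef \<psi> g j z"
  unfolding coef_def L2_inner_def distrib_right
  by (intro Bochner_Integration.integral_add L2_integrable_mult L2_atom)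

lemma coef_diff: "f \<in> L2 m \<Longrightarrow> g \<in> L2 m \<Longrightarrow> \<psi> \<in> L2 m \<Longrightarrow>
    coef \<psi> (\<lambda>x. f x - g x) j z = coef \<psi> f j z - coef \<psi> g j z"
  unfolding coef_def L2_inner_def left_diff_distrib
  by (intro Bochner_Integration.integral_diff L2_integrable_mult L2_atom)

lemma coef_translate:
  assumes "f \<in> L2 m" "\<psi> \<in> L2 m"
  shows "coef \<psi> (translate y f) j z = shift y (coef \<psi> f) (j, z)"
proof -
  let ?h = "\<lambda>x. translate y f x * cnj (atom j z \<psi> x)"
  have "?h \<in> borel_measurable m"
    using L2_integrable_mult[OF L2_translate[OF assms(1)] L2_atom[OF assms(2)]]
    by (rule borel_measurable_integrable)
  from integral_translate[OF this, of y] have "coef \<psi> (translate y f) j z = (\<integral>x. ?h (y + x) \<partial>m)"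
    by (simp add: coef_def L2_inner_def)
  also have "\<dots> = coef \<psi> f j (z - \<pi> powi (- j) * y)"
    unfolding coef_def L2_inner_def by (simp add: translate_def atom_def algebra_simps)
  finally show ?thesis
    by (simp add: shift_def)
qed

lemma coef_dilate:
  assumes "f \<in> L2 m" "\<psi> \<in> L2 m"
  shows "coef \<psi> (dilate \<pi> c i f) j z = coef \<psi> f (j - i) z"
proof -
  let ?h = "\<lambda>x. f x * cnj (atom (j - i) z \<psi> x)"
  have h: "?h \<in> borel_measurable m"
    using L2_integrable_mult[OF assms(1) L2_atom[OF assms(2)]] by (rule borel_measurable_integrable)
  have eq: "dilate \<pi> c i f x * cnj (atom j z \<psi> x) = real q powr i *\<^sub>R ?h (\<pi> powi (- i) * x)" for x
  proof -
    have arg: "\<pi> powi (- (j - i)) * (\<pi> powi (- i) * x) = \<pi> powi (- j) * x"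
      by (simp add: mult.assoc[symmetric] power_int_add[symmetric])
    have "real q powr (i / 2) * real q powr (j / 2) = real q powr i * real q powr ((j - i) / 2)"
      by (simp add: powr_add[symmetric] field_simps)
    then have "complex_of_real (real q powr (i / 2)) * of_real (real q powr (j / 2)) =
        of_real (real q powr i) * of_real (real q powr ((j - i) / 2))"
      by (simp only: of_real_mult[symmetric])
    then show ?thesis
      unfolding dilate_def atom_def q_half_power_def q_def[symmetric] arg
      by (simp add: scaleR_conv_of_real mult_ac)
  qed
  have "coef \<psi> (dilate \<pi> c i f) j z = real q powr i *\<^sub>R (\<integral>x. ?h (\<pi> powi (- i) * x) \<partial>m)"
    unfolding coef_def L2_inner_def eq by simp
  also have "\<dots> = coef \<psi> f (j - i) z"
    unfolding coef_def L2_inner_def integral_scale[OF h, of "\<pi> powi (- i)", simplified]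
    by (simp add: v_\<pi>_powi powr_minus)
  finally show ?thesis .
qed

text \<open>Conjugation by dilations: this carries invariance under \<Lambda> over to all its
  multiples by powers of \<pi>.\<close>

lemma translate_scaled:
  "translate (\<pi> powi i * y) f = dilate \<pi> c i (translate y (dilate \<pi> c (- i) f))"
  using CHAR_positive by (simp add: translate_def dilate_def fun_eq_iff q_half_power_def right_diff_distrib
      mult.assoc[symmetric] power_int_add[symmetric] powr_add[symmetric] of_real_mult[symmetric] del: of_real_mult)

text \<open>The substitution leaves \<psi> in place and moves \<open>Y\<close> instead, so that the
  bounds for different \<open>j\<close> and \<open>z\<close> can be added under one
  integral.\<close>

lemma energy_atom_indicator:
  assumes "\<psi> \<in> L2 m" "Y \<in> sets m"
  shows "energy m (\<lambda>x. indicator Y x * atom j z \<psi> x) =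
      (\<integral>x. indicator Y (\<pi> powi j * (x + z)) * (cmod (\<psi> x))\<^sup>2 \<partial>m)"
proof -
  let ?h = "\<lambda>x. indicator Y (\<pi> powi j * (x + z)) * (cmod (\<psi> x))\<^sup>2"
  have "(\<lambda>x. indicator Y (\<pi> powi j * (x + z)) :: real) \<in> borel_measurable m"
    using affine_measurable[of "indicator Y" borel "\<pi> powi j" "- (\<pi> powi j * z)"] assms(2)
    by (simp add: algebra_simps)
  then have h: "?h \<in> borel_measurable m"
    using assms(1) by (auto simp: L2_def)
  have cancel: "\<pi> powi j * (\<pi> powi (- j) * x) = x" for x
    by (simp add: mult.assoc[symmetric] power_int_add[symmetric])
  have eq: "(cmod (indicator Y x * atom j z \<psi> x))\<^sup>2 = real q powr j *\<^sub>R ?h (\<pi> powi (- j) * x - z)" for x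
    by (simp add: atom_def norm_mult power_mult_distrib powr_power indicator_def cancel)
  have "energy m (\<lambda>x. indicator Y x * atom j z \<psi> x) = real q powr j *\<^sub>R (\<integral>x. ?h (\<pi> powi (- j) * x - z) \<partial>m)"
    unfolding energy_def eq by simp
  also have "(\<integral>x. ?h (\<pi> powi (- j) * x - z) \<partial>m) = inverse (v (\<pi> powi (- j))) *\<^sub>R (\<integral>x. ?h x \<partial>m)"
    by (rule integral_affine_map[OF h]) simp
  also have "real q powr j *\<^sub>R \<dots> = (\<integral>x. ?h x \<partial>m)"
    by (simp add: v_\<pi>_powi powr_minus)
  finally show ?thesis .
qed

lemma coef_support_bound:
  assumes "f \<in> L2 m" "\<psi> \<in> L2 m" "Y \<in> sets m" "\<And>x. x \<notin> Y \<Longrightarrow> f x = 0"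
  shows "(cmod (coef \<psi> f j z))\<^sup>2 \<le> energy m f * (\<integral>x. indicator Y (\<pi> powi j * (x + z)) * (cmod (\<psi> x))\<^sup>2 \<partial>m)"
proof -
  have "coef \<psi> f j z = L2_inner m f (\<lambda>x. indicator Y x * atom j z \<psi> x)"
    unfolding coef_def L2_inner_def using assms(4)
    by (intro Bochner_Integration.integral_cong) (auto simp: indicator_def)
  then show ?thesis
    using L2_inner_Cauchy_Schwarz[OF assms(1) L2_indicator[OF L2_atom[OF assms(2)] assms(3), of j z]]
      energy_atom_indicator[OF assms(2,3), of j z] by simp
qed

end

section \<open>The tail of the averages\<close>

lemma sum_le_infsum_ennreal:
  fixes f :: "'b \<Rightarrow> ennreal"
  assumes "finite K"
  shows "sum f K \<le> (\<Sum>\<^sub>\<infinity>x. f x)"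
proof -
  have "infsum f K \<le> infsum f UNIV"
    by (rule infsum_mono_neutral) (auto intro: nonneg_summable_on_complete)
  then show ?thesis
    using assms by simp
qed

context positive_char_local_field
begin

text \<open>Real summability over pairs, for one generator, replaces the iterated
  \<open>ennreal\<close> sums of the hypothesis.\<close>

definition bessel :: "real \<Rightarrow> ('a \<Rightarrow> complex) \<Rightarrow> bool" where
  "bessel B \<psi> \<longleftrightarrow> B \<ge> 0 \<and> (\<forall>f\<in>L2 m.
     (\<lambda>(j, z). (cmod (coef \<psi> f j z))\<^sup>2) summable_on UNIV \<times> Lam \<and>
     (\<Sum>\<^sub>\<infinity>(j, z)\<in>UNIV \<times> Lam. (cmod (coef \<psi> f j z))\<^sup>2) \<le> B * energy m f)"

text \<open>A finite set of pairs sits in a finite rectangle, whose sum is dominated by the iterated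
  sums for \<open>l\<close>, and these by the sum over all generators.\<close>

lemma affine_Bessel_family_imp_bessel:
  assumes "affine_Bessel_family m \<pi> c \<epsilon> L \<Psi>"
  shows "\<exists>B. \<forall>l\<in>{1..L}. bessel B (\<Psi> l)"
proof -
  obtain B where B: "B > 0" and le: "\<And>f. f \<in> L2 m \<Longrightarrow>
      (\<Sum>l=1..L. \<Sum>\<^sub>\<infinity>j. \<Sum>\<^sub>\<infinity>k. ennreal ((cmod (coef (\<Psi> l) f j (uu k)))\<^sup>2)) \<le> ennreal (B * energy m f)"
    using assms unfolding affine_Bessel_family_def affine_elt_eq_atom coef_def[symmetric] L2_norm_square
    by blast
  have "bessel B (\<Psi> l)" if l: "l \<in> {1..L}" for l
    unfolding bessel_def
  proof (intro conjI ballI)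
    fix f assume f: "f \<in> L2 m"
    define a where "a j z = (cmod (coef (\<Psi> l) f j z))\<^sup>2" for j z
    have bound: "sum (\<lambda>(j, z). a j z) F \<le> B * energy m f" if F: "F \<subseteq> UNIV \<times> Lam" "finite F" for F
    proof -
      define K where "K = uu -` (snd ` F)"
      have "finite K"
        unfolding K_def using F(2) inj_uu by (intro finite_vimageI) auto
      have "F \<subseteq> fst ` F \<times> uu ` K"
        using F(1) by (force simp: K_def Lam_def)
      then have "sum (\<lambda>(j, z). a j z) F \<le> sum (\<lambda>(j, z). a j z) (fst ` F \<times> uu ` K)"
        using F(2) \<open>finite K\<close> by (intro sum_mono2) (auto simp: a_def)
      also have "\<dots> = (\<Sum>j\<in>fst ` F. \<Sum>k\<in>K. a j (uu k))"
        using inj_uu by (simp add: sum.cartesian_product[symmetric] sum.reindex[OF inj_on_subset[OF inj_uu]])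
      finally have "ennreal (sum (\<lambda>(j, z). a j z) F) \<le> ennreal (\<Sum>j\<in>fst ` F. \<Sum>k\<in>K. a j (uu k))"
        by (rule ennreal_leI)
      also have "\<dots> = (\<Sum>j\<in>fst ` F. \<Sum>k\<in>K. ennreal (a j (uu k)))"
        by (simp add: a_def sum_nonneg)
      also have "\<dots> \<le> (\<Sum>j\<in>fst ` F. \<Sum>\<^sub>\<infinity>k. ennreal (a j (uu k)))"
      proof (rule sum_mono)
        show "(\<Sum>k\<in>K. ennreal (a j (uu k))) \<le> (\<Sum>\<^sub>\<infinity>k. ennreal (a j (uu k)))" for j
          by (rule sum_le_infsum_ennreal[OF \<open>finite K\<close>])
      qed
      also have "\<dots> \<le> (\<Sum>\<^sub>\<infinity>j. \<Sum>\<^sub>\<infinity>k. ennreal (a j (uu k)))"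
        using F(2) by (intro sum_le_infsum_ennreal) auto
      also have "\<dots> \<le> (\<Sum>l=1..L. \<Sum>\<^sub>\<infinity>j. \<Sum>\<^sub>\<infinity>k. ennreal ((cmod (coef (\<Psi> l) f j (uu k)))\<^sup>2))"
        unfolding a_def using l
        by (intro member_le_sum[where f = "\<lambda>l. \<Sum>\<^sub>\<infinity>j. \<Sum>\<^sub>\<infinity>k. ennreal ((cmod (coef (\<Psi> l) f j (uu k)))\<^sup>2)"]) auto
      also note le[OF f]
      finally show ?thesis
        using B by (simp add: ennreal_le_iff)
    qed
    show "(\<lambda>(j, z). (cmod (coef (\<Psi> l) f j z))\<^sup>2) summable_on UNIV \<times> Lam"
    proof (rule nonneg_bdd_above_summable_on)
      show "bdd_above (sum (\<lambda>(j, z). (cmod (coef (\<Psi> l) f j z))\<^sup>2) ` {F. F \<subseteq> UNIV \<times> Lam \<and> finite F})"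
        using bound unfolding a_def by (auto intro!: bdd_aboveI)
    qed auto
    then show "(\<Sum>\<^sub>\<infinity>(j, z)\<in>UNIV \<times> Lam. (cmod (coef (\<Psi> l) f j z))\<^sup>2) \<le> B * energy m f"
      using bound unfolding a_def by (intro infsum_le_finite_sums) auto
  qed (use B in auto)
  then show ?thesis
    by blast
qed

text \<open>Shifted coefficients are the coefficients of a translate of \<open>f\<close>, which has
  the same energy; hence the bound is uniform in \<open>y\<close>.\<close>

lemma
  assumes "bessel B \<psi>" "f \<in> L2 m" "\<psi> \<in> L2 m"
  shows bessel_shift_summable: "(\<lambda>x. (cmod (shift y (coef \<psi> f) x))\<^sup>2) summable_on UNIV \<times> Lam"
    and bessel_shift_bound: "(\<Sum>\<^sub>\<infinity>x\<in>UNIV \<times> Lam. (cmod (shift y (coef \<psi> f) x))\<^sup>2) \<le> B * energy m f"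
proof -
  have eq: "(\<lambda>(j, z). (cmod (coef \<psi> (translate y f) j z))\<^sup>2) = (\<lambda>x. (cmod (shift y (coef \<psi> f) x))\<^sup>2)"
    using assms by (auto simp: coef_translate)
  show "(\<lambda>x. (cmod (shift y (coef \<psi> f) x))\<^sup>2) summable_on UNIV \<times> Lam"
    and "(\<Sum>\<^sub>\<infinity>x\<in>UNIV \<times> Lam. (cmod (shift y (coef \<psi> f) x))\<^sup>2) \<le> B * energy m f"
    using assms L2_translate[OF assms(2), of y] unfolding bessel_def eq[symmetric]
    by (auto simp: energy_translate)
qed

text \<open>Mean square mass, over the \<open>q ^ N\<close> translates, of the scales that averaging
  up to \<open>N\<close> has not yet made quasi-affine.\<close>

definition tail :: "('a \<Rightarrow> complex) \<Rightarrow> ('a \<Rightarrow> complex) \<Rightarrow> nat \<Rightarrow> real" where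
  "tail \<psi> f N = (1 / real (q ^ N)) *
     (\<Sum>r<q ^ N. \<Sum>\<^sub>\<infinity>x\<in>{..<- int N} \<times> Lam. (cmod (shift (uu r) (coef \<psi> f) x))\<^sup>2)"

lemma tail_nonneg: "tail \<psi> f N \<ge> 0"
  unfolding tail_def by (intro mult_nonneg_nonneg sum_nonneg infsum_nonneg) auto

lemma tail_summable:
  assumes "bessel B \<psi>" "f \<in> L2 m" "\<psi> \<in> L2 m" 
  shows "(\<lambda>x. (cmod (shift y (coef \<psi> f) x))\<^sup>2) summable_on A \<times> Lam"
  by (rule summable_on_subset_banach[OF bessel_shift_summable[OF assms]]) auto

lemma tail_term_le:
  assumes "bessel B \<psi>" "f \<in> L2 m" "\<psi> \<in> L2 m" 
  shows "(\<Sum>\<^sub>\<infinity>x\<in>A \<times> Lam. (cmod (shift y (coef \<psi> f) x))\<^sup>2) \<le> B * energy m f"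
  using tail_summable[OF assms, of y]
  by (intro order_trans[OF infsum_mono2 bessel_shift_bound[OF assms, of y]]) auto

lemma tail_le:
  assumes "bessel B \<psi>" "f \<in> L2 m" "\<psi> \<in> L2 m" 
  shows "tail \<psi> f N \<le> B * energy m f"
proof -
  have "tail \<psi> f N \<le> (1 / real (q ^ N)) * (\<Sum>r<q ^ N. B * energy m f)"
    unfolding tail_def by (intro mult_left_mono sum_mono tail_term_le[OF assms]) auto
  then show ?thesis
    by simp
qed

text \<open>Allows the truncation of \<open>f\<close>: one part will have a small tail for all
  \<open>N\<close>, the other as \<open>N\<close> grows, so the factor \<open>2\<close> is
  harmless.\<close>

lemma tail_add_le:
  assumes "bessel B \<psi>" "\<psi> \<in> L2 m" "f \<in> L2 m" "g \<in> L2 m"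
  shows "tail \<psi> (\<lambda>x. f x + g x) N \<le> 2 * tail \<psi> f N + 2 * tail \<psi> g N"
proof -
  note summ = tail_summable[OF assms(1,3,2)] tail_summable[OF assms(1,4,2)]
  have "(cmod (shift y (coef \<psi> (\<lambda>x. f x + g x)) x))\<^sup>2 \<le>
      2 * (cmod (shift y (coef \<psi> f) x))\<^sup>2 + 2 * (cmod (shift y (coef \<psi> g) x))\<^sup>2" for y x
    using assms by (cases x) (simp add: shift_def coef_add cmod_add_square_le)
  then have "(\<Sum>\<^sub>\<infinity>x\<in>{..<- int N} \<times> Lam. (cmod (shift y (coef \<psi> (\<lambda>x. f x + g x)) x))\<^sup>2) \<le>
      (\<Sum>\<^sub>\<infinity>x\<in>{..<- int N} \<times> Lam. 2 * (cmod (shift y (coef \<psi> f) x))\<^sup>2 + 2 * (cmod (shift y (coef \<psi> g) x))\<^sup>2)" for y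
    using assms L2_add(1)[OF assms(3,4)]
    by (intro infsum_mono tail_summable[OF assms(1)] summable_on_add summable_on_cmult_right) auto
  also have "\<dots> y = 2 * (\<Sum>\<^sub>\<infinity>x\<in>{..<- int N} \<times> Lam. (cmod (shift y (coef \<psi> f) x))\<^sup>2) +
      2 * (\<Sum>\<^sub>\<infinity>x\<in>{..<- int N} \<times> Lam. (cmod (shift y (coef \<psi> g) x))\<^sup>2)" for y
    using summ by (simp add: infsum_add infsum_cmult_right' summable_on_cmult_right)
  finally have "tail \<psi> (\<lambda>x. f x + g x) N \<le> (1 / real (q ^ N)) *
     (\<Sum>r<q ^ N. 2 * (\<Sum>\<^sub>\<infinity>x\<in>{..<- int N} \<times> Lam. (cmod (shift (uu r) (coef \<psi> f) x))\<^sup>2) +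
      2 * (\<Sum>\<^sub>\<infinity>x\<in>{..<- int N} \<times> Lam. (cmod (shift (uu r) (coef \<psi> g) x))\<^sup>2))"
    unfolding tail_def by (intro mult_left_mono sum_mono) auto
  also have "\<dots> = 2 * tail \<psi> f N + 2 * tail \<psi> g N"
    by (simp add: tail_def sum.distrib sum_distrib_left[symmetric] distrib_left)
  finally show ?thesis .
qed

lemma \<pi>_power_mult_RI_iff: "\<pi> ^ N * x \<in> RI \<longleftrightarrow> v x \<le> real q ^ N"
  using q_pos by (simp add: mem_RI v_mult v_power v_\<pi> field_simps)

text \<open>\<open>z\<close> is determined by \<open>x\<close>, the scale \<open>j\<close> lies in a window of length \<open>N\<close>, and given \<open>j\<close> and
  \<open>z\<close> the translate \<open>u r\<close> lies in a ball of radius \<open>q ^ M\<close>.\<close>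

lemma card_overlap_le:
  assumes F: "finite F" "F \<subseteq> {..<- int N} \<times> Lam"
  shows "card {(r, j, z). r \<in> {q ^ M..<q ^ N} \<and> (j, z) \<in> F \<and> \<pi> ^ M * (\<pi> powi j * (x + z) - uu r) \<in> RI} \<le> N * q ^ M"
    (is "card ?S \<le> _")
proof -
  define w where "w j z = \<pi> powi j * (x + z)" for j z
  \<comment> \<open>Because \<open>q ^ M \<le> r < q ^ N\<close>, the point \<open>uu r\<close> lies
    in the shell between the radii \<open>q ^ M\<close> and \<open>q ^ N\<close>;
    \<open>w j z\<close> is within \<open>q ^ M\<close> of it, so the ultrametric inequality puts it
    in the same shell.\<close>
  have S: "r < q ^ N" "q ^ M \<le> r" "j < - int N" "z \<in> Lam" "v (w j z - uu r) \<le> real q ^ M"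
    "v (w j z) \<le> real q ^ N" "v (w j z) > real q ^ M" if "(r, j, z) \<in> ?S" for r j z
  proof -
    show r: "r < q ^ N" "q ^ M \<le> r" and "j < - int N" "z \<in> Lam"
      and w: "v (w j z - uu r) \<le> real q ^ M"
      using that F by (auto simp: w_def \<pi>_power_mult_RI_iff)
    have u: "v (uu r) \<le> real q ^ N" "\<not> v (uu r) \<le> real q ^ M"
      using r Lam_RI_bounded_iff[of N r] Lam_RI_bounded_iff[of M r] by (auto simp: \<pi>_power_mult_RI_iff)
    have "q ^ M < q ^ N"
      using r by simp
    then have "real q ^ M \<le> real q ^ N"
      by (metis less_imp_le of_nat_le_iff of_nat_power)
    then show "v (w j z) \<le> real q ^ N"
      using v_add[of "w j z - uu r" "uu r"] u w by simp
    show "v (w j z) > real q ^ M"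
      using v_diff[of "w j z" "w j z - uu r"] u w by auto
  qed
  have v_w: "v (w j z) = real q powr (- j) * v (x + z)" for j z
    by (simp add: w_def v_mult v_\<pi>_powi)
  \<comment> \<open>Since \<open>j < - N\<close>, the factor \<open>q powr (- j)\<close> is at least
    \<open>q ^ N\<close>, so \<open>v (w j z) \<le> q ^ N\<close> forces \<open>x + z\<close> into
    the unit ball; distinct points of \<Lambda> cannot both satisfy this.\<close>
  have xz: "x + z \<in> RI" if "(r, j, z) \<in> ?S" for r j z
  proof -
    have "real q powr (- j) * v (x + z) \<le> real q powr (real N)"
      using S(6)[OF that] q_pos by (simp add: v_w powr_realpow)
    also have "\<dots> \<le> real q powr (- j)"
      using S(3)[OF that] q_gt_1 by (intro powr_mono) auto
    finally show ?thesis
      using q_pos by (simp add: mem_RI)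
  qed
  have z_unique: "z = z'" if "(r, j, z) \<in> ?S" "(r', j', z') \<in> ?S" for r j z r' j' z'
    using S(4)[OF that(1)] S(4)[OF that(2)] RI_diff[OF xz[OF that(1)] xz[OF that(2)]]
    by (intro Lam_tile_unique) auto
  \<comment> \<open>With \<open>z\<close> common to all triples, \<open>v (w j z)\<close> is
    \<open>q powr (- j)\<close> times one fixed number and lies in the interval from
    \<open>1\<close>, excluded, to \<open>q ^ N\<close>; so the scales differ by less than
    \<open>N\<close>.\<close>
  have j_close: "j' - j < int N" if "(r, j, z) \<in> ?S" "(r', j', z') \<in> ?S" for r j z r' j' z'
  proof -
    have "1 < real q powr (- j') * v (x + z')"
    proof -
      have "1 \<le> real q ^ M"
        using q_gt_1 by (intro one_le_power) simp
      then show ?thesis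
        using S(7)[OF that(2)] by (simp add: v_w)
    qed
    then have "real q powr (j' - j) * 1 < real q powr (j' - j) * (real q powr (- j') * v (x + z'))"
      using q_pos by (intro mult_strict_left_mono) auto
    also have "\<dots> = v (w j z)"
      using z_unique[OF that] q_pos by (simp add: v_w mult.assoc[symmetric] powr_add[symmetric])
    also have "\<dots> \<le> real q powr real N"
      using S(6)[OF that(1)] q_pos by (simp add: powr_realpow)
    finally have "real_of_int (j' - j) < real N"
      using q_gt_1 by simp
    then show ?thesis
      by linarith
  qed
  define J where "J = (\<lambda>(r, j, z). j) ` ?S"
  have fin: "finite ?S"
  proof (rule finite_subset)
    show "?S \<subseteq> {q ^ M..<q ^ N} \<times> F"
      by blast
    show "finite ({q ^ M..<q ^ N} \<times> F)"
      using F by (intro finite_cartesian_product finite_atLeastLessThan)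
  qed
  have card_J: "card J \<le> N"
  proof (cases "J = {}")
    case False
    have "finite J"
      using fin by (simp add: J_def)
    have "J \<subseteq> {Min J..<Min J + int N}"
    proof
      fix j assume "j \<in> J"
      have "Min J \<in> J"
        using \<open>finite J\<close> False by (rule Min_in)
      then have "j - Min J < int N"
        using \<open>j \<in> J\<close> j_close unfolding J_def by fast
      then show "j \<in> {Min J..<Min J + int N}"
        using \<open>finite J\<close> \<open>j \<in> J\<close> by simp
    qed
    then have "card J \<le> card {Min J..<Min J + int N}"
      by (intro card_mono) auto
    then show ?thesis
      by simp
  qed simp
  \<comment> \<open>The ball of radius \<open>q ^ M\<close> splits into \<open>q ^ M\<close> unit
    balls; \<open>s\<close> will name the one containing \<open>w j z - uu r\<close>, and
    \<open>j\<close> and \<open>s\<close> together determine \<open>r\<close>.\<close>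
  have s_ex: "\<exists>s. s < q ^ M \<and> (w j z - uu r) - uu s \<in> RI" if "(r, j, z) \<in> ?S" for r j z
    using uu_tile_exists[of M "w j z - uu r"] S(5)[OF that] by (simp add: \<pi>_power_mult_RI_iff)
  define s where "s r j z = (SOME s. s < q ^ M \<and> (w j z - uu r) - uu s \<in> RI)" for r j z
  have s: "s r j z < q ^ M \<and> (w j z - uu r) - uu (s r j z) \<in> RI" if "(r, j, z) \<in> ?S" for r j z
    unfolding s_def by (rule someI_ex[OF s_ex[OF that]])
  have "card ?S \<le> card (J \<times> {..<q ^ M})"
  proof (rule card_inj_on_le)
    show "inj_on (\<lambda>(r, j, z). (j, s r j z)) ?S"
    proof (rule inj_onI)
      fix p p' assume p: "p \<in> ?S" "p' \<in> ?S"
        and eq: "(case p of (r, j, z) \<Rightarrow> (j, s r j z)) = (case p' of (r, j, z) \<Rightarrow> (j, s r j z))"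
      obtain r j z where p1: "p = (r, j, z)" by (cases p)
      obtain r' j' z' where p2: "p' = (r', j', z')" by (cases p')
      have "(j, s r j z) = (j', s r' j' z')"
        using eq unfolding p1 p2 prod.case .
      then have "j' = j" "s r' j' z' = s r j z"
        by (auto simp only: prod.inject)
      have mem: "(r, j, z) \<in> ?S" "(r', j, z') \<in> ?S"
        using p unfolding p1 p2 \<open>j' = j\<close> .
      have z: "z' = z"
        using z_unique[OF mem] by simp
      have "w j z - uu r - uu (s r j z) \<in> RI" "w j z - uu r' - uu (s r' j z) \<in> RI"
        using s[OF mem(1)] s[OF mem(2)] unfolding z by blast+
      then have "(w j z - uu r - uu (s r j z)) - (w j z - uu r' - uu (s r' j z)) \<in> RI"
        by (rule RI_diff)
      moreover have "s r' j z = s r j z"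
        using \<open>s r' j' z' = s r j z\<close> unfolding z \<open>j' = j\<close> .
      ultimately have "uu r' - uu r \<in> RI"
        by simp
      then have "r' = r"
        by (rule uu_tile_unique)
      then show "p = p'"
        unfolding p1 p2 using z \<open>j' = j\<close> by simp
    qed
    show "(\<lambda>(r, j, z). (j, s r j z)) ` ?S \<subseteq> J \<times> {..<q ^ M}"
    proof (rule image_subsetI)
      fix p assume p: "p \<in> ?S"
      obtain r j z where p1: "p = (r, j, z)" by (cases p)
      have "j \<in> J"
        unfolding J_def using p p1 by (intro image_eqI[of _ _ p]) simp_all
      then show "(case p of (r, j, z) \<Rightarrow> (j, s r j z)) \<in> J \<times> {..<q ^ M}"
        using s[OF p[unfolded p1]] unfolding p1 by simp
    qed
    show "finite (J \<times> {..<q ^ M})"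
      unfolding J_def using fin by (intro finite_cartesian_product finite_imageI finite_lessThan)
  qed
  also have "\<dots> \<le> N * q ^ M"
    using card_J by (simp add: card_cartesian_product)
  finally show ?thesis .
qed

text \<open>For fixed \<open>M\<close> the bracket grows only linearly in \<open>N\<close>, whereas
  the average divides it by \<open>q ^ N\<close>.\<close>

lemma tail_bounded_support:
  assumes bes: "bessel B \<psi>" and f: "f \<in> L2 m" and \<psi>: "\<psi> \<in> L2 m"
    and supp: "\<And>x. \<pi> ^ M * x \<notin> RI \<Longrightarrow> f x = 0" and "M \<le> N"
  shows "tail \<psi> f N \<le> (1 / real (q ^ N)) *
    (real (q ^ M) * (B * energy m f) + energy m f * (real (N * q ^ M) * energy m \<psi>))"
proof -
  define A where "A = {..<- int N} \<times> Lam"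
  define I where "I = {q ^ M..<q ^ N}"
  \<comment> \<open>\<open>Y r\<close> contains the support of \<open>translate (uu r) f\<close>, so
    only the part of an atom inside it matters.\<close>
  define Y where "Y r = {x. \<pi> ^ M * (x - uu r) \<in> RI}" for r
  have Y_sets: "Y r \<in> sets m" for r
  proof -
    have "(\<lambda>x. \<pi> ^ M * x - \<pi> ^ M * uu r) \<in> measurable m m"
      by (rule affine_measurable[of "\<lambda>x. x"]) simp
    from measurable_sets[OF this RI_sets] show ?thesis
      by (simp add: Y_def space_m right_diff_distrib vimage_def)
  qed
  define h where "h r x = (cmod (shift (uu r) (coef \<psi> f) x))\<^sup>2" for r x
  have h_summ: "h r summable_on A" for r
    unfolding h_def A_def by (rule tail_summable[OF bes f \<psi>])
  have h_le: "h r (j, z) \<le> energy m f * (\<integral>x. indicator (Y r) (\<pi> powi j * (x + z)) * (cmod (\<psi> x))\<^sup>2 \<partial>m)" for r j z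
  proof -
    have "translate (uu r) f x = 0" if "x \<notin> Y r" for x
      using that supp by (simp add: Y_def translate_def)
    from coef_support_bound[OF L2_translate[OF f] \<psi> Y_sets this, where j = j and z = z] show ?thesis
      unfolding h_def coef_translate[OF f \<psi>] energy_translate[OF f] .
  qed
  have ind_int: "integrable m (\<lambda>x. indicator (Y r) (\<pi> powi j * (x + z)) * (cmod (\<psi> x))\<^sup>2)" for r j z
  proof (rule Bochner_Integration.integrable_bound[OF L2_integrable_square[OF \<psi>]])
    have "(\<lambda>x. indicator (Y r) (\<pi> powi j * (x + z)) :: real) \<in> borel_measurable m"
      using affine_measurable[of "indicator (Y r)" borel "\<pi> powi j" "- (\<pi> powi j * z)"] Y_sets[of r]
      by (simp add: algebra_simps)
    then show "(\<lambda>x. indicator (Y r) (\<pi> powi j * (x + z)) * (cmod (\<psi> x))\<^sup>2) \<in> borel_measurable m"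
      using \<psi> by (auto simp: L2_def)
  qed (auto simp: indicator_def)
  have count: "(\<Sum>p\<in>F. \<Sum>r\<in>I. indicator (Y r) (\<pi> powi (fst p) * (x + snd p))) \<le> real (N * q ^ M)"
    if F: "finite F" "F \<subseteq> A" for F x
  proof -
    have "(\<Sum>p\<in>F. \<Sum>r\<in>I. indicator (Y r) (\<pi> powi (fst p) * (x + snd p)) :: real) =
        (\<Sum>(r, p)\<in>I \<times> F. of_bool (\<pi> ^ M * (\<pi> powi (fst p) * (x + snd p) - uu r) \<in> RI))"
      by (subst sum.swap) (simp add: sum.cartesian_product indicator_def Y_def)
    also have "\<dots> = real (card ((I \<times> F) \<inter> {(r, p). \<pi> ^ M * (\<pi> powi (fst p) * (x + snd p) - uu r) \<in> RI}))"
      using F(1) by (subst sum_of_bool_eq[symmetric]) (auto simp: I_def case_prod_unfold)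
    also have "(I \<times> F) \<inter> {(r, p). \<pi> ^ M * (\<pi> powi (fst p) * (x + snd p) - uu r) \<in> RI} =
        {(r, j, z). r \<in> {q ^ M..<q ^ N} \<and> (j, z) \<in> F \<and> \<pi> ^ M * (\<pi> powi j * (x + z) - uu r) \<in> RI}"
      by (auto simp: I_def)
    also have "real (card \<dots>) \<le> real (N * q ^ M)"
      using card_overlap_le[OF F(1), of N M x] F(2) by (simp only: A_def of_nat_le_iff)
    finally show ?thesis .
  qed
  have "(\<Sum>r\<in>I. infsum (h r) A) = (\<Sum>\<^sub>\<infinity>p\<in>A. \<Sum>r\<in>I. h r p)"
    using h_summ by (intro infsum_sum_finite(2)[symmetric]) (auto simp: I_def)
  also have "\<dots> \<le> energy m f * (real (N * q ^ M) * energy m \<psi>)"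
  proof (rule infsum_le_finite_sums)
    show "(\<lambda>p. \<Sum>r\<in>I. h r p) summable_on A"
      using h_summ by (intro infsum_sum_finite(1)) (auto simp: I_def)
    fix F assume F: "finite F" "F \<subseteq> A"
    have "(\<Sum>p\<in>F. \<Sum>r\<in>I. h r p) \<le>
        (\<Sum>p\<in>F. \<Sum>r\<in>I. energy m f * (\<integral>x. indicator (Y r) (\<pi> powi (fst p) * (x + snd p)) * (cmod (\<psi> x))\<^sup>2 \<partial>m))"
    proof (intro sum_mono)
      show "h r p \<le> energy m f * (\<integral>x. indicator (Y r) (\<pi> powi (fst p) * (x + snd p)) * (cmod (\<psi> x))\<^sup>2 \<partial>m)" for r p
        using h_le[of r "fst p" "snd p"] by simp
    qed
    also have "\<dots> = energy m f * (\<integral>x. (\<Sum>p\<in>F. \<Sum>r\<in>I. indicator (Y r) (\<pi> powi (fst p) * (x + snd p)) * (cmod (\<psi> x))\<^sup>2) \<partial>m)"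
      by (simp add: sum_distrib_left[symmetric] ind_int)
    also have "\<dots> = energy m f * (\<integral>x. (\<Sum>p\<in>F. \<Sum>r\<in>I. indicator (Y r) (\<pi> powi (fst p) * (x + snd p))) * (cmod (\<psi> x))\<^sup>2 \<partial>m)"
      by (simp add: sum_distrib_right)
    \<comment> \<open>All the bounds integrate the same density, so their sum over translates,
      scales and positions reduces to a pointwise count of balls.\<close>
    also have "\<dots> \<le> energy m f * (\<integral>x. real (N * q ^ M) * (cmod (\<psi> x))\<^sup>2 \<partial>m)"
    proof (intro mult_left_mono integral_mono mult_right_mono count[OF F])
      show "integrable m (\<lambda>x. (\<Sum>p\<in>F. \<Sum>r\<in>I. indicator (Y r) (\<pi> powi (fst p) * (x + snd p))) * (cmod (\<psi> x))\<^sup>2)"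
        unfolding sum_distrib_right by (intro Bochner_Integration.integrable_sum ind_int)
    qed (use \<psi> in \<open>auto simp: L2_def\<close>)
    also have "\<dots> = energy m f * (real (N * q ^ M) * energy m \<psi>)"
      by (simp add: energy_def)
    finally show "(\<Sum>p\<in>F. \<Sum>r\<in>I. h r p) \<le> energy m f * (real (N * q ^ M) * energy m \<psi>)" .
  qed
  finally have high: "(\<Sum>r\<in>I. infsum (h r) A) \<le> energy m f * (real (N * q ^ M) * energy m \<psi>)" .
  have "(\<Sum>r<q ^ M. infsum (h r) A) \<le> (\<Sum>r<q ^ M. B * energy m f)"
    unfolding h_def A_def by (intro sum_mono tail_term_le[OF bes f \<psi>])
  then have low: "(\<Sum>r<q ^ M. infsum (h r) A) \<le> real (q ^ M) * (B * energy m f)"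
    by simp
  have "q ^ M \<le> q ^ N"
    using \<open>M \<le> N\<close> q_gt_1 by (intro power_increasing) auto
  then have "(\<Sum>r<q ^ N. infsum (h r) A) = (\<Sum>r<q ^ M. infsum (h r) A) + (\<Sum>r\<in>I. infsum (h r) A)"
    unfolding I_def lessThan_atLeast0 by (intro sum.atLeastLessThan_concat[symmetric]) auto
  also have "\<dots> \<le> real (q ^ M) * (B * energy m f) + energy m f * (real (N * q ^ M) * energy m \<psi>)"
    using low high by simp
  finally have "(1 / real (q ^ N)) * (\<Sum>r<q ^ N. infsum (h r) A) \<le> (1 / real (q ^ N)) *
    (real (q ^ M) * (B * energy m f) + energy m f * (real (N * q ^ M) * energy m \<psi>))"
    by (rule mult_left_mono) simp
  moreover have "h = (\<lambda>r x. (cmod (shift (uu r) (coef \<psi> f) x))\<^sup>2)"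
    by (simp add: h_def fun_eq_iff)
  ultimately show ?thesis
    by (simp only: tail_def A_def)
qed

lemma truncation:
  assumes f: "f \<in> L2 m"
  defines "Y \<equiv> \<lambda>M. {x. \<pi> ^ M * x \<in> RI}"
  shows "Y M \<in> sets m" and "(\<lambda>M. energy m (\<lambda>x. indicator (- Y M) x * f x)) \<longlonglongrightarrow> 0"
proof -
  show Y_sets: "Y M \<in> sets m" for M
    using measurable_sets[OF scale_measurable RI_sets, of "\<pi> ^ M"] by (simp add: Y_def space_m vimage_def)
  have eq: "(cmod (indicator (- Y M) x * f x))\<^sup>2 = indicator (- Y M) x * (cmod (f x))\<^sup>2" for M x
    by (simp add: indicator_def)
  have "(\<lambda>M. \<integral>x. indicator (- Y M) x * (cmod (f x))\<^sup>2 \<partial>m) \<longlonglongrightarrow> (\<integral>x. 0 \<partial>m)"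
  proof (rule integral_dominated_convergence[where w = "\<lambda>x. (cmod (f x))\<^sup>2"])
    show "(\<lambda>x. indicator (- Y M) x * (cmod (f x))\<^sup>2) \<in> borel_measurable m" for M
      using f Y_sets[of M] sets.compl_sets[OF Y_sets[of M]]
      by (intro borel_measurable_times borel_measurable_indicator) (auto simp: L2_def space_m Compl_eq_Diff_UNIV)
    show "AE x in m. (\<lambda>M. indicator (- Y M) x * (cmod (f x))\<^sup>2) \<longlonglongrightarrow> 0"
    proof (rule AE_I2)
      fix x
      obtain N where N: "\<pi> ^ N * x \<in> RI"
        using exists_\<pi>_power_RI by blast
      have "\<forall>\<^sub>F M in sequentially. indicator (- Y M) x * (cmod (f x))\<^sup>2 = 0"
        using eventually_ge_at_top[of N]
      proof eventually_elim
        case (elim M)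
        then show ?case
          using \<pi>_power_RI_mono[OF N] by (simp add: Y_def)
      qed
      then show "(\<lambda>M. indicator (- Y M) x * (cmod (f x))\<^sup>2) \<longlonglongrightarrow> 0"
        by (rule tendsto_eventually)
    qed
  qed (use f in \<open>auto simp: L2_def indicator_def\<close>)
  then show "(\<lambda>M. energy m (\<lambda>x. indicator (- Y M) x * f x)) \<longlonglongrightarrow> 0"
    by (simp add: energy_def eq)
qed

lemma tail_tendsto_0:
  assumes bes: "bessel B \<psi>" and f: "f \<in> L2 m" and \<psi>: "\<psi> \<in> L2 m"
  shows "tail \<psi> f \<longlonglongrightarrow> 0"
proof (rule LIMSEQ_I)
  fix e :: real assume e: "e > 0"
  define Y where "Y M = {x. \<pi> ^ M * x \<in> RI}" for M
  have B: "B \<ge> 0"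
    using bes by (simp add: bessel_def)
  have Y_sets: "Y M \<in> sets m" for M
    unfolding Y_def by (rule truncation[OF f])
  have "(\<lambda>M. energy m (\<lambda>x. indicator (- Y M) x * f x)) \<longlonglongrightarrow> 0"
    unfolding Y_def by (rule truncation[OF f])
  then have "(\<lambda>M. 2 * (B * energy m (\<lambda>x. indicator (- Y M) x * f x))) \<longlonglongrightarrow> 2 * (B * 0)"
    by (intro tendsto_mult tendsto_const)
  then have "\<forall>\<^sub>F M in sequentially. 2 * (B * energy m (\<lambda>x. indicator (- Y M) x * f x)) < e / 2"
    by (rule order_tendstoD(2)) (use e in simp)
  \<comment> \<open>\<open>M\<close> is fixed first: the Bessel bound controls the tail of the part
    of \<open>f\<close> outside \<open>Y M\<close> for every \<open>N\<close> at once.\<close>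
  then obtain M where M: "2 * (B * energy m (\<lambda>x. indicator (- Y M) x * f x)) < e / 2"
    by (auto simp: eventually_sequentially)
  define g where "g = (\<lambda>x. indicator (Y M) x * f x)"
  define h where "h = (\<lambda>x. indicator (- Y M) x * f x)"
  have compl: "- Y M \<in> sets m"
    using sets.compl_sets[OF Y_sets[of M]] by (simp add: space_m Compl_eq_Diff_UNIV)
  have gh: "g \<in> L2 m" "h \<in> L2 m"
    unfolding g_def h_def by (intro L2_indicator f Y_sets compl)+
  have f_eq: "f = (\<lambda>x. g x + h x)"
    by (auto simp: g_def h_def indicator_def)
  define C1 where "C1 = real (q ^ M) * (B * energy m g)"
  define C2 where "C2 = energy m g * (real (q ^ M) * energy m \<psi>)"
  \<comment> \<open>The factor \<open>N\<close> of the overlap count is beaten by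
    \<open>q ^ N\<close>.\<close>
  have lim: "(\<lambda>N. 2 * (C1 * (1 / real q) ^ N + C2 * (real N * (1 / real q) ^ N))) \<longlonglongrightarrow> 2 * (C1 * 0 + C2 * 0)"
    using q_gt_1
    by (intro tendsto_intros LIMSEQ_power_zero powser_times_n_limit_0) auto
  then have "\<forall>\<^sub>F N in sequentially. 2 * (C1 * (1 / real q) ^ N + C2 * (real N * (1 / real q) ^ N)) < e / 2"
    by (rule order_tendstoD(2)) (use e in simp)
  then have "\<forall>\<^sub>F N in sequentially. tail \<psi> f N < e"
    using eventually_ge_at_top[of M]
  proof eventually_elim
    case (elim N)
    have "tail \<psi> g N \<le> (1 / real (q ^ N)) *
        (real (q ^ M) * (B * energy m g) + energy m g * (real (N * q ^ M) * energy m \<psi>))"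
      using elim by (intro tail_bounded_support[OF bes gh(1) \<psi>]) (auto simp: g_def Y_def)
    also have "\<dots> = C1 * (1 / real q) ^ N + C2 * (real N * (1 / real q) ^ N)"
      by (simp add: C1_def C2_def power_one_over field_simps)
    finally have "2 * tail \<psi> g N < e / 2"
      using elim by simp
    moreover have "2 * tail \<psi> h N < e / 2"
      using tail_le[OF bes gh(2) \<psi>, of N] M by (simp add: h_def)
    moreover have "tail \<psi> f N \<le> 2 * tail \<psi> g N + 2 * tail \<psi> h N"
      by (subst f_eq) (rule tail_add_le[OF bes \<psi> gh])
    ultimately show ?case
      by simp
  qed
  then show "\<exists>N0. \<forall>N\<ge>N0. norm (tail \<psi> f N - 0) < e"
    using tail_nonneg by (auto simp: eventually_sequentially)
qed

end

section \<open>Continuity of translations\<close>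

text \<open>Reduces continuity of translations in \<open>L\<^sup>2\<close> to \<open>L\<^sup>1\<close>.\<close>

lemma cmod_diff_square_le:
  "(cmod (a - b))\<^sup>2 \<le> 2 * cmod (a * of_real (cmod a) - b * of_real (cmod b))"
proof (cases "a = b")
  case False
  define z where "z = a * of_real (cmod a) - b * of_real (cmod b)"
  define A where "A = cmod a"
  define B where "B = cmod b"
  define D where "D = cmod (a - b)"
  have D: "D > 0"
    using False by (simp add: D_def)
  have dot: "2 * (a \<bullet> b) = A\<^sup>2 + B\<^sup>2 - D\<^sup>2"
    by (simp add: A_def B_def D_def power2_norm_eq_inner inner_diff_left inner_diff_right inner_commute)
  have z: "z = A *\<^sub>R a - B *\<^sub>R b"
    by (simp add: z_def A_def B_def scaleR_conv_of_real mult.commute)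
  \<comment> \<open>Pairing \<open>z\<close> with \<open>a - b\<close> gives \<open>2 * (z \<bullet>
    (a - b)) = (A + B) * (D\<^sup>2 + (A - B)\<^sup>2)\<close>. Since \<open>A + B \<ge> D\<close>,
    this is at least the cube of \<open>D\<close>, while Cauchy-Schwarz bounds it by
    \<open>2 * cmod z * D\<close>.\<close>
  have "2 * (z \<bullet> (a - b)) = 2 * (A * A\<^sup>2 + B * B\<^sup>2) - (A + B) * (2 * (a \<bullet> b))"
    unfolding z
    by (simp add: inner_diff_left inner_diff_right inner_commute A_def B_def power2_norm_eq_inner algebra_simps)
  also have "\<dots> = (A + B) * D\<^sup>2 + (A + B) * (A - B)\<^sup>2"
    unfolding dot by (simp add: power2_eq_square algebra_simps)
  also have "\<dots> \<ge> (A + B) * D\<^sup>2"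
    by (simp add: A_def B_def)
  also (xtrans) have "(A + B) * D\<^sup>2 \<ge> D * D\<^sup>2"
    unfolding A_def B_def D_def by (intro mult_right_mono norm_triangle_ineq4) auto
  finally have "D * D\<^sup>2 \<le> 2 * (z \<bullet> (a - b))" .
  also have "\<dots> \<le> 2 * (cmod z * D)"
    unfolding D_def by (intro mult_left_mono norm_cauchy_schwarz) auto
  finally have "D * D\<^sup>2 \<le> D * (2 * cmod z)"
    by (simp add: mult_ac)
  then show ?thesis
    using D by (simp add: D_def z_def)
qed simp

lemma integrable_complex_indicator:
  assumes "A \<in> sets M" "emeasure M A < \<infinity>"
  shows "integrable M (indicator A :: _ \<Rightarrow> complex)"
proof -
  have "(indicator A :: _ \<Rightarrow> complex) = (\<lambda>x. indicator A x *\<^sub>R 1)"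
    by (auto simp: indicator_def)
  then show ?thesis
    using integrable_indicator[OF assms, of "1::complex"] by simp
qed

context positive_char_local_field
begin

text \<open>Continuity along a single sequence of translations suffices, because the density
  argument approaches a given translation by one sequence.\<close>

definition L1_continuous :: "(nat \<Rightarrow> 'a) \<Rightarrow> ('a \<Rightarrow> complex) \<Rightarrow> bool" where
  "L1_continuous d f \<longleftrightarrow> integrable m f \<and> (\<lambda>i. \<integral>x. cmod (f (x - d i) - f x) \<partial>m) \<longlonglongrightarrow> 0"

lemma integrable_minus_translate:
  fixes f :: "'a \<Rightarrow> 'b::{banach, second_countable_topology}"
  assumes "integrable m f" shows "integrable m (\<lambda>x. f (x - y))"
  using integrable_translate_iff[OF borel_measurable_integrable[OF assms], of "- y"] assms by simp

lemma integral_minus_translate: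
  fixes f :: "'a \<Rightarrow> 'b::{banach, second_countable_topology}"
  assumes "integrable m f" shows "(\<integral>x. f (x - y) \<partial>m) = (\<integral>x. f x \<partial>m)"
  using integral_translate[OF borel_measurable_integrable[OF assms], of "- y"] by simp

lemma L1_continuous_cmult:
  assumes "L1_continuous d f" shows "L1_continuous d (\<lambda>x. a * f x)"
proof -
  have "cmod (a * f (x - d i) - a * f x) = cmod a * cmod (f (x - d i) - f x)" for x i
    by (simp flip: right_diff_distrib add: norm_mult)
  then show ?thesis
    using assms tendsto_mult_left[of "\<lambda>i. \<integral>x. cmod (f (x - d i) - f x) \<partial>m" 0 sequentially "cmod a"]
    by (simp add: L1_continuous_def)
qed

lemma L1_continuous_add:
  assumes "L1_continuous d f" "L1_continuous d g" shows "L1_continuous d (\<lambda>x. f x + g x)"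
proof -
  have int: "integrable m f" "integrable m g"
    using assms by (auto simp: L1_continuous_def)
  have "(\<lambda>i. (\<integral>x. cmod (f (x - d i) - f x) \<partial>m) + (\<integral>x. cmod (g (x - d i) - g x) \<partial>m)) \<longlonglongrightarrow> 0 + 0"
    using assms by (intro tendsto_add) (auto simp: L1_continuous_def)
  then have lim: "(\<lambda>i. (\<integral>x. cmod (f (x - d i) - f x) \<partial>m) + (\<integral>x. cmod (g (x - d i) - g x) \<partial>m)) \<longlonglongrightarrow> 0"
    by simp
  have "(\<integral>x. cmod ((f (x - d i) + g (x - d i)) - (f x + g x)) \<partial>m) \<le>
      (\<integral>x. cmod (f (x - d i) - f x) + cmod (g (x - d i) - g x) \<partial>m)" for i
    using int integrable_minus_translate[OF int(1)] integrable_minus_translate[OF int(2)]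
    by (intro integral_mono) (auto intro!: integrable_norm norm_diff_triangle_ineq)
  also have "\<dots> i = (\<integral>x. cmod (f (x - d i) - f x) \<partial>m) + (\<integral>x. cmod (g (x - d i) - g x) \<partial>m)" for i
    using int integrable_minus_translate[OF int(1)] integrable_minus_translate[OF int(2)]
    by (intro Bochner_Integration.integral_add integrable_norm Bochner_Integration.integrable_diff)
  finally have "(\<lambda>i. \<integral>x. cmod ((f (x - d i) + g (x - d i)) - (f x + g x)) \<partial>m) \<longlonglongrightarrow> 0"
    by (intro Lim_null_comparison[OF _ lim]) auto
  then show ?thesis
    using int by (simp add: L1_continuous_def)
qed

lemma L1_continuous_sum:
  assumes "finite I" "\<And>k. k \<in> I \<Longrightarrow> L1_continuous d (f k)"
  shows "L1_continuous d (\<lambda>x. \<Sum>k\<in>I. f k x)"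
  using assms
proof (induction I rule: finite_induct)
  case empty
  then show ?case
    by (simp add: L1_continuous_def)
next
  case (insert k I)
  then show ?case
    using L1_continuous_add[of d "f k" "\<lambda>x. \<Sum>k\<in>I. f k x"] by simp
qed

text \<open>Dominated convergence makes some \<open>s n\<close> close to \<open>f\<close> in mean;
  its translate is equally close to the translate of \<open>f\<close> by invariance of the integral,
  which leaves the continuity of \<open>s n\<close>.\<close>

lemma L1_continuous_limit:
  assumes s: "\<And>n::nat. L1_continuous d (s n)" and f: "f \<in> borel_measurable m"
    and lim: "\<And>x. (\<lambda>n. s n x) \<longlonglongrightarrow> f x"
    and w: "integrable m w" "\<And>n x. cmod (s n x) \<le> w x"
  shows "L1_continuous d f"
proof -
  have s_int: "integrable m (s n)" for n
    using s by (simp add: L1_continuous_def)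
  have f_le: "cmod (f x) \<le> w x" for x
    by (rule LIMSEQ_le_const2[OF tendsto_norm[OF lim]]) (use w in auto)
  then have f_int: "integrable m f"
    by (intro Bochner_Integration.integrable_bound[OF w(1) f] AE_I2) (metis abs_ge_self order_trans real_norm_def)
  have "(\<lambda>n. \<integral>x. cmod (s n x - f x) \<partial>m) \<longlonglongrightarrow> (\<integral>x. 0 \<partial>m)"
  proof (rule integral_dominated_convergence[where w = "\<lambda>x. 2 * w x"])
    show "AE x in m. (\<lambda>n. cmod (s n x - f x)) \<longlonglongrightarrow> 0"
      using tendsto_norm_zero[OF LIM_zero[OF lim]] by (auto intro!: AE_I2)
    have "cmod (s n x - f x) \<le> 2 * w x" for n x
      using norm_triangle_ineq4[of "s n x" "f x"] w(2)[of n x] f_le[of x] by simp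
    then show "AE x in m. norm (cmod (s n x - f x)) \<le> 2 * w x" for n
      by simp
  qed (use w s_int f_int in \<open>auto intro!: borel_measurable_norm\<close>)
  then have close: "(\<lambda>n. \<integral>x. cmod (s n x - f x) \<partial>m) \<longlonglongrightarrow> 0"
    by simp
  have "(\<lambda>i. \<integral>x. cmod (f (x - d i) - f x) \<partial>m) \<longlonglongrightarrow> 0"
  proof (rule LIMSEQ_I)
    fix e :: real assume "e > 0"
    then obtain n where n: "(\<integral>x. cmod (s n x - f x) \<partial>m) < e / 3"
      using order_tendstoD(2)[OF close, of "e / 3"] by (auto simp: eventually_sequentially)
    have "\<forall>\<^sub>F i in sequentially. (\<integral>x. cmod (s n (x - d i) - s n x) \<partial>m) < e / 3"
      using s[of n] \<open>e > 0\<close> by (intro order_tendstoD(2)[where y = 0]) (auto simp: L1_continuous_def)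
    then have "\<forall>\<^sub>F i in sequentially. (\<integral>x. cmod (f (x - d i) - f x) \<partial>m) < e"
    proof eventually_elim
      case (elim i)
      have int: "integrable m (\<lambda>x. cmod (s n (x - d i) - f (x - d i)))"
        "integrable m (\<lambda>x. cmod (s n x - f x))" "integrable m (\<lambda>x. cmod (s n (x - d i) - s n x))"
        using s_int[of n] f_int integrable_minus_translate[OF s_int[of n]] integrable_minus_translate[OF f_int]
        by (auto intro!: integrable_norm Bochner_Integration.integrable_diff)
      have "(\<integral>x. cmod (f (x - d i) - f x) \<partial>m) \<le>
          (\<integral>x. cmod (s n (x - d i) - f (x - d i)) + cmod (s n (x - d i) - s n x) + cmod (s n x - f x) \<partial>m)"
      proof (rule integral_mono)
        show "integrable m (\<lambda>x. cmod (f (x - d i) - f x))"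
          using f_int integrable_minus_translate[OF f_int]
          by (intro integrable_norm Bochner_Integration.integrable_diff)
        show "integrable m (\<lambda>x. cmod (s n (x - d i) - f (x - d i)) + cmod (s n (x - d i) - s n x) + cmod (s n x - f x))"
          by (intro Bochner_Integration.integrable_add int)
        fix x
        have "cmod ((p - q') + (r - p)) \<le> cmod (p - q') + cmod (r - p)" for p q' r :: complex
          by (rule norm_triangle_ineq)
        then show "cmod (f (x - d i) - f x) \<le> cmod (s n (x - d i) - f (x - d i)) + cmod (s n (x - d i) - s n x) + cmod (s n x - f x)"
          using norm_triangle_ineq[of "f (x - d i) - s n (x - d i)" "s n (x - d i) - f x"]
            norm_triangle_ineq[of "s n (x - d i) - s n x" "s n x - f x"]
          by (simp add: norm_minus_commute)
      qed
      also have "\<dots> = (\<integral>x. cmod (s n (x - d i) - f (x - d i)) \<partial>m) + (\<integral>x. cmod (s n (x - d i) - s n x) \<partial>m) + (\<integral>x. cmod (s n x - f x) \<partial>m)"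
        using int by simp
      also have "(\<integral>x. cmod (s n (x - d i) - f (x - d i)) \<partial>m) = (\<integral>x. cmod (s n x - f x) \<partial>m)"
        by (rule integral_minus_translate[OF int(2)])
      finally show ?case
        using n elim by simp
    qed
    then show "\<exists>i0. \<forall>i\<ge>i0. norm ((\<integral>x. cmod (f (x - d i) - f x) \<partial>m) - 0) < e"
      by (auto simp: eventually_sequentially)
  qed
  then show ?thesis
    using f_int by (simp add: L1_continuous_def)
qed

text \<open>\<open>V n\<close> consists of the points whose ball \<open>x + \<pi> ^ n * RI\<close>
  stays in \<open>U\<close>. It is a union of such balls, so \<open>d i\<close> leaves its indicator
  unchanged once \<open>i \<ge> n\<close>, and the \<open>V n\<close> exhaust
  \<open>U\<close>.\<close>

lemma L1_continuous_indicator_open: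
  assumes d: "\<And>i. \<exists>t\<in>RI. d i = \<pi> ^ i * t" and U: "open U" "emeasure m U < \<infinity>"
  shows "L1_continuous d (indicator U)"
proof -
  define V where "V n = {x. \<forall>t\<in>RI. x + \<pi> ^ n * t \<in> U}" for n
  have V_inv: "x + \<pi> ^ i * t \<in> V n" if "x \<in> V n" "n \<le> i" "t \<in> RI" for x n i t
  proof -
    have "x + \<pi> ^ i * t + \<pi> ^ n * t' \<in> U" if "t' \<in> RI" for t'
    proof -
      have "\<pi> ^ (i - n) * t + t' \<in> RI"
        using that \<open>t \<in> RI\<close> v_less_1_\<pi>
        by (intro RI_add RI_mult) (auto simp: mem_RI v_power power_le_one)
      then have "x + \<pi> ^ n * (\<pi> ^ (i - n) * t + t') \<in> U"
        using \<open>x \<in> V n\<close> by (simp add: V_def)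
      moreover have "\<pi> ^ n * (\<pi> ^ (i - n) * t + t') = \<pi> ^ i * t + \<pi> ^ n * t'"
        using \<open>n \<le> i\<close> by (simp add: distrib_left mult.assoc[symmetric] power_add[symmetric])
      ultimately show ?thesis
        by (simp add: add.assoc)
    qed
    then show ?thesis
      by (simp add: V_def)
  qed
  have V_open: "open (V n)" for n
  proof -
    have "V n = (\<Union>x\<in>V n. (+) x ` (*) (\<pi> ^ n) ` RI)"
      using V_inv[of _ n n] by (auto simp: image_iff intro!: bexI[of _ 0] bexI[of "\<lambda>x. \<exists>t\<in>RI. _ = x + \<pi> ^ n * t"])
    moreover have "open (\<Union>x\<in>V n. (+) x ` (*) (\<pi> ^ n) ` RI)"
      by (intro open_UN ballI open_translate open_scale open_RI) simp
    ultimately show ?thesis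
      by simp
  qed
  have V_sub: "V n \<subseteq> U" for n
    by (auto simp: V_def dest: bspec[of _ _ 0])
  show ?thesis
  proof (rule L1_continuous_limit[where s = "\<lambda>n. indicator (V n)" and w = "indicator U"])
    fix n
    have "emeasure m (V n) < \<infinity>"
      using emeasure_mono[OF V_sub[of n] open_sets_m[OF U(1)]] U(2) by (rule le_less_trans)
    then have "integrable m (indicator (V n) :: 'a \<Rightarrow> complex)"
      using V_open by (intro integrable_complex_indicator open_sets_m)
    moreover have "(indicator (V n) (x - d i) :: complex) = indicator (V n) x" if "n \<le> i" for x i
    proof -
      obtain t where t: "t \<in> RI" "d i = \<pi> ^ i * t"
        using d by blast
      have "x - d i \<in> V n \<longleftrightarrow> x \<in> V n"
        using V_inv[of "x - d i" n i t] V_inv[of x n i "- t"] t that by (auto simp: RI_uminus)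
      then show ?thesis
        by (simp add: indicator_def)
    qed
    then have "\<forall>\<^sub>F i in sequentially. (\<integral>x. cmod (indicator (V n) (x - d i) - indicator (V n) x) \<partial>m) = 0"
      unfolding eventually_sequentially by (intro exI[of _ n]) simp
    then have "(\<lambda>i. \<integral>x. cmod (indicator (V n) (x - d i) - indicator (V n) x) \<partial>m) \<longlonglongrightarrow> 0"
      by (rule tendsto_eventually)
    ultimately show "L1_continuous d (indicator (V n))"
      by (simp add: L1_continuous_def)
  next
    fix x
    show "(\<lambda>n. indicator (V n) x :: complex) \<longlonglongrightarrow> indicator U x"
    proof (cases "x \<in> U")
      case True
      have "open ((+) x -` U)"
        by (intro open_vimage continuous_on_translation U)
      then obtain n where n: "\<forall>t\<in>RI. \<pi> ^ n * t \<in> (+) x -` U"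
        using \<pi>_power_RI_small[of "(+) x -` U"] True by auto
      have "x \<in> V k" if "n \<le> k" for k
      proof -
        have "x + \<pi> ^ k * t \<in> U" if "t \<in> RI" for t
        proof -
          have "\<pi> ^ (k - n) * t \<in> RI"
            using that v_less_1_\<pi> by (intro RI_mult) (auto simp: mem_RI v_power power_le_one)
          then have "x + \<pi> ^ n * (\<pi> ^ (k - n) * t) \<in> U"
            using n by auto
          then show ?thesis
            using \<open>n \<le> k\<close> by (simp add: mult.assoc[symmetric] power_add[symmetric])
        qed
        then show ?thesis
          by (simp add: V_def)
      qed
      then have "\<forall>\<^sub>F k in sequentially. (indicator (V k) x :: complex) = indicator U x"
        using True unfolding eventually_sequentially by (intro exI[of _ n]) simp
      then show ?thesis
        by (rule tendsto_eventually)
    next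
      case False
      then have "x \<notin> V n" for n
        using V_sub by blast
      then show ?thesis
        using False by simp
    qed
  next
    show "cmod (indicator (V n) x) \<le> indicator U x" for n x
      using V_sub[of n] by (auto simp: indicator_def)
  qed (use U in \<open>auto intro!: borel_measurable_indicator open_sets_m simp: integrable_indicator_iff space_m\<close>)
qed

lemma emeasure_ball_finite: "emeasure m {x. \<pi> ^ M * x \<in> RI} < \<infinity>"
proof -
  have "{x. \<pi> ^ M * x \<in> RI} = (*) (inverse (\<pi> ^ M)) ` RI"
    by (subst scale_image_eq_vimage) auto
  then show ?thesis
    by (simp add: emeasure_scale_RI del: power_inverse)
qed

text \<open>Open sets are stable under intersection, so complements and disjoint unions reach all
  Borel sets. Cutting with the ball \<open>Y M\<close> keeps measures finite, which makes a
  complement a difference of integrable indicators.\<close>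

lemma L1_continuous_indicator_ball:
  assumes d: "\<And>i. \<exists>t\<in>RI. d i = \<pi> ^ i * t" and E: "E \<in> sets m"
  defines "Y \<equiv> \<lambda>M. {x. \<pi> ^ M * x \<in> RI}"
  shows "L1_continuous d (indicator (E \<inter> Y M))"
proof -
  have Y_open: "open (Y M)" for M
    using open_vimage[OF open_RI continuous_on_scale[of UNIV "\<pi> ^ M"]] by (simp add: Y_def vimage_def)
  have Y_fin: "emeasure m (Y M) < \<infinity>" for M
    unfolding Y_def by (rule emeasure_ball_finite)
  have Y_sets: "Y M \<in> sets m"
    by (intro open_sets_m Y_open)
  have fin: "emeasure m (A \<inter> Y M) < \<infinity>" for A
    using emeasure_mono[OF Int_lower2 Y_sets, of A] Y_fin[of M] by (rule le_less_trans)
  have "Int_stable {S :: 'a set. open S}" "{S :: 'a set. open S} \<subseteq> Pow UNIV" "E \<in> sigma_sets UNIV {S. open S}"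
    using E by (auto simp: sets_m borel_def Int_stable_def)
  then show ?thesis
  proof (induction rule: sigma_sets_induct_disjoint[consumes 3])
    case (basic A)
    then show ?case
      using Y_open fin by (intro L1_continuous_indicator_open[OF d]) auto
  next
    case empty
    then show ?case
      by (simp add: L1_continuous_def)
  next
    case (compl A)
    have "L1_continuous d (\<lambda>x. indicator (Y M) x + (- 1) * indicator (A \<inter> Y M) x)"
      by (intro L1_continuous_add L1_continuous_cmult compl L1_continuous_indicator_open[OF d] Y_open Y_fin)
    also have "(\<lambda>x. indicator (Y M) x + (- 1) * indicator (A \<inter> Y M) x :: complex) = indicator ((UNIV - A) \<inter> Y M)"
      by (auto simp: indicator_def)
    finally show ?case .
  next
    case (union A)
    have A_sets: "A k \<in> sets m" for k
      using union(2) by (auto simp: sets_m borel_def)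
    have sum_eq: "(\<Sum>k<n. indicator (A k \<inter> Y M) x) = (indicator ((\<Union>k<n. A k) \<inter> Y M) x :: complex)" for n x
    proof -
      have "disjoint_family_on (\<lambda>k. A k \<inter> Y M) {..<n}"
        using union(1) by (auto simp: disjoint_family_on_def)
      then have "indicator (\<Union>k<n. A k \<inter> Y M) x = (\<Sum>k<n. indicator (A k \<inter> Y M) x :: complex)"
        by (intro indicator_UN_disjoint) auto
      then show ?thesis
        by simp
    qed
    show ?case
    proof (rule L1_continuous_limit[where s = "\<lambda>n x. \<Sum>k<n. indicator (A k \<inter> Y M) x" and w = "indicator (Y M)"])
      show "L1_continuous d (\<lambda>x. \<Sum>k<n. indicator (A k \<inter> Y M) x)" for n
        by (intro L1_continuous_sum union) auto
      show "(indicator (\<Union> (range A) \<inter> Y M) :: _ \<Rightarrow> complex) \<in> borel_measurable m"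
        using A_sets Y_sets by (intro borel_measurable_indicator sets.Int sets.countable_UN) auto
      show "(\<lambda>n. \<Sum>k<n. indicator (A k \<inter> Y M) x) \<longlonglongrightarrow> (indicator (\<Union> (range A) \<inter> Y M) x :: complex)" for x
      proof (cases "x \<in> \<Union> (range A) \<inter> Y M")
        case True
        then obtain k where "x \<in> A k" "x \<in> Y M"
          by auto
        then have "\<forall>\<^sub>F n in sequentially. (\<Sum>k<n. indicator (A k \<inter> Y M) x) = (indicator (\<Union> (range A) \<inter> Y M) x :: complex)"
          unfolding sum_eq eventually_sequentially by (intro exI[of _ "Suc k"]) (auto simp: indicator_def)
        then show ?thesis
          by (rule tendsto_eventually)
      next
        case False
        then have "indicator ((\<Union>k<n. A k) \<inter> Y M) x = (0 :: complex)"
          "indicator (\<Union> (range A) \<inter> Y M) x = (0 :: complex)" for n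
          by auto
        then show ?thesis
          unfolding sum_eq by simp
      qed
      show "cmod (\<Sum>k<n. indicator (A k \<inter> Y M) x) \<le> indicator (Y M) x" for n x
        unfolding sum_eq by (auto simp: indicator_def)
    qed (use Y_sets Y_fin in \<open>auto simp: space_m\<close>)
  qed
qed

lemma L1_continuous_integrable:
  assumes d: "\<And>i. \<exists>t\<in>RI. d i = \<pi> ^ i * t" and f: "integrable m f"
  shows "L1_continuous d f"
  using f
proof (induction rule: integrable_induct)
  case (base A a)
  have "L1_continuous d (indicator A)"
  proof (rule L1_continuous_limit[where s = "\<lambda>M. indicator (A \<inter> {x. \<pi> ^ M * x \<in> RI})" and w = "indicator A"])
    show "L1_continuous d (indicator (A \<inter> {x. \<pi> ^ M * x \<in> RI}))" for M
      by (rule L1_continuous_indicator_ball[OF d base(1)])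
    show "(\<lambda>M. indicator (A \<inter> {x. \<pi> ^ M * x \<in> RI}) x) \<longlonglongrightarrow> (indicator A x :: complex)" for x
    proof -
      obtain N where N: "\<pi> ^ N * x \<in> RI"
        using exists_\<pi>_power_RI by blast
      have "\<forall>\<^sub>F M in sequentially. (indicator (A \<inter> {x. \<pi> ^ M * x \<in> RI}) x :: complex) = indicator A x"
        unfolding eventually_sequentially
        using \<pi>_power_RI_mono[OF N] by (intro exI[of _ N]) (auto simp: indicator_def)
      then show ?thesis
        by (rule tendsto_eventually)
    qed
  qed (use base in \<open>auto simp: indicator_def\<close>)
  moreover have "(\<lambda>x. indicator A x *\<^sub>R a) = (\<lambda>x. a * indicator A x)"
    by (auto simp: indicator_def)
  ultimately show ?case
    using L1_continuous_cmult[of d "indicator A" a] by simp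
next
  case (add f g)
  show ?case
    by (rule L1_continuous_add[OF add(3,4)])
next
  case (lim f s)
  show ?case
    by (rule L1_continuous_limit[where s = s and w = "\<lambda>x. 2 * cmod (f x)"]) (use lim in \<open>auto simp: space_m\<close>)
qed

lemma energy_translate_diff_tendsto_0:
  assumes d: "\<And>i. \<exists>t\<in>RI. d i = \<pi> ^ i * t" and f: "f \<in> L2 m"
  shows "(\<lambda>i. energy m (\<lambda>x. translate (d i) f x - f x)) \<longlonglongrightarrow> 0"
proof -
  define F where "F x = f x * of_real (cmod (f x))" for x
  have F_meas: "F \<in> borel_measurable m"
    unfolding F_def using f by (auto simp: L2_def)
  have F: "integrable m F"
  proof (rule Bochner_Integration.integrable_bound[OF L2_integrable_square[OF f] F_meas])
    show "AE x in m. norm (F x) \<le> norm ((cmod (f x))\<^sup>2)"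
      by (simp add: F_def norm_mult power2_eq_square)
  qed
  have "(\<lambda>i. 2 * (\<integral>x. cmod (F (x - d i) - F x) \<partial>m)) \<longlonglongrightarrow> 2 * 0"
    using L1_continuous_integrable[OF d F] by (intro tendsto_mult tendsto_const) (simp add: L1_continuous_def)
  then have lim: "(\<lambda>i. 2 * (\<integral>x. cmod (F (x - d i) - F x) \<partial>m)) \<longlonglongrightarrow> 0"
    by simp
  have "energy m (\<lambda>x. translate (d i) f x - f x) \<le> 2 * (\<integral>x. cmod (F (x - d i) - F x) \<partial>m)" for i
  proof -
    have "energy m (\<lambda>x. translate (d i) f x - f x) \<le> (\<integral>x. 2 * cmod (F (x - d i) - F x) \<partial>m)"
      unfolding energy_def
    proof (rule integral_mono)
      show "integrable m (\<lambda>x. (cmod (translate (d i) f x - f x))\<^sup>2)"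
        by (intro L2_integrable_square L2_diff L2_translate f)
      show "integrable m (\<lambda>x. 2 * cmod (F (x - d i) - F x))"
        using F integrable_minus_translate[OF F] by auto
      show "(cmod (translate (d i) f x - f x))\<^sup>2 \<le> 2 * cmod (F (x - d i) - F x)" for x
        unfolding translate_def F_def by (rule cmod_diff_square_le)
    qed
    then show ?thesis
      by simp
  qed
  then show ?thesis
    by (intro Lim_null_comparison[OF _ lim]) auto
qed

end

section \<open>The affine and quasi-affine operators\<close>

context positive_char_local_field
begin

definition prodc :: "('a \<Rightarrow> complex) \<Rightarrow> ('a \<Rightarrow> complex) \<Rightarrow> ('a \<Rightarrow> complex) \<Rightarrow> ('a \<Rightarrow> complex) \<Rightarrow> int \<Rightarrow> 'a \<Rightarrow> complex" where
  "prodc \<psi> \<phi> f g j z = coef \<psi> f j z * cnj (coef \<phi> g j z)"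

definition affine_sum :: "('a \<Rightarrow> complex) \<Rightarrow> ('a \<Rightarrow> complex) \<Rightarrow> ('a \<Rightarrow> complex) \<Rightarrow> ('a \<Rightarrow> complex) \<Rightarrow> complex" where
  "affine_sum \<psi> \<phi> f g = (\<Sum>\<^sub>\<infinity>(j, z)\<in>UNIV \<times> Lam. prodc \<psi> \<phi> f g j z)"

definition quasi_affine_sum :: "('a \<Rightarrow> complex) \<Rightarrow> ('a \<Rightarrow> complex) \<Rightarrow> ('a \<Rightarrow> complex) \<Rightarrow> ('a \<Rightarrow> complex) \<Rightarrow> complex" where
  "quasi_affine_sum \<psi> \<phi> f g = (\<Sum>\<^sub>\<infinity>(j, z)\<in>Sigma UNIV LamQ. wt j *\<^sub>R prodc \<psi> \<phi> f g j z)"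

lemma prodc_translate:
  assumes "f \<in> L2 m" "g \<in> L2 m" "\<psi> \<in> L2 m" "\<phi> \<in> L2 m"
  shows "prodc \<psi> \<phi> (translate y f) (translate y g) j z = shift y (prodc \<psi> \<phi> f g) (j, z)"
  using assms by (simp add: prodc_def coef_translate shift_def)

lemma affine_sum_translate:
  assumes "f \<in> L2 m" "g \<in> L2 m" "\<psi> \<in> L2 m" "\<phi> \<in> L2 m"
  shows "affine_sum \<psi> \<phi> (translate y f) (translate y g) = infsum (shift y (prodc \<psi> \<phi> f g)) (UNIV \<times> Lam)"
  unfolding affine_sum_def prodc_translate[OF assms] by simp

lemma quasi_affine_sum_translate:
  assumes "f \<in> L2 m" "g \<in> L2 m" "\<psi> \<in> L2 m" "\<phi> \<in> L2 m" "y \<in> Lam"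
  shows "quasi_affine_sum \<psi> \<phi> (translate y f) (translate y g) = quasi_affine_sum \<psi> \<phi> f g"
  unfolding quasi_affine_sum_def prodc_translate[OF assms(1-4)] by (rule quasi_sum_shift[OF assms(5)])

lemma affine_sum_dilate:
  assumes "f \<in> L2 m" "g \<in> L2 m" "\<psi> \<in> L2 m" "\<phi> \<in> L2 m"
  shows "affine_sum \<psi> \<phi> (dilate \<pi> c i f) (dilate \<pi> c i g) = affine_sum \<psi> \<phi> f g"
proof -
  have "bij_betw (\<lambda>(j, z). (j - i, z)) (UNIV \<times> Lam) (UNIV \<times> Lam)"
    by (rule bij_betwI[where g = "\<lambda>(j, z). (j + i, z)"]) auto
  from infsum_reindex_bij_betw[OF this, of "\<lambda>(j, z). prodc \<psi> \<phi> f g j z"] show ?thesis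
    using assms by (simp add: affine_sum_def prodc_def coef_dilate case_prod_unfold)
qed

context
  fixes \<psi> \<phi> :: "'a \<Rightarrow> complex" and A B :: real
  assumes bes: "bessel A \<psi>" "bessel B \<phi>" and \<psi>: "\<psi> \<in> L2 m" and \<phi>: "\<phi> \<in> L2 m"
begin

lemma norm_shift_prodc_le:
  assumes "t > 0"
  shows "norm (shift y (prodc \<psi> \<phi> f g) x) \<le>
    (t / 2) * (cmod (shift y (coef \<psi> f) x))\<^sup>2 + (1 / (2 * t)) * (cmod (shift y (coef \<phi> g) x))\<^sup>2"
  using two_mult_le_scaled_squares[OF assms, of "cmod (shift y (coef \<psi> f) x)" "cmod (shift y (coef \<phi> g) x)"]
  by (cases x) (simp add: shift_def prodc_def norm_mult field_simps)

text \<open>The weight \<open>t\<close> stays free: \<open>affine_sum_bound\<close> lets it vary to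
  obtain a product bound, whereas the tail estimate takes \<open>t = 1\<close>.\<close>

lemma
  assumes "f \<in> L2 m" "g \<in> L2 m"
  shows prodc_summable: "(\<lambda>x. norm (shift y (prodc \<psi> \<phi> f g) x)) summable_on S \<times> Lam"
    and prodc_bound: "t > 0 \<Longrightarrow> (\<Sum>\<^sub>\<infinity>x\<in>S \<times> Lam. norm (shift y (prodc \<psi> \<phi> f g) x)) \<le>
      (t / 2) * (\<Sum>\<^sub>\<infinity>x\<in>S \<times> Lam. (cmod (shift y (coef \<psi> f) x))\<^sup>2) +
      (1 / (2 * t)) * (\<Sum>\<^sub>\<infinity>x\<in>S \<times> Lam. (cmod (shift y (coef \<phi> g) x))\<^sup>2)"
proof -
  note summ = tail_summable[OF bes(1) assms(1) \<psi>, of y S] tail_summable[OF bes(2) assms(2) \<phi>, of y S]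
  have majorant: "(\<lambda>x. (t / 2) * (cmod (shift y (coef \<psi> f) x))\<^sup>2 + (1 / (2 * t)) * (cmod (shift y (coef \<phi> g) x))\<^sup>2)
      summable_on S \<times> Lam" for t
    by (intro summable_on_add summable_on_cmult_right summ)
  have le: "norm (shift y (prodc \<psi> \<phi> f g) x) \<le>
    (1 / 2) * (cmod (shift y (coef \<psi> f) x))\<^sup>2 + (1 / (2 * 1)) * (cmod (shift y (coef \<phi> g) x))\<^sup>2" for x
    by (rule norm_shift_prodc_le) simp
  show summable: "(\<lambda>x. norm (shift y (prodc \<psi> \<phi> f g) x)) summable_on S \<times> Lam"
    by (rule summable_on_comparison_test[OF majorant[of 1]]) (use le in auto)
  show "(\<Sum>\<^sub>\<infinity>x\<in>S \<times> Lam. norm (shift y (prodc \<psi> \<phi> f g) x)) \<le>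
      (t / 2) * (\<Sum>\<^sub>\<infinity>x\<in>S \<times> Lam. (cmod (shift y (coef \<psi> f) x))\<^sup>2) +
      (1 / (2 * t)) * (\<Sum>\<^sub>\<infinity>x\<in>S \<times> Lam. (cmod (shift y (coef \<phi> g) x))\<^sup>2)" if t: "t > 0"
  proof -
    have "(\<Sum>\<^sub>\<infinity>x\<in>S \<times> Lam. norm (shift y (prodc \<psi> \<phi> f g) x)) \<le>
        (\<Sum>\<^sub>\<infinity>x\<in>S \<times> Lam. (t / 2) * (cmod (shift y (coef \<psi> f) x))\<^sup>2 + (1 / (2 * t)) * (cmod (shift y (coef \<phi> g) x))\<^sup>2)"
      by (intro infsum_mono summable majorant norm_shift_prodc_le t)
    also have "\<dots> = (\<Sum>\<^sub>\<infinity>x\<in>S \<times> Lam. (t / 2) * (cmod (shift y (coef \<psi> f) x))\<^sup>2) +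
        (\<Sum>\<^sub>\<infinity>x\<in>S \<times> Lam. (1 / (2 * t)) * (cmod (shift y (coef \<phi> g) x))\<^sup>2)"
      by (intro infsum_add summable_on_cmult_right summ)
    also have "\<dots> = (t / 2) * (\<Sum>\<^sub>\<infinity>x\<in>S \<times> Lam. (cmod (shift y (coef \<psi> f) x))\<^sup>2) +
        (1 / (2 * t)) * (\<Sum>\<^sub>\<infinity>x\<in>S \<times> Lam. (cmod (shift y (coef \<phi> g) x))\<^sup>2)"
      by (simp only: infsum_cmult_right')
    finally show ?thesis .
  qed
qed

lemma prodc_summable_0:
  assumes "f \<in> L2 m" "g \<in> L2 m"
  shows "(\<lambda>(j, z). prodc \<psi> \<phi> f g j z) summable_on UNIV \<times> Lam"
proof -
  have "shift 0 (prodc \<psi> \<phi> f g) summable_on UNIV \<times> Lam"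
    by (rule abs_summable_summable[OF prodc_summable[OF assms]])
  then show ?thesis
    by (simp add: shift_def)
qed

lemma affine_sum_bound:
  assumes f: "f \<in> L2 m" and g: "g \<in> L2 m"
  shows "(cmod (affine_sum \<psi> \<phi> f g))\<^sup>2 \<le> (A * energy m f) * (B * energy m g)"
proof (rule square_le_if_all_scalings)
  fix t :: real assume t: "t > 0"
  have "affine_sum \<psi> \<phi> f g = infsum (shift 0 (prodc \<psi> \<phi> f g)) (UNIV \<times> Lam)"
    by (simp add: affine_sum_def shift_def)
  then have "cmod (affine_sum \<psi> \<phi> f g) \<le> (\<Sum>\<^sub>\<infinity>x\<in>UNIV \<times> Lam. norm (shift 0 (prodc \<psi> \<phi> f g) x))"
    using norm_infsum_bound[OF prodc_summable[OF f g]] by simp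
  also have "\<dots> \<le> (t / 2) * (\<Sum>\<^sub>\<infinity>x\<in>UNIV \<times> Lam. (cmod (shift 0 (coef \<psi> f) x))\<^sup>2) +
      (1 / (2 * t)) * (\<Sum>\<^sub>\<infinity>x\<in>UNIV \<times> Lam. (cmod (shift 0 (coef \<phi> g) x))\<^sup>2)"
    by (rule prodc_bound[OF f g t])
  also have "\<dots> \<le> (t / 2) * (A * energy m f) + (1 / (2 * t)) * (B * energy m g)"
    using t by (intro add_mono mult_left_mono bessel_shift_bound bes f g \<psi> \<phi>) auto
  finally show "2 * cmod (affine_sum \<psi> \<phi> f g) \<le> t * (A * energy m f) + B * energy m g / t"
    using t by (simp add: field_simps)
qed (use bes in \<open>auto simp: bessel_def\<close>)

lemma
  assumes f: "f \<in> L2 m" and g: "g \<in> L2 m" and h: "h \<in> L2 m"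
  shows affine_sum_diff_left: "affine_sum \<psi> \<phi> (\<lambda>x. f x - h x) g = affine_sum \<psi> \<phi> f g - affine_sum \<psi> \<phi> h g"
    and affine_sum_diff_right: "affine_sum \<psi> \<phi> f (\<lambda>x. g x - h x) = affine_sum \<psi> \<phi> f g - affine_sum \<psi> \<phi> f h"
proof -
  have "affine_sum \<psi> \<phi> (\<lambda>x. f x - h x) g = (\<Sum>\<^sub>\<infinity>x\<in>UNIV \<times> Lam.
      (\<lambda>(j, z). prodc \<psi> \<phi> f g j z) x - (\<lambda>(j, z). prodc \<psi> \<phi> h g j z) x)"
    unfolding affine_sum_def using f h \<psi>
    by (intro infsum_cong) (auto simp: prodc_def coef_diff algebra_simps)
  also have "\<dots> = affine_sum \<psi> \<phi> f g - affine_sum \<psi> \<phi> h g"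
    unfolding affine_sum_def diff_conv_add_uminus
    by (subst infsum_add) (auto intro: prodc_summable_0 f g h summable_on_uminus[THEN iffD2] simp: infsum_uminus)
  finally show "affine_sum \<psi> \<phi> (\<lambda>x. f x - h x) g = affine_sum \<psi> \<phi> f g - affine_sum \<psi> \<phi> h g" .
  have "affine_sum \<psi> \<phi> f (\<lambda>x. g x - h x) = (\<Sum>\<^sub>\<infinity>x\<in>UNIV \<times> Lam.
      (\<lambda>(j, z). prodc \<psi> \<phi> f g j z) x - (\<lambda>(j, z). prodc \<psi> \<phi> f h j z) x)"
    unfolding affine_sum_def using g h \<phi>
    by (intro infsum_cong) (auto simp: prodc_def coef_diff algebra_simps)
  also have "\<dots> = affine_sum \<psi> \<phi> f g - affine_sum \<psi> \<phi> f h"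
    unfolding affine_sum_def diff_conv_add_uminus
    by (subst infsum_add) (auto intro: prodc_summable_0 f g h summable_on_uminus[THEN iffD2] simp: infsum_uminus)
  finally show "affine_sum \<psi> \<phi> f (\<lambda>x. g x - h x) = affine_sum \<psi> \<phi> f g - affine_sum \<psi> \<phi> f h" .
qed

text \<open>The difference is split by changing one argument at a time; each piece has a factor
  whose energy tends to \<open>0\<close>, while the energy of the other stays constant.\<close>

lemma affine_sum_translate_tendsto:
  assumes d: "\<And>i. \<exists>t\<in>RI. d i = \<pi> ^ i * t" and f: "f \<in> L2 m" and g: "g \<in> L2 m"
  shows "(\<lambda>i. affine_sum \<psi> \<phi> (translate (d i) f) (translate (d i) g)) \<longlonglongrightarrow> affine_sum \<psi> \<phi> f g"
proof -
  have null: "X \<longlonglongrightarrow> 0"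
    if "\<And>i. (cmod (X i))\<^sup>2 \<le> Y i" "Y \<longlonglongrightarrow> 0" for X :: "nat \<Rightarrow> complex" and Y
  proof -
    have "(\<lambda>i. (cmod (X i))\<^sup>2) \<longlonglongrightarrow> 0"
      by (rule Lim_null_comparison[OF _ that(2)]) (use that(1) in auto)
    then have "(\<lambda>i. sqrt ((cmod (X i))\<^sup>2)) \<longlonglongrightarrow> sqrt 0"
      by (rule tendsto_real_sqrt)
    then show ?thesis
      by (simp add: tendsto_norm_zero_iff)
  qed
  note L2s = f g L2_translate[OF f] L2_translate[OF g] L2_diff[OF L2_translate[OF f] f] L2_diff[OF L2_translate[OF g] g]
  have 1: "(\<lambda>i. affine_sum \<psi> \<phi> (\<lambda>x. translate (d i) f x - f x) (translate (d i) g)) \<longlonglongrightarrow> 0"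
  proof (rule null)
    show "(cmod (affine_sum \<psi> \<phi> (\<lambda>x. translate (d i) f x - f x) (translate (d i) g)))\<^sup>2 \<le>
        (A * energy m (\<lambda>x. translate (d i) f x - f x)) * (B * energy m g)" for i
      using affine_sum_bound[OF L2s(5) L2s(4), of "d i" "d i"] by (simp only: energy_translate[OF g])
    have "(\<lambda>i. (A * energy m (\<lambda>x. translate (d i) f x - f x)) * (B * energy m g)) \<longlonglongrightarrow> (A * 0) * (B * energy m g)"
      by (intro tendsto_mult tendsto_const energy_translate_diff_tendsto_0[OF d f])
    then show "(\<lambda>i. (A * energy m (\<lambda>x. translate (d i) f x - f x)) * (B * energy m g)) \<longlonglongrightarrow> 0"
      by simp
  qed
  have 2: "(\<lambda>i. affine_sum \<psi> \<phi> f (\<lambda>x. translate (d i) g x - g x)) \<longlonglongrightarrow> 0"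
  proof (rule null)
    show "(cmod (affine_sum \<psi> \<phi> f (\<lambda>x. translate (d i) g x - g x)))\<^sup>2 \<le>
        (A * energy m f) * (B * energy m (\<lambda>x. translate (d i) g x - g x))" for i
      by (rule affine_sum_bound[OF L2s(1) L2s(6)])
    have "(\<lambda>i. (A * energy m f) * (B * energy m (\<lambda>x. translate (d i) g x - g x))) \<longlonglongrightarrow> (A * energy m f) * (B * 0)"
      by (intro tendsto_mult tendsto_const energy_translate_diff_tendsto_0[OF d g])
    then show "(\<lambda>i. (A * energy m f) * (B * energy m (\<lambda>x. translate (d i) g x - g x))) \<longlonglongrightarrow> 0"
      by simp
  qed
  have "affine_sum \<psi> \<phi> (translate (d i) f) (translate (d i) g) =
      affine_sum \<psi> \<phi> (\<lambda>x. translate (d i) f x - f x) (translate (d i) g) +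
      affine_sum \<psi> \<phi> f (\<lambda>x. translate (d i) g x - g x) + affine_sum \<psi> \<phi> f g" for i
    using affine_sum_diff_left[OF L2s(3) L2s(4) L2s(1), of "d i" "d i"]
      affine_sum_diff_right[OF L2s(1) L2s(4) L2s(2), of "d i"] by simp
  then show ?thesis
    using tendsto_add[OF tendsto_add[OF 1 2] tendsto_const[of "affine_sum \<psi> \<phi> f g"]] by simp
qed

lemma
  assumes f: "f \<in> L2 m" and g: "g \<in> L2 m"
  shows quasi_prodc_summable: "(\<lambda>(j, z). wt j *\<^sub>R prodc \<psi> \<phi> f g j z) summable_on Sigma UNIV LamQ"
    and average_affine_sum_tendsto:
      "(\<lambda>N. (1 / real (q ^ N)) *\<^sub>R (\<Sum>r<q ^ N. affine_sum \<psi> \<phi> (translate (uu r) f) (translate (uu r) g)))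
        \<longlonglongrightarrow> quasi_affine_sum \<psi> \<phi> f g"
proof -
  have bound: "(\<Sum>\<^sub>\<infinity>x\<in>UNIV \<times> Lam. norm (shift (uu r) (prodc \<psi> \<phi> f g) x)) \<le>
      (1 / 2) * (A * energy m f) + (1 / (2 * 1)) * (B * energy m g)" for r
    by (rule order_trans[OF prodc_bound[OF f g zero_less_one]])
       (intro add_mono mult_left_mono bessel_shift_bound bes f g \<psi> \<phi>; simp)+
  have "(\<lambda>(j, z). norm (wt j *\<^sub>R prodc \<psi> \<phi> f g j z)) summable_on Sigma UNIV LamQ"
    by (rule quasi_summable[OF prodc_summable[OF f g] bound])
  then show "(\<lambda>(j, z). wt j *\<^sub>R prodc \<psi> \<phi> f g j z) summable_on Sigma UNIV LamQ"
    by - (rule abs_summable_summable, simp add: case_prod_unfold)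
  have "(\<lambda>N. (1 / 2) * tail \<psi> f N + (1 / 2) * tail \<phi> g N) \<longlonglongrightarrow> (1 / 2) * 0 + (1 / 2) * 0"
    by (intro tendsto_add tendsto_mult tendsto_const tail_tendsto_0[OF bes(1) f \<psi>] tail_tendsto_0[OF bes(2) g \<phi>])
  then have lim: "(\<lambda>N. (1 / 2) * tail \<psi> f N + (1 / 2) * tail \<phi> g N) \<longlonglongrightarrow> 0"
    by simp
  have le: "(1 / real (q ^ N)) * (\<Sum>r<q ^ N. \<Sum>\<^sub>\<infinity>x\<in>{..<- int N} \<times> Lam. norm (shift (uu r) (prodc \<psi> \<phi> f g) x))
      \<le> (1 / 2) * tail \<psi> f N + (1 / 2) * tail \<phi> g N" for N
  proof -
    have "(1 / real (q ^ N)) * (\<Sum>r<q ^ N. \<Sum>\<^sub>\<infinity>x\<in>{..<- int N} \<times> Lam. norm (shift (uu r) (prodc \<psi> \<phi> f g) x))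
      \<le> (1 / real (q ^ N)) * (\<Sum>r<q ^ N. (1 / 2) * (\<Sum>\<^sub>\<infinity>x\<in>{..<- int N} \<times> Lam. (cmod (shift (uu r) (coef \<psi> f) x))\<^sup>2) +
      (1 / (2 * 1)) * (\<Sum>\<^sub>\<infinity>x\<in>{..<- int N} \<times> Lam. (cmod (shift (uu r) (coef \<phi> g) x))\<^sup>2))"
      by (intro mult_left_mono sum_mono prodc_bound[OF f g]) auto
    also have "\<dots> = (1 / 2) * tail \<psi> f N + (1 / 2) * tail \<phi> g N"
      unfolding tail_def sum.distrib sum_distrib_left[symmetric] by (simp add: distrib_left)
    finally show ?thesis .
  qed
  have tail: "(\<lambda>N. (1 / real (q ^ N)) * (\<Sum>r<q ^ N. \<Sum>\<^sub>\<infinity>x\<in>{..<- int N} \<times> Lam. norm (shift (uu r) (prodc \<psi> \<phi> f g) x))) \<longlonglongrightarrow> 0"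
    by (rule Lim_null_comparison[OF _ lim]) (use le in \<open>auto intro!: always_eventually simp: abs_mult sum_nonneg infsum_nonneg\<close>)
  show "(\<lambda>N. (1 / real (q ^ N)) *\<^sub>R (\<Sum>r<q ^ N. affine_sum \<psi> \<phi> (translate (uu r) f) (translate (uu r) g)))
        \<longlonglongrightarrow> quasi_affine_sum \<psi> \<phi> f g"
    unfolding affine_sum_translate[OF f g \<psi> \<phi>] quasi_affine_sum_def
    by (rule average_tendsto[OF prodc_summable[OF f g] bound tail])
qed

text \<open>\<open>infsum\<close> is \<open>0\<close> on families that are not summable, so
  exchanging the iterated sum of the definition for a sum over pairs needs the absolute convergence
  that the two Bessel bounds give.\<close>

lemma affine_sum_eq:
  assumes f: "f \<in> L2 m" and g: "g \<in> L2 m"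
  shows "(\<Sum>\<^sub>\<infinity>j. \<Sum>\<^sub>\<infinity>k. L2_inner m f (affine_elt \<pi> c \<epsilon> \<psi> j k) * L2_inner m (affine_elt \<pi> c \<epsilon> \<phi> j k) g) =
    affine_sum \<psi> \<phi> f g"
proof -
  have "(\<Sum>\<^sub>\<infinity>k. L2_inner m f (affine_elt \<pi> c \<epsilon> \<psi> j k) * L2_inner m (affine_elt \<pi> c \<epsilon> \<phi> j k) g) =
      (\<Sum>\<^sub>\<infinity>z\<in>Lam. prodc \<psi> \<phi> f g j z)" for j
    unfolding Lam_def infsum_reindex[OF inj_uu]
    by (simp add: o_def prodc_def coef_def affine_elt_eq_atom L2_inner_commute[of m _ g])
  then show ?thesis
    unfolding affine_sum_def by (simp add: infsum_Sigma'_banach[OF prodc_summable_0[OF f g]])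
qed

lemma quasi_affine_sum_eq:
  assumes f: "f \<in> L2 m" and g: "g \<in> L2 m"
  shows "(\<Sum>\<^sub>\<infinity>j. \<Sum>\<^sub>\<infinity>k. L2_inner m f (quasi_affine_elt \<pi> c \<epsilon> \<psi> j k) * L2_inner m (quasi_affine_elt \<pi> c \<epsilon> \<phi> j k) g) =
    quasi_affine_sum \<psi> \<phi> f g"
proof -
  have "(\<Sum>\<^sub>\<infinity>k. L2_inner m f (quasi_affine_elt \<pi> c \<epsilon> \<psi> j k) * L2_inner m (quasi_affine_elt \<pi> c \<epsilon> \<phi> j k) g) =
      (\<Sum>\<^sub>\<infinity>z\<in>LamQ j. wt j *\<^sub>R prodc \<psi> \<phi> f g j z)" for j
  proof (cases "j \<ge> 0")
    case True
    then show ?thesis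
      unfolding LamQ_def Lam_def
      by (simp add: infsum_reindex[OF inj_uu] o_def prodc_def coef_def quasi_affine_elt_eq_atom wt_def
          L2_inner_commute[of m _ g])
  next
    case False
    \<comment> \<open>Each of the two inner products carries one factor
      \<open>q powr (j / 2)\<close>; their product is \<open>wt j\<close>.\<close>
    define s where "s = real q powr (j / 2)"
    have s: "wt j = s * s"
      using False by (simp add: wt_def s_def powr_add[symmetric] powr_real_of_int')
    have inner: "L2_inner m h (quasi_affine_elt \<pi> c \<epsilon> \<theta> j k) = of_real s * coef \<theta> h j (\<pi> powi (- j) * uu k)" for h \<theta> k
      using False unfolding coef_def L2_inner_def quasi_affine_elt_eq_atom s_def[symmetric]
      by (simp add: mult.left_commute[of _ "of_real s"])
    have inj: "inj (\<lambda>k. \<pi> powi (- j) * uu k)"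
      using inj_uu by (auto simp: inj_on_def)
    have "LamQ j = range (\<lambda>k. \<pi> powi (- j) * uu k)"
      using False by (auto simp: LamQ_def Lam_def)
    then show ?thesis
      by (simp add: infsum_reindex[OF inj] o_def prodc_def inner L2_inner_commute[of m _ g] s
          scaleR_conv_of_real mult_ac)
  qed
  then show ?thesis
    unfolding quasi_affine_sum_def by (simp add: infsum_Sigma'_banach[OF quasi_prodc_summable[OF f g]])
qed

end

end

theorem theorem3p2:
  fixes m :: "'a::local_field measure"
    and v :: "'a \<Rightarrow> real"
    and \<pi> :: 'a
    and c L :: nat
    and \<epsilon> :: "nat \<Rightarrow> 'a"
    and \<Psi> \<Phi> :: "nat \<Rightarrow> 'a \<Rightarrow> complex"
  assumes "CHAR('a) > 0"
    and "local_field_data m v \<pi> c \<epsilon>"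
    and "\<And>l. l \<in> {1..L} \<Longrightarrow> \<Psi> l \<in> L2 m"
    and "\<And>l. l \<in> {1..L} \<Longrightarrow> \<Phi> l \<in> L2 m"
    and "affine_Bessel_family m \<pi> c \<epsilon> L \<Psi>"
    and "affine_Bessel_family m \<pi> c \<epsilon> L \<Phi>"
  shows "translation_invariant m (affine_op m \<pi> c \<epsilon> L \<Psi> \<Phi>) \<longleftrightarrow>
    (\<forall>f\<in>L2 m. \<forall>g\<in>L2 m.
       affine_op m \<pi> c \<epsilon> L \<Psi> \<Phi> f g = quasi_affine_op m \<pi> c \<epsilon> L \<Psi> \<Phi> f g)"
proof -
  interpret positive_char_local_field m v \<pi> c \<epsilon>
    using assms(1,2) by (intro positive_char_local_field.intro positive_char_local_field_axioms.intro)
  obtain A where A: "\<And>l. l \<in> {1..L} \<Longrightarrow> bessel A (\<Psi> l)"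
    using affine_Bessel_family_imp_bessel[OF assms(5)] by blast
  obtain B where B: "\<And>l. l \<in> {1..L} \<Longrightarrow> bessel B (\<Phi> l)"
    using affine_Bessel_family_imp_bessel[OF assms(6)] by blast
  let ?K = "affine_op m \<pi> c \<epsilon> L \<Psi> \<Phi>"
  let ?Q = "quasi_affine_op m \<pi> c \<epsilon> L \<Psi> \<Phi>"
  have K_eq: "?K f g = (\<Sum>l=1..L. affine_sum (\<Psi> l) (\<Phi> l) f g)" if "f \<in> L2 m" "g \<in> L2 m" for f g
    unfolding affine_op_def using that assms(3,4)
    by (intro sum.cong affine_sum_eq[OF A B]) auto
  have Q_eq: "?Q f g = (\<Sum>l=1..L. quasi_affine_sum (\<Psi> l) (\<Phi> l) f g)" if "f \<in> L2 m" "g \<in> L2 m" for f g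
    unfolding quasi_affine_op_def using that assms(3,4)
    by (intro sum.cong quasi_affine_sum_eq[OF A B]) auto
  show ?thesis
  proof
    assume inv: "translation_invariant m ?K"
    show "\<forall>f\<in>L2 m. \<forall>g\<in>L2 m. ?K f g = ?Q f g"
    proof (intro ballI)
      fix f g assume fg: "f \<in> L2 m" "g \<in> L2 m"
      have "(\<lambda>N. \<Sum>l=1..L. (1 / real (q ^ N)) *\<^sub>R
          (\<Sum>r<q ^ N. affine_sum (\<Psi> l) (\<Phi> l) (translate (uu r) f) (translate (uu r) g))) \<longlonglongrightarrow> ?Q f g"
        unfolding Q_eq[OF fg] using fg assms(3,4)
        by (intro tendsto_sum average_affine_sum_tendsto[OF A B]) auto
      moreover have "(\<Sum>l=1..L. (1 / real (q ^ N)) *\<^sub>R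
          (\<Sum>r<q ^ N. affine_sum (\<Psi> l) (\<Phi> l) (translate (uu r) f) (translate (uu r) g))) = ?K f g" for N
      proof -
        have "(\<Sum>l=1..L. (1 / real (q ^ N)) *\<^sub>R
            (\<Sum>r<q ^ N. affine_sum (\<Psi> l) (\<Phi> l) (translate (uu r) f) (translate (uu r) g))) =
            (1 / real (q ^ N)) *\<^sub>R (\<Sum>r<q ^ N. ?K (translate (uu r) f) (translate (uu r) g))"
          unfolding scaleR_right.sum[symmetric] by (subst sum.swap) (simp add: K_eq L2_translate fg)
        also have "\<dots> = (1 / real (q ^ N)) *\<^sub>R (\<Sum>r<q ^ N. ?K f g)"
          using inv fg by (simp add: translation_invariant_def)
        also have "\<dots> = ?K f g"
          unfolding sum_constant_scaleR by simp
        finally show ?thesis .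
      qed
      ultimately have "(\<lambda>N::nat. ?K f g) \<longlonglongrightarrow> ?Q f g"
        by simp
      then show "?K f g = ?Q f g"
        by (simp add: LIMSEQ_const_iff)
    qed
  next
    assume eq: "\<forall>f\<in>L2 m. \<forall>g\<in>L2 m. ?K f g = ?Q f g"
    have Lam_inv: "?K (translate y f) (translate y g) = ?K f g"
      if "f \<in> L2 m" "g \<in> L2 m" "y \<in> Lam" for f g y
    proof -
      have "?Q (translate y f) (translate y g) = ?Q f g"
        using that assms(3,4) by (simp add: Q_eq L2_translate quasi_affine_sum_translate)
      then show ?thesis
        using eq that by (simp add: L2_translate)
    qed
    have dil: "?K (dilate \<pi> c i f) (dilate \<pi> c i g) = ?K f g" if "f \<in> L2 m" "g \<in> L2 m" for f g i
      using that assms(3,4) by (simp add: K_eq L2_dilate affine_sum_dilate)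
    have dil_inv: "?K (translate (\<pi> powi i * y) f) (translate (\<pi> powi i * y) g) = ?K f g"
      if "f \<in> L2 m" "g \<in> L2 m" "y \<in> Lam" for f g y i
      using that by (simp add: translate_scaled dil Lam_inv L2_dilate L2_translate)
    show "translation_invariant m ?K"
      unfolding translation_invariant_def
    proof (intro allI ballI)
      fix y f g assume fg: "f \<in> L2 m" "g \<in> L2 m"
      \<comment> \<open>Tiling \<open>\<pi> powi (- int i) * y\<close> by \<Lambda> splits
        \<open>y\<close> into a translation under which the operator is already invariant and a
        remainder \<open>d\<close> that tends to \<open>0\<close> as \<open>i\<close> grows.\<close>
      have "\<exists>d. (\<exists>t\<in>RI. d = \<pi> ^ i * t) \<and> (\<exists>z\<in>Lam. y = \<pi> powi (int i) * z + d)" for i :: nat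
      proof -
        obtain z where z: "z \<in> Lam" "\<pi> powi (- int i) * y - z \<in> RI"
          using Lam_tile_exists by blast
        have "y = \<pi> powi (int i) * z + \<pi> ^ i * (\<pi> powi (- int i) * y - z)"
          by (simp add: power_int_minus field_simps)
        then show ?thesis
          using z by blast
      qed
      then obtain d where d: "\<And>i. \<exists>t\<in>RI. d i = \<pi> ^ i * t"
        and dz: "\<And>i. \<exists>z\<in>Lam. y = \<pi> powi (int i) * z + d i"
        by metis
      \<comment> \<open>For every \<open>i\<close> the value at the remainder equals the value at
        \<open>y\<close>; letting \<open>i\<close> grow, continuity identifies it with the
        untranslated value.\<close>
      have const: "?K (translate (d i) f) (translate (d i) g) = ?K (translate y f) (translate y g)" for i
      proof -
        obtain z where z: "z \<in> Lam" "y = \<pi> powi (int i) * z + d i"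
          using dz by blast
        have "translate y h = translate (\<pi> powi (int i) * z) (translate (d i) h)" for h :: "'a \<Rightarrow> complex"
          by (simp add: translate_def z(2) algebra_simps)
        then show ?thesis
          using dil_inv[OF L2_translate[OF fg(1), of "d i"] L2_translate[OF fg(2), of "d i"] z(1), of "int i"]
          by (simp only:)
      qed
      have "(\<lambda>i. \<Sum>l=1..L. affine_sum (\<Psi> l) (\<Phi> l) (translate (d i) f) (translate (d i) g)) \<longlonglongrightarrow> ?K f g"
        unfolding K_eq[OF fg] using fg assms(3,4)
        by (intro tendsto_sum affine_sum_translate_tendsto[OF A B _ _ d]) auto
      then have "(\<lambda>i. ?K (translate (d i) f) (translate (d i) g)) \<longlonglongrightarrow> ?K f g"
        by (simp add: K_eq L2_translate fg)
      then show "?K (translate y f) (translate y g) = ?K f g"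
        unfolding const by (simp add: LIMSEQ_const_iff)
    qed
  qed
qed

end
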